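(* Let $d\ge1$, let $\mathcal H$ be a fixed separable infinite-dimensional Hilbert space, and let $$\mathcal C^d=\{(T_1,\dots,T_d): T_j\in B(\mathcal H),\ \|T_j\|<1 \text{ for } 1\le j\le d\}.$$ Let $\mathcal U$ be a separable Hilbert space, let $\Lambda\subset\mathcal F_d$ be an infinite initial segment, and let $p=\sum_{w\in\Lambda}p_w w$ be a formal power series with coefficients $p_w\in B(\mathcal U)$ such that $p(X)$ converges for every $X\in\mathcal C^d$ and $\|p\|=\sup\{\|p(X)\|:X\in\mathcal C^d\}<\infty$. There exist operators $\tilde x_w\in B(\mathcal U)$ ($w\in\mathcal F_d$) and a formal power series $\tilde x=\sum_{w\in\mathcal F_d}\tilde x_w w$ such that $\tilde x_w=p_w$ for all $w\in\Lambda$ and $$\|\tilde x\|=\sup\{\|p(T)\| : T\in\mathcal C^d,\ T\text{ is }\Lambda\text{-nilpotent}\}.$$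
   Context: $\mathcal F_d$ is the free semigroup of words in $g_1,\dots,g_d$ with identity the empty word $\emptyset$; $|w|$ is the length of $w$. For $w=g_{i_1}\cdots g_{i_k}$ and a $d$-tuple $T$ of operators, $T^w=T_{i_1}\cdots T_{i_k}$ and $T^\emptyset=I$. For a formal power series $f=\sum_{w\in\mathcal F_d}f_w w$ with $f_w\in B(\mathcal U)$ (a series over $\Lambda$ is one with $f_w=0$ for $w\notin\Lambda$), $f(T)=\sum_{j=0}^\infty\sum_{|w|=j}f_w\otimes T^w$, the sum over $j$ converging in operator norm. $\|f\|=\sup\{\|f(T)\|:T\in\mathcal C^d\}$ (the assertion about $\|\tilde x\|$ includes that $\tilde x(T)$ converges for every $T\in\mathcal C^d$). A set $\Lambda\subset\mathcal F_d$ is an initial segment if for every $w\in\mathcal F_d\setminus\Lambda$ and $1\le j\le d$ both $g_jw$ and $wg_j$ lie in $\mathcal F_d\setminus\Lambda$. A tuple $T$ is $\Lambda$-nilpotent if $T^v=0$ for all $v\in\mathcal F_d\setminus\Lambda$. *)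

theory Defs
  imports "HOL-Analysis.Analysis"
begin

section \<open>Complex Hilbert spaces\<close>

text \<open>
  The real structure of a complex Hilbert space (norm, topology, \<^const>\<open>scaleR\<close>, \<^const>\<open>inner\<close>) is
  tied to the complex one by the axioms, so the whole library for real inner product spaces applies.
  Positivity of \<open>cinner\<close> and the identity \<open>norm x = sqrt (Re (cinner x x))\<close> follow from
  \<^class>\<open>real_inner\<close>; \<open>cinner\<close> is linear in its first argument.
\<close>

class complex_hilbert = real_inner + complete_space +
  fixes scaleC :: "complex \<Rightarrow> 'a \<Rightarrow> 'a" (infixr \<open>*\<^sub>C\<close> 75)
    and cinner :: "'a \<Rightarrow> 'a \<Rightarrow> complex"
  assumes scaleC_add_right: "a *\<^sub>C (x + y) = a *\<^sub>C x + a *\<^sub>C y"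
    and scaleC_add_left: "(a + b) *\<^sub>C x = a *\<^sub>C x + b *\<^sub>C x"
    and scaleC_scaleC: "a *\<^sub>C b *\<^sub>C x = (a * b) *\<^sub>C x"
    and scaleC_of_real: "complex_of_real r *\<^sub>C x = scaleR r x"
    and cinner_commute: "cinner x y = cnj (cinner y x)"
    and cinner_add_left: "cinner (x + y) z = cinner x z + cinner y z"
    and cinner_scaleC_left: "cinner (a *\<^sub>C x) y = a * cinner x y"
    and Re_cinner: "Re (cinner x y) = inner x y"

subclass (in complex_hilbert) banach
  by standard

instantiation complex :: complex_hilbert
begin
definition scaleC_complex :: "complex \<Rightarrow> complex \<Rightarrow> complex" where "scaleC_complex a x = a * x"
definition cinner_complex :: "complex \<Rightarrow> complex \<Rightarrow> complex" where "cinner_complex x y = x * cnj y"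
instance
  by standard
    (simp_all add: scaleC_complex_def cinner_complex_def inner_complex_def algebra_simps
      scaleR_conv_of_real)
end

global_interpretation cvec: vector_space "scaleC :: complex \<Rightarrow> 'a::complex_hilbert \<Rightarrow> 'a"
  defines cspan = cvec.span
proof
  fix x :: 'a
  show "1 *\<^sub>C x = x"
    using scaleC_of_real[of 1 x] by simp
qed (simp_all add: scaleC_add_right scaleC_add_left scaleC_scaleC)

definition infinite_dimensional :: "'a::complex_hilbert itself \<Rightarrow> bool" where
  "infinite_dimensional _ \<longleftrightarrow> \<not> (\<exists>B :: 'a set. finite B \<and> cspan B = UNIV)"

text \<open>
  $B(\mathcal H)$: the members of the library type of bounded real-linear operators that are
  complex-linear. The norm of that type is the operator norm.
\<close>

definition clinear_ops :: "('a::complex_hilbert \<Rightarrow>\<^sub>L 'a) set" where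
  "clinear_ops = {A. \<forall>c x. blinfun_apply A (c *\<^sub>C x) = c *\<^sub>C blinfun_apply A x}"


section \<open>Hilbert space tensor products\<close>

text \<open>
  \<open>hilbert_tensor \<tau>\<close> says that the type \<open>'k\<close> with \<open>u \<otimes> h = \<tau> u h\<close> is a Hilbert space tensor product
  of \<open>'u\<close> and \<open>'h\<close>; any two such are unitarily equivalent by a map respecting \<open>\<tau>\<close>.
\<close>

definition hilbert_tensor ::
    "('u::complex_hilbert \<Rightarrow> 'h::complex_hilbert \<Rightarrow> 'k::complex_hilbert) \<Rightarrow> bool" where
  "hilbert_tensor \<tau> \<longleftrightarrow>
     (\<forall>u u' h. \<tau> (u + u') h = \<tau> u h + \<tau> u' h) \<and>
     (\<forall>u h h'. \<tau> u (h + h') = \<tau> u h + \<tau> u h') \<and>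
     (\<forall>c u h. \<tau> (c *\<^sub>C u) h = c *\<^sub>C \<tau> u h) \<and>
     (\<forall>c u h. \<tau> u (c *\<^sub>C h) = c *\<^sub>C \<tau> u h) \<and>
     (\<forall>u u' h h'. cinner (\<tau> u h) (\<tau> u' h') = cinner u u' * cinner h h') \<and>
     closure (cspan {\<tau> u h | u h. True}) = UNIV"

text \<open>
  The operator $A \otimes B$ on the tensor product. That it exists for complex-linear \<open>A\<close> and \<open>B\<close>
  is lemma \<open>tensor_op_apply\<close> below.
\<close>

definition tensor_op ::
    "('u::complex_hilbert \<Rightarrow> 'h::complex_hilbert \<Rightarrow> 'k::complex_hilbert) \<Rightarrow>
     ('u \<Rightarrow>\<^sub>L 'u) \<Rightarrow> ('h \<Rightarrow>\<^sub>L 'h) \<Rightarrow> ('k \<Rightarrow>\<^sub>L 'k)" where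
  "tensor_op \<tau> A B =
     (THE C. C \<in> clinear_ops \<and>
        (\<forall>u h. blinfun_apply C (\<tau> u h) = \<tau> (blinfun_apply A u) (blinfun_apply B h)))"


section \<open>Words, power series and their evaluation\<close>

text \<open>
  The letters $g_1,\dots,g_d$ are the elements of a finite type \<open>'d\<close>, so that $\mathcal F_d$ is
  the type \<open>'d list\<close> and $d$-tuples are functions on \<open>'d\<close>.
\<close>

definition initial_segment :: "'d list set \<Rightarrow> bool" where
  "initial_segment \<Lambda> \<longleftrightarrow> (\<forall>w j. w \<notin> \<Lambda> \<longrightarrow> j # w \<notin> \<Lambda> \<and> w @ [j] \<notin> \<Lambda>)"

primrec word_op :: "('d \<Rightarrow> 'h::real_normed_vector \<Rightarrow>\<^sub>L 'h) \<Rightarrow> 'd list \<Rightarrow> 'h \<Rightarrow>\<^sub>L 'h" where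
  "word_op T [] = id_blinfun"
| "word_op T (j # w) = T j o\<^sub>L word_op T w"

definition nilpotent_tuple :: "'d list set \<Rightarrow> ('d \<Rightarrow> 'h::real_normed_vector \<Rightarrow>\<^sub>L 'h) \<Rightarrow> bool" where
  "nilpotent_tuple \<Lambda> T \<longleftrightarrow> (\<forall>v. v \<notin> \<Lambda> \<longrightarrow> word_op T v = 0)"

definition polydisc :: "('d \<Rightarrow> 'h::complex_hilbert \<Rightarrow>\<^sub>L 'h) set" where
  "polydisc = {T. \<forall>j. T j \<in> clinear_ops \<and> norm (T j) < 1}"

definition homogeneous_part ::
    "('u::complex_hilbert \<Rightarrow> 'h::complex_hilbert \<Rightarrow> 'k::complex_hilbert) \<Rightarrow>
     ('d::finite list \<Rightarrow> 'u \<Rightarrow>\<^sub>L 'u) \<Rightarrow> ('d \<Rightarrow> 'h \<Rightarrow>\<^sub>L 'h) \<Rightarrow> nat \<Rightarrow> 'k \<Rightarrow>\<^sub>L 'k" where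
  "homogeneous_part \<tau> f T j = (\<Sum>w | length w = j. tensor_op \<tau> (f w) (word_op T w))"

definition series_converges ::
    "('u::complex_hilbert \<Rightarrow> 'h::complex_hilbert \<Rightarrow> 'k::complex_hilbert) \<Rightarrow>
     ('d::finite list \<Rightarrow> 'u \<Rightarrow>\<^sub>L 'u) \<Rightarrow> ('d \<Rightarrow> 'h \<Rightarrow>\<^sub>L 'h) \<Rightarrow> bool" where
  "series_converges \<tau> f T \<longleftrightarrow> summable (homogeneous_part \<tau> f T)"

definition series_eval ::
    "('u::complex_hilbert \<Rightarrow> 'h::complex_hilbert \<Rightarrow> 'k::complex_hilbert) \<Rightarrow>
     ('d::finite list \<Rightarrow> 'u \<Rightarrow>\<^sub>L 'u) \<Rightarrow> ('d \<Rightarrow> 'h \<Rightarrow>\<^sub>L 'h) \<Rightarrow> 'k \<Rightarrow>\<^sub>L 'k" where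
  "series_eval \<tau> f T = (\<Sum>j. homogeneous_part \<tau> f T j)"

text \<open>
  Suprema of norms are taken in $[0,\infty]$, where they always exist. \<open>series_norm\<close> is meaningful
  only for series that converge at every point of the polydisc.
\<close>

definition series_norm ::
    "('u::complex_hilbert \<Rightarrow> 'h::complex_hilbert \<Rightarrow> 'k::complex_hilbert) \<Rightarrow>
     ('d::finite list \<Rightarrow> 'u \<Rightarrow>\<^sub>L 'u) \<Rightarrow> ennreal" where
  "series_norm \<tau> f = (SUP T\<in>polydisc. ennreal (norm (series_eval \<tau> f T)))"


section \<open>Existence and uniqueness of tensor products of operators\<close>

lemma clinear_opsD: "A \<in> clinear_ops \<Longrightarrow> blinfun_apply A (c *\<^sub>C x) = c *\<^sub>C blinfun_apply A x"
  by (simp add: clinear_ops_def)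

lemma cinner_add_right: "cinner x (y + z) = cinner x y + cinner x (z::'a::complex_hilbert)"
  by (metis cinner_add_left cinner_commute complex_cnj_add)

lemma cinner_scaleC_right: "cinner x (a *\<^sub>C y) = cnj a * cinner x (y::'a::complex_hilbert)"
  by (metis cinner_commute cinner_scaleC_left complex_cnj_mult)

lemma cinner_zero_left [simp]: "cinner 0 (x::'a::complex_hilbert) = 0"
  using cinner_add_left[of 0 0 x] by simp

lemma cinner_sum_left: "cinner (sum f S) (x::'a::complex_hilbert) = (\<Sum>i\<in>S. cinner (f i) x)"
  by (induction S rule: infinite_finite_induct) (auto simp: cinner_add_left)

lemma cinner_diff_left: "cinner (x - y) (z::'a::complex_hilbert) = cinner x z - cinner y z"
  using cinner_add_left[of "x - y" y z] by (simp add: algebra_simps)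

lemma cinner_self: "cinner x x = complex_of_real ((norm (x::'a::complex_hilbert))\<^sup>2)"
proof (rule complex_eqI)
  show "Re (cinner x x) = Re (complex_of_real ((norm x)\<^sup>2))"
    by (simp add: Re_cinner power2_norm_eq_inner)
  have "cinner x x = cnj (cinner x x)"
    by (rule cinner_commute)
  then show "Im (cinner x x) = Im (complex_of_real ((norm x)\<^sup>2))"
    by (metis Im_complex_of_real Reals_cnj_iff complex_is_Real_iff)
qed

lemma norm_scaleC: "norm (a *\<^sub>C x) = cmod a * norm (x::'a::complex_hilbert)"
proof -
  have "complex_of_real ((norm (a *\<^sub>C x))\<^sup>2) = a * (cnj a * cinner x x)"
    by (simp only: cinner_self[symmetric] cinner_scaleC_left cinner_scaleC_right mult.left_commute)
  also have "\<dots> = complex_of_real ((cmod a)\<^sup>2) * complex_of_real ((norm x)\<^sup>2)"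
    by (simp only: complex_norm_square cinner_self mult.assoc)
  finally have "(norm (a *\<^sub>C x))\<^sup>2 = (cmod a * norm x)\<^sup>2"
    by (metis of_real_eq_iff of_real_mult power_mult_distrib)
  then show ?thesis
    by (meson mult_nonneg_nonneg norm_ge_zero power2_eq_imp_eq)
qed

context
  fixes \<tau> :: "'u::complex_hilbert \<Rightarrow> 'h::complex_hilbert \<Rightarrow> 'k::complex_hilbert"
  assumes tau: "hilbert_tensor \<tau>"
begin

lemma tau_add_left: "\<tau> (u + u') h = \<tau> u h + \<tau> u' h"
  and tau_add_right: "\<tau> u (h + h') = \<tau> u h + \<tau> u h'"
  and tau_scale_left: "\<tau> (c *\<^sub>C u) h = c *\<^sub>C \<tau> u h"
  and tau_scale_right: "\<tau> u (c *\<^sub>C h) = c *\<^sub>C \<tau> u h"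
  and tau_cinner: "cinner (\<tau> u h) (\<tau> u' h') = cinner u u' * cinner h h'"
  and tau_dense: "closure (cspan {\<tau> u h | u h. True}) = UNIV"
  using tau unfolding hilbert_tensor_def by blast+

lemma tau_zero_left [simp]: "\<tau> 0 h = 0"
  using tau_add_left[of 0 0 h] by simp

lemma tau_zero_right [simp]: "\<tau> u 0 = 0"
  using tau_add_right[of u 0 0] by simp

lemma tau_sum_right: "\<tau> u (sum f S) = (\<Sum>i\<in>S. \<tau> u (f i))"
  by (induction S rule: infinite_finite_induct) (auto simp: tau_add_right)

lemma norm_tau: "norm (\<tau> u h) = norm u * norm h"
proof -
  have "complex_of_real ((norm (\<tau> u h))\<^sup>2) = complex_of_real ((norm u * norm h)\<^sup>2)"
    unfolding cinner_self[symmetric] tau_cinner by (simp add: cinner_self power_mult_distrib)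
  then have "(norm (\<tau> u h))\<^sup>2 = (norm u * norm h)\<^sup>2"
    using of_real_eq_iff by blast
  then show ?thesis
    by (meson mult_nonneg_nonneg norm_ge_zero power2_eq_imp_eq)
qed

lemma orthonormal_rewrite:
  "\<exists>E v. finite E \<and> (\<forall>e\<in>E. \<forall>e'\<in>E. cinner e e' = (if e = e' then 1 else 0)) \<and>
     (\<forall>A\<in>clinear_ops. (\<Sum>(u, h)\<leftarrow>xs. \<tau> (blinfun_apply A u) h)
        = (\<Sum>e\<in>E. \<tau> (blinfun_apply A (v e)) e))"
proof (induction xs)
  case Nil
  then show ?case
    by (intro exI[of _ "{}"]) auto
next
  case (Cons x xs)
  obtain u h where x: "x = (u, h)"
    by (cases x)
  from Cons obtain E v where E: "finite E"
    and on: "\<And>e e'. e \<in> E \<Longrightarrow> e' \<in> E \<Longrightarrow> cinner e e' = (if e = e' then 1 else 0)"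
    and eq: "\<And>A. A \<in> clinear_ops \<Longrightarrow> (\<Sum>(u, h)\<leftarrow>xs. \<tau> (blinfun_apply A u) h)
        = (\<Sum>e\<in>E. \<tau> (blinfun_apply A (v e)) e)"
    by blast
  define r where "r = h - (\<Sum>e\<in>E. cinner h e *\<^sub>C e)"
  have h: "h = r + (\<Sum>e\<in>E. cinner h e *\<^sub>C e)"
    by (simp add: r_def)
  have r_orth: "cinner r e = 0" if "e \<in> E" for e
  proof -
    have "(\<Sum>e'\<in>E. cinner h e' * cinner e' e) = (\<Sum>e'\<in>E. if e' = e then cinner h e' else 0)"
      by (rule sum.cong) (auto simp: on that)
    also have "\<dots> = cinner h e"
      using E that by simp
    finally show ?thesis
      by (simp add: r_def cinner_diff_left cinner_sum_left cinner_scaleC_left)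
  qed
  define v1 where "v1 = (\<lambda>e. v e + cinner h e *\<^sub>C u)"
  have step: "(\<Sum>(u, h)\<leftarrow>x # xs. \<tau> (blinfun_apply A u) h)
      = \<tau> (blinfun_apply A u) r + (\<Sum>e\<in>E. \<tau> (blinfun_apply A (v1 e)) e)"
    if A: "A \<in> clinear_ops" for A
  proof -
    have "\<tau> (blinfun_apply A u) h
        = \<tau> (blinfun_apply A u) r + (\<Sum>e\<in>E. \<tau> (blinfun_apply A (cinner h e *\<^sub>C u)) e)"
      by (subst h) (simp add: tau_add_right tau_sum_right tau_scale_right tau_scale_left
          clinear_opsD[OF A])
    then show ?thesis
      by (simp add: x eq[OF A] v1_def blinfun.add_right tau_add_left sum.distrib)
  qed
  show ?case
  proof (cases "r = 0")
    case True
    then show ?thesis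
      using E on step by (intro exI[of _ E] exI[of _ v1]) simp
  next
    case False
    define e0 where "e0 = complex_of_real (inverse (norm r)) *\<^sub>C r"
    have r: "r = complex_of_real (norm r) *\<^sub>C e0"
      using False by (simp add: e0_def scaleC_of_real del: of_real_inverse)
    have e0e0: "cinner e0 e0 = 1"
      using False by (simp add: cinner_self e0_def scaleC_of_real del: of_real_inverse)
    have e0E: "cinner e0 e = 0" "cinner e e0 = 0" if "e \<in> E" for e
      using r_orth[OF that] cinner_commute[of e e0] by (simp_all add: e0_def cinner_scaleC_left)
    have notin: "e0 \<notin> E"
      using e0E(1) e0e0 by fastforce
    define v2 where "v2 = v1(e0 := complex_of_real (norm r) *\<^sub>C u)"
    have "(\<Sum>(u, h)\<leftarrow>x # xs. \<tau> (blinfun_apply A u) h)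
        = (\<Sum>e\<in>insert e0 E. \<tau> (blinfun_apply A (v2 e)) e)" if A: "A \<in> clinear_ops" for A
    proof -
      have "\<tau> (blinfun_apply A u) r = \<tau> (blinfun_apply A (v2 e0)) e0"
        by (subst r) (simp add: v2_def tau_scale_left tau_scale_right clinear_opsD[OF A])
      moreover have "(\<Sum>e\<in>E. \<tau> (blinfun_apply A (v1 e)) e) = (\<Sum>e\<in>E. \<tau> (blinfun_apply A (v2 e)) e)"
        using notin by (intro sum.cong) (auto simp: v2_def)
      ultimately show ?thesis
        unfolding step[OF A] using E notin by simp
    qed
    moreover have "\<forall>e\<in>insert e0 E. \<forall>e'\<in>insert e0 E. cinner e e' = (if e = e' then 1 else 0)"
      using on e0e0 e0E notin by auto
    ultimately show ?thesis
      using E by (intro exI[of _ "insert e0 E"] exI[of _ v2]) blast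
  qed
qed

lemma id_clinear: "id_blinfun \<in> clinear_ops"
  by (simp add: clinear_ops_def)

lemma left_factor_bound:
  assumes A: "A \<in> clinear_ops"
  shows "norm (\<Sum>(u, h)\<leftarrow>xs. \<tau> (blinfun_apply A u) h) \<le> norm A * norm (\<Sum>(u, h)\<leftarrow>xs. \<tau> u h)"
proof -
  obtain E v where E: "finite E"
    and on: "\<And>e e'. e \<in> E \<Longrightarrow> e' \<in> E \<Longrightarrow> cinner e e' = (if e = e' then 1 else 0)"
    and eq: "\<And>A. A \<in> clinear_ops \<Longrightarrow> (\<Sum>(u, h)\<leftarrow>xs. \<tau> (blinfun_apply A u) h)
        = (\<Sum>e\<in>E. \<tau> (blinfun_apply A (v e)) e)"
    using orthonormal_rewrite[of xs] by blast
  have n1: "norm e = 1" if "e \<in> E" for e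
    using on[OF that that] cinner_self[of e] by (metis of_real_eq_1_iff norm_ge_zero
        power2_eq_1_iff le_minus_one_simps(3))
  have pyth: "(norm (\<Sum>e\<in>E. \<tau> (w e) e))\<^sup>2 = (\<Sum>e\<in>E. (norm (w e))\<^sup>2)" for w
  proof -
    have "(norm (\<Sum>e\<in>E. \<tau> (w e) e))\<^sup>2 = (\<Sum>e\<in>E. (norm (\<tau> (w e) e))\<^sup>2)"
      using E
    proof (rule norm_sum_Pythagorean)
      show "pairwise (\<lambda>i j. orthogonal (\<tau> (w i) i) (\<tau> (w j) j)) E"
        by (auto simp: pairwise_def orthogonal_def tau_cinner on simp flip: Re_cinner)
    qed
    then show ?thesis
      by (simp add: norm_tau n1)
  qed
  have "(norm (\<Sum>(u, h)\<leftarrow>xs. \<tau> (blinfun_apply A u) h))\<^sup>2 = (\<Sum>e\<in>E. (norm (blinfun_apply A (v e)))\<^sup>2)"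
    by (simp add: eq[OF A] pyth)
  also have "\<dots> \<le> (\<Sum>e\<in>E. (norm A * norm (v e))\<^sup>2)"
    by (intro sum_mono power_mono norm_blinfun) auto
  also have "\<dots> = (norm A)\<^sup>2 * (\<Sum>e\<in>E. (norm (v e))\<^sup>2)"
    by (simp add: power_mult_distrib sum_distrib_left)
  also have "\<dots> = (norm A)\<^sup>2 * (norm (\<Sum>(u, h)\<leftarrow>xs. \<tau> u h))\<^sup>2"
    using eq[OF id_clinear] by (simp add: pyth)
  finally show ?thesis
    by (metis power_mult_distrib power2_le_imp_le mult_nonneg_nonneg norm_ge_zero)
qed

end

lemma hilbert_tensor_scalar: "hilbert_tensor (scaleC :: complex \<Rightarrow> 'h::complex_hilbert \<Rightarrow> 'h)"
proof -
  have "x \<in> {u *\<^sub>C h | u h. True}" for x :: 'h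
    using cvec.scale_one[of x] by (metis (mono_tags, lifting) mem_Collect_eq)
  then have "{u *\<^sub>C h | u (h::'h). True} = UNIV"
    by blast
  then show ?thesis
    unfolding hilbert_tensor_def
    by (simp add: scaleC_add_left scaleC_add_right scaleC_scaleC cinner_scaleC_left cinner_scaleC_right
        scaleC_complex_def cinner_complex_def algebra_simps)
qed

lemma hilbert_tensor_swap:
  assumes "hilbert_tensor \<tau>"
  shows "hilbert_tensor (\<lambda>h u. \<tau> u h)"
proof -
  have "{\<tau> u h | h u. True} = {\<tau> u h | u h. True}"
    by blast
  then show ?thesis
    using assms unfolding hilbert_tensor_def by (simp add: mult.commute)
qed

lemma tensor_bound:
  assumes tau: "hilbert_tensor \<tau>" and A: "A \<in> clinear_ops" and B: "B \<in> clinear_ops"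
  shows "norm (\<Sum>(u, h)\<leftarrow>xs. \<tau> (blinfun_apply A u) (blinfun_apply B h))
    \<le> norm A * norm B * norm (\<Sum>(u, h)\<leftarrow>xs. \<tau> u h)"
proof -
  let ?ys = "map (\<lambda>(u, h). (u, blinfun_apply B h)) xs"
  let ?zs = "map (\<lambda>(u, h). (h, u)) xs"
  have "(\<Sum>(u, h)\<leftarrow>xs. \<tau> (blinfun_apply A u) (blinfun_apply B h))
      = (\<Sum>(u, h)\<leftarrow>?ys. \<tau> (blinfun_apply A u) h)"
    by (simp add: o_def case_prod_unfold)
  then have "norm (\<Sum>(u, h)\<leftarrow>xs. \<tau> (blinfun_apply A u) (blinfun_apply B h))
      \<le> norm A * norm (\<Sum>(u, h)\<leftarrow>?ys. \<tau> u h)"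
    using left_factor_bound[OF tau A, of ?ys] by metis
  also have "(\<Sum>(u, h)\<leftarrow>?ys. \<tau> u h) = (\<Sum>(h, u)\<leftarrow>?zs. \<tau> u (blinfun_apply B h))"
    by (simp add: o_def case_prod_unfold)
  also have "norm A * norm (\<Sum>(h, u)\<leftarrow>?zs. \<tau> u (blinfun_apply B h))
      \<le> norm A * (norm B * norm (\<Sum>(h, u)\<leftarrow>?zs. \<tau> u h))"
    by (intro mult_left_mono left_factor_bound[OF hilbert_tensor_swap[OF tau] B]) simp
  also have "(\<Sum>(h, u)\<leftarrow>?zs. \<tau> u h) = (\<Sum>(u, h)\<leftarrow>xs. \<tau> u h)"
    by (simp add: o_def case_prod_unfold)
  finally show ?thesis
    by (simp add: mult.assoc)
qed

lemma tensor_cspan: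
  assumes tau: "hilbert_tensor \<tau>"
  shows "cspan {\<tau> u h | u h. True} = range (\<lambda>xs. \<Sum>(u, h)\<leftarrow>xs. \<tau> u h)"
proof (rule cvec.span_unique)
  show "{\<tau> u h | u h. True} \<subseteq> range (\<lambda>xs. \<Sum>(u, h)\<leftarrow>xs. \<tau> u h)"
  proof clarify
    fix u h
    show "\<tau> u h \<in> range (\<lambda>xs. \<Sum>(u, h)\<leftarrow>xs. \<tau> u h)"
      by (intro range_eqI[of _ _ "[(u, h)]"]) simp
  qed
next
  show "cvec.subspace (range (\<lambda>xs. \<Sum>(u, h)\<leftarrow>xs. \<tau> u h))"
    unfolding cvec.subspace_def
  proof safe
    show "0 \<in> range (\<lambda>xs. \<Sum>(u, h)\<leftarrow>xs. \<tau> u h)"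
      by (intro range_eqI[of _ _ "[]"]) simp
  next
    fix xs ys
    show "(\<Sum>(u, h)\<leftarrow>xs. \<tau> u h) + (\<Sum>(u, h)\<leftarrow>ys. \<tau> u h) \<in> range (\<lambda>xs. \<Sum>(u, h)\<leftarrow>xs. \<tau> u h)"
      by (intro range_eqI[of _ _ "xs @ ys"]) simp
  next
    fix c xs
    have "c *\<^sub>C (\<Sum>(u, h)\<leftarrow>xs. \<tau> u h) = (\<Sum>(u, h)\<leftarrow>map (\<lambda>(u, h). (c *\<^sub>C u, h)) xs. \<tau> u h)"
      by (induction xs) (auto simp: scaleC_add_right tau_scale_left[OF tau] o_def)
    then show "c *\<^sub>C (\<Sum>(u, h)\<leftarrow>xs. \<tau> u h) \<in> range (\<lambda>xs. \<Sum>(u, h)\<leftarrow>xs. \<tau> u h)"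
      by blast
  qed
next
  fix T :: "'c set"
  assume T: "{\<tau> u h | u h. True} \<subseteq> T" "cvec.subspace T"
  have "(\<Sum>(u, h)\<leftarrow>xs. \<tau> u h) \<in> T" for xs
    using T by (induction xs) (auto simp: cvec.subspace_def)
  then show "range (\<lambda>xs. \<Sum>(u, h)\<leftarrow>xs. \<tau> u h) \<subseteq> T"
    by blast
qed

lemma tensor_op_unique:
  assumes tau: "hilbert_tensor \<tau>"
    and eq: "\<And>u h. blinfun_apply C (\<tau> u h) = blinfun_apply D (\<tau> u h)"
  shows "C = D"
proof (rule blinfun_eqI)
  fix x
  let ?X = "range (\<lambda>xs. \<Sum>(u, h)\<leftarrow>xs. \<tau> u h)"
  have "blinfun_apply C (\<Sum>(u, h)\<leftarrow>xs. \<tau> u h) = blinfun_apply D (\<Sum>(u, h)\<leftarrow>xs. \<tau> u h)" for xs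
    by (induction xs) (auto simp: blinfun.add_right eq)
  then have "?X \<subseteq> {x. blinfun_apply C x = blinfun_apply D x}"
    by auto
  moreover have "closed {x. blinfun_apply C x = blinfun_apply D x}"
    by (intro closed_Collect_eq continuous_intros)
  ultimately have "closure ?X \<subseteq> {x. blinfun_apply C x = blinfun_apply D x}"
    by (rule closure_minimal)
  then show "blinfun_apply C x = blinfun_apply D x"
    using tau_dense[OF tau] tensor_cspan[OF tau] by auto
qed

lemma tensor_op_exists:
  assumes tau: "hilbert_tensor \<tau>" and A: "A \<in> clinear_ops" and B: "B \<in> clinear_ops"
  shows "\<exists>C\<in>clinear_ops. \<forall>u h. blinfun_apply C (\<tau> u h) = \<tau> (blinfun_apply A u) (blinfun_apply B h)"
proof -
  let ?s = "\<lambda>xs. \<Sum>(u, h)\<leftarrow>xs. \<tau> u h"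
  let ?t = "\<lambda>xs. \<Sum>(u, h)\<leftarrow>xs. \<tau> (blinfun_apply A u) (blinfun_apply B h)"
  let ?sc = "\<lambda>c. map (\<lambda>(u, h). (c *\<^sub>C u, h))"
  define M where "M = norm A * norm B"
  have M: "M \<ge> 0"
    by (simp add: M_def)
  have s_scale: "?s (?sc c xs) = c *\<^sub>C ?s xs" and t_scale: "?t (?sc c xs) = c *\<^sub>C ?t xs" for c xs
    by (induction xs)
      (auto simp: scaleC_add_right tau_scale_left[OF tau] clinear_opsD[OF A] o_def)
  have m1: "(-1) *\<^sub>C x = - x" for x :: "'c"
    using scaleC_of_real[of "-1" x] by simp
  have lip: "norm (?t xs - ?t ys) \<le> M * norm (?s xs - ?s ys)" for xs ys
  proof -
    have "?t xs - ?t ys = ?t (xs @ ?sc (-1) ys)" "?s xs - ?s ys = ?s (xs @ ?sc (-1) ys)"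
      unfolding map_append sum_list_append s_scale t_scale m1 by simp_all
    then show ?thesis
      using tensor_bound[OF tau A B, of "xs @ ?sc (-1) ys"] by (simp only: M_def)
  qed
  define X where "X = range ?s"
  define f where "f = (\<lambda>x. ?t (SOME xs. ?s xs = x))"
  have f: "f (?s xs) = ?t xs" for xs
  proof -
    have "?s (SOME ys. ?s ys = ?s xs) = ?s xs"
      by (rule someI) (rule refl)
    then have "norm (f (?s xs) - ?t xs) \<le> 0"
      using lip[of "SOME ys. ?s ys = ?s xs" xs] unfolding f_def by simp
    then show ?thesis
      by simp
  qed
  have "M-lipschitz_on X f"
    unfolding X_def using lip M by (auto intro!: lipschitz_onI simp: f dist_norm)
  then obtain g where g: "uniformly_continuous_on (closure X) g" and fg: "\<And>x. x \<in> X \<Longrightarrow> f x = g x"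
    using uniformly_continuous_on_extension_on_closure[OF lipschitz_on_uniformly_continuous]
    by metis
  have X: "closure X = UNIV"
    using tau_dense[OF tau] tensor_cspan[OF tau] by (simp add: X_def)
  have cont: "continuous_on UNIV g"
    using uniformly_continuous_imp_continuous[OF g] by (simp add: X)
  have gs: "g (?s xs) = ?t xs" for xs
    using fg[of "?s xs"] f[of xs] by (simp add: X_def)
  have cont_comp: "continuous_on UNIV (\<lambda>x. g (p x))" if "continuous_on UNIV p"
    for p :: "'z::topological_space \<Rightarrow> 'c"
    using continuous_on_compose2[OF cont that] by simp
  have add: "g (x + y) = g x + g y" for x y
  proof -
    have "closure (X \<times> X) \<subseteq> {z. g (fst z + snd z) = g (fst z) + g (snd z)}"
    proof (rule closure_minimal)
      show "X \<times> X \<subseteq> {z. g (fst z + snd z) = g (fst z) + g (snd z)}"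
      proof clarsimp
        fix x y assume "x \<in> X" "y \<in> X"
        then obtain xs ys where "x = ?s xs" "y = ?s ys"
          by (auto simp: X_def)
        then show "g (x + y) = g x + g y"
          using gs[of "xs @ ys"] gs[of xs] gs[of ys] by simp
      qed
      show "closed {z. g (fst z + snd z) = g (fst z) + g (snd z)}"
        by (intro closed_Collect_eq continuous_on_add cont_comp continuous_intros)
    qed
    moreover have "(x, y) \<in> closure (X \<times> X)"
      by (simp add: closure_Times X)
    ultimately have "(x, y) \<in> {z. g (fst z + snd z) = g (fst z) + g (snd z)}"
      by (rule subsetD)
    then show ?thesis
      by simp
  qed
  have "bounded_linear (\<lambda>x::'c. c *\<^sub>C x)" for c
    by (rule bounded_linear_intro[of _ "cmod c"])
      (auto simp: scaleC_add_right norm_scaleC mult.commute scaleC_scaleC simp flip: scaleC_of_real)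
  then have cont_scale: "continuous_on UNIV (\<lambda>x::'c. c *\<^sub>C x)" for c
    by (rule linear_continuous_on)
  have scale: "g (c *\<^sub>C x) = c *\<^sub>C g x" for c x
  proof -
    have "closure X \<subseteq> {x. g (c *\<^sub>C x) = c *\<^sub>C g x}"
    proof (rule closure_minimal)
      show "X \<subseteq> {x. g (c *\<^sub>C x) = c *\<^sub>C g x}"
      proof clarsimp
        fix x assume "x \<in> X"
        then obtain xs where "x = ?s xs"
          by (auto simp: X_def)
        then show "g (c *\<^sub>C x) = c *\<^sub>C g x"
          using gs[of "?sc c xs"] gs[of xs] unfolding s_scale t_scale by simp
      qed
      show "closed {x. g (c *\<^sub>C x) = c *\<^sub>C g x}"
        by (intro closed_Collect_eq cont_comp cont_scale continuous_on_compose2[OF cont_scale cont]) simp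
    qed
    then show ?thesis
      by (auto simp: X)
  qed
  have bound: "norm (g x) \<le> norm x * M" for x
  proof -
    have "closure X \<subseteq> {x. norm (g x) \<le> norm x * M}"
    proof (rule closure_minimal)
      show "X \<subseteq> {x. norm (g x) \<le> norm x * M}"
        using tensor_bound[OF tau A B] by (auto simp: X_def gs M_def mult.commute)
      show "closed {x. norm (g x) \<le> norm x * M}"
        by (intro closed_Collect_le continuous_intros cont)
    qed
    then show ?thesis
      by (auto simp: X)
  qed
  have "bounded_linear g"
    by (rule bounded_linear_intro[of _ M]) (auto simp: add scale bound simp flip: scaleC_of_real)
  then have "Blinfun g \<in> clinear_ops" "blinfun_apply (Blinfun g) = g"
    by (auto simp: clinear_ops_def bounded_linear_Blinfun_apply scale)
  moreover have "g (\<tau> u h) = \<tau> (blinfun_apply A u) (blinfun_apply B h)" for u h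
    using gs[of "[(u, h)]"] by simp
  ultimately show ?thesis
    by (intro bexI[of _ "Blinfun g"]) auto
qed

lemma
  assumes tau: "hilbert_tensor \<tau>" and A: "A \<in> clinear_ops" and B: "B \<in> clinear_ops"
  shows tensor_op_clinear: "tensor_op \<tau> A B \<in> clinear_ops"
    and tensor_op_apply:
      "blinfun_apply (tensor_op \<tau> A B) (\<tau> u h) = \<tau> (blinfun_apply A u) (blinfun_apply B h)"
proof -
  let ?P = "\<lambda>C. C \<in> clinear_ops \<and>
    (\<forall>u h. blinfun_apply C (\<tau> u h) = \<tau> (blinfun_apply A u) (blinfun_apply B h))"
  obtain C where C: "?P C"
    using tensor_op_exists[OF assms] by blast
  have "?P (tensor_op \<tau> A B)"
    unfolding tensor_op_def
  proof (rule theI[where P = ?P, OF C])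
    fix D assume "?P D"
    then show "D = C"
      using C by (intro tensor_op_unique[OF tau]) auto
  qed
  then show "tensor_op \<tau> A B \<in> clinear_ops"
    "blinfun_apply (tensor_op \<tau> A B) (\<tau> u h) = \<tau> (blinfun_apply A u) (blinfun_apply B h)"
    by auto
qed

end

theory Submission
  imports Defs "HOL-Library.Function_Algebras"
begin

text \<open>
  The proof is by duality. A nilpotent tuple \<open>T\<close> and vectors \<open>\<xi>, \<eta>\<close> give the functional
  $x \mapsto \langle x(T)\xi, \eta\rangle$ on power series. Direct sums of tuples show that these functionals,
  weighted by $(\|\xi\|^2 + \|\eta\|^2)/2$, form a convex cone. If such a functional depends only on
  the coefficients over \<open>\<Lambda>\<close>, then compressing \<open>T\<close> to the semi-invariant subspace $M \ominus M_0$, where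
  $M$ is spanned by the vectors $T^w h$ with $h$ a component of \<open>\<xi>\<close>, and $M_0$ by those with $w \notin \Lambda$,
  makes the tuple \<open>\<Lambda>\<close>-nilpotent without changing the functional; hence its value at $p$ is bounded by
  the supremum in the theorem times the weight. The extension theorem of M. Riesz extends evaluation
  at $p$ to all these functionals with the same bound, and the Riesz representation theorem turns
  the extension into the coefficients of a power series $\tilde x$. Testing with
  $T \otimes (\hbox{truncated shift})$ bounds the homogeneous parts and the Fejer means of $\tilde x(T)$, so
  the series converges and satisfies the same bound.
\<close>

section \<open>Extension and representation of functionals\<close>

text \<open>The weight is the mean of the squared norms, not the product of the norms, because
  direct sums add it; replacing the pair by \<open>(s \<xi>, \<eta> / s)\<close> recovers the
  product afterwards. A functional has many representations. Instead of taking an infimum of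
  weights, the relation "\<open>c\<close> is at least the weight of some representation" is carried
  along; its pairs form a cone, which is what the extension theorem asks for. All tuples must act on
  the one fixed space, so direct sums and shifts have to be built inside it. This dictates the
  finiteness conditions: \<open>\<xi>\<close> and \<open>\<eta>\<close> are finite sums of
  elementary tensors and long words annihilate \<open>\<xi>\<close>, so that the vectors to be moved
  span a finite-dimensional space, of which any finite number of orthogonal copies fit into an
  infinite-dimensional one. The same conditions make each functional a finite sum, defined on every
  family of coefficients without any question of convergence. The series produced by the extension
  is therefore only formal at first, and its convergence has to be won from the bounds on
  functionals.\<close>

instantiation "fun" :: (type, scaleR) scaleR
begin
definition scaleR_fun :: "real \<Rightarrow> ('a \<Rightarrow> 'b) \<Rightarrow> 'a \<Rightarrow> 'b" where
  "scaleR_fun r f = (\<lambda>x. r *\<^sub>R f x)"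
instance ..
end

text \<open>Makes functionals on coefficient families into vectors, so that
  \<open>riesz_extension\<close> applies to pairs of a functional and a weight.\<close>

instance "fun" :: (type, real_vector) real_vector
  by standard (auto simp: scaleR_fun_def fun_eq_iff algebra_simps)

text \<open>Zorn's lemma is applied to graphs of positive partial extensions, and a maximal graph is
  shown to cover \<open>V\<close>. The hypothesis \<open>absorb\<close> does the work of an interior
  point: used at \<open>y\<close> and at \<open>- y\<close>, it bounds the possible values at a new
  vector from both sides.\<close>

theorem riesz_extension:
  fixes V F K :: "'a::real_vector set" and f :: "'a \<Rightarrow> real"
  assumes V: "subspace V" and F: "subspace F" "F \<subseteq> V"
    and K_add: "\<And>x y. x \<in> K \<Longrightarrow> y \<in> K \<Longrightarrow> x + y \<in> K"
    and K_scale: "\<And>r x. 0 \<le> r \<Longrightarrow> x \<in> K \<Longrightarrow> r *\<^sub>R x \<in> K"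
    and absorb: "\<And>y. y \<in> V \<Longrightarrow> \<exists>z\<in>F. z + y \<in> K"
    and f_add: "\<And>x y. x \<in> F \<Longrightarrow> y \<in> F \<Longrightarrow> f (x + y) = f x + f y"
    and f_scale: "\<And>r x. x \<in> F \<Longrightarrow> f (r *\<^sub>R x) = r * f x"
    and f_pos: "\<And>x. x \<in> F \<Longrightarrow> x \<in> K \<Longrightarrow> 0 \<le> f x"
  obtains g where "\<And>x y. x \<in> V \<Longrightarrow> y \<in> V \<Longrightarrow> g (x + y) = g x + g y"
    and "\<And>r x. x \<in> V \<Longrightarrow> g (r *\<^sub>R x) = r * g x"
    and "\<And>x. x \<in> F \<Longrightarrow> g x = f x"
    and "\<And>x. x \<in> V \<Longrightarrow> x \<in> K \<Longrightarrow> 0 \<le> g x"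
proof -
  \<comment> \<open>The members are linear relations; being the graph of a function is not demanded,
    since positivity will force it.\<close>
  define \<G> where "\<G> = {G :: ('a \<times> real) set. subspace G \<and> fst ` G \<subseteq> V \<and>
    (\<lambda>x. (x, f x)) ` F \<subseteq> G \<and> (\<forall>(x, t) \<in> G. x \<in> K \<longrightarrow> 0 \<le> t)}"
  have "(\<lambda>x. (x, f x)) ` F \<in> \<G>"
  proof -
    have "subspace ((\<lambda>x. (x, f x)) ` F)"
      unfolding subspace_def
    proof safe
      show "0 \<in> (\<lambda>x. (x, f x)) ` F"
        using f_scale[of 0 0] subspace_0[OF F(1)] by (auto simp: zero_prod_def image_iff)
    qed (auto simp: image_iff f_add f_scale subspace_add[OF F(1)] subspace_scale[OF F(1)])
    then show ?thesis
      using F f_pos by (auto simp: \<G>_def)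
  qed
  then have ne: "\<G> \<noteq> {}"
    by blast
  have chain: "\<Union>\<C> \<in> \<G>" if nonempty: "\<C> \<noteq> {}" and ch: "subset.chain \<G> \<C>" for \<C>
  proof -
    have sub: "\<C> \<subseteq> \<G>" and tot: "\<And>A B. A \<in> \<C> \<Longrightarrow> B \<in> \<C> \<Longrightarrow> A \<subseteq> B \<or> B \<subseteq> A"
      using ch by (auto simp: subset_chain_def)
    obtain A where A: "A \<in> \<C>" using nonempty by blast
    have "subspace (\<Union>\<C>)"
      unfolding subspace_def
    proof safe
      show "0 \<in> \<Union>\<C>" using A sub by (auto simp: \<G>_def intro: subspace_0)
    next
      fix x t y s B C assume *: "(x, t) \<in> B" "B \<in> \<C>" "(y, s) \<in> C" "C \<in> \<C>"
      obtain D where D: "D \<in> \<C>" "(x, t) \<in> D" "(y, s) \<in> D"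
        using tot[of B C] * by blast
      then have "(x, t) + (y, s) \<in> D"
        using sub by (intro subspace_add) (auto simp: \<G>_def)
      then show "(x, t) + (y, s) \<in> \<Union>\<C>" using D by blast
    next
      fix c x t B assume *: "(x, t) \<in> B" "B \<in> \<C>"
      then have "c *\<^sub>R (x, t) \<in> B"
        using sub by (intro subspace_scale) (auto simp: \<G>_def)
      then show "c *\<^sub>R (x, t) \<in> \<Union>\<C>" using * by blast
    qed
    then show ?thesis
      using sub A unfolding \<G>_def by blast
  qed
  obtain G where G: "G \<in> \<G>" and max: "\<And>H. H \<in> \<G> \<Longrightarrow> G \<subseteq> H \<Longrightarrow> H = G"
    using subset_Zorn_nonempty[OF ne chain] by blast
  have sub: "subspace G" and GV: "\<And>x t. (x, t) \<in> G \<Longrightarrow> x \<in> V"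
    and GF: "\<And>x. x \<in> F \<Longrightarrow> (x, f x) \<in> G" and pos: "\<And>x t. (x, t) \<in> G \<Longrightarrow> x \<in> K \<Longrightarrow> 0 \<le> t"
    using G by (auto simp: \<G>_def)
  have add: "(x + y, t + s) \<in> G" if "(x, t) \<in> G" "(y, s) \<in> G" for x y t s
    using subspace_add[OF sub that] by simp
  have scale: "(r *\<^sub>R x, r * t) \<in> G" if "(x, t) \<in> G" for r x t
    using subspace_scale[OF sub that, of r] by simp
  have diff: "(x - y, t - s) \<in> G" if "(x, t) \<in> G" "(y, s) \<in> G" for x y t s
    using subspace_diff[OF sub that] by simp
  have zero_K: "0 \<in> K"
    using absorb[OF subspace_0[OF V]] K_scale[of 0] by auto
  \<comment> \<open>Both \<open>(0, t - s)\<close> and \<open>(0, s - t)\<close> lie in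
    \<open>G\<close>, and \<open>0\<close> lies in \<open>K\<close>.\<close>
  have single: "t = s" if "(x, t) \<in> G" "(x, s) \<in> G" for x t s
    using pos[OF diff[OF that]] pos[OF diff[OF that(2,1)]] zero_K by simp
  have total: "\<exists>t. (y, t) \<in> G" if y: "y \<in> V" for y
  proof -
    \<comment> \<open>Positivity at \<open>z + y\<close> forces a value at \<open>y\<close> to be at
      least \<open>- t\<close>, positivity at \<open>z - y\<close> to be at most \<open>t\<close>.
      By \<open>bound\<close> these demands are compatible, and \<open>s0\<close> is the least
      choice.\<close>
    define L where "L = {- t | z t. (z, t) \<in> G \<and> z + y \<in> K}"
    have bound: "l \<le> s" if "l \<in> L" "(z, s) \<in> G" "z - y \<in> K" for l z s
    proof -
      obtain z' t where "l = - t" "(z', t) \<in> G" "z' + y \<in> K"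
        using \<open>l \<in> L\<close> by (auto simp: L_def)
      then show ?thesis
        using pos[OF add[of z' t z s]] K_add[of "z' + y" "z - y"] that by (simp add: algebra_simps)
    qed
    obtain z1 where z1: "z1 \<in> F" "z1 + y \<in> K" using absorb[OF y] by blast
    obtain z2 where z2: "z2 \<in> F" "z2 - y \<in> K" using absorb[OF subspace_neg[OF V y]] by auto
    have Lne: "L \<noteq> {}" using z1 GF by (auto simp: L_def)
    have Lbdd: "bdd_above L" using bound[OF _ GF[OF z2(1)] z2(2)] by (auto simp: bdd_above_def)
    define s0 where "s0 = Sup L"
    have upper: "- t \<le> s0" if "(z, t) \<in> G" "z + y \<in> K" for z t
      unfolding s0_def using that Lbdd by (intro cSup_upper) (auto simp: L_def)
    have lower: "s0 \<le> t" if "(z, t) \<in> G" "z - y \<in> K" for z t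
      unfolding s0_def using bound[OF _ that] Lne by (intro cSup_least)
    define H where "H = {(z + r *\<^sub>R y, t + r * s0) | z t r. (z, t) \<in> G}"
    have "subspace H"
      unfolding subspace_def
    proof (intro conjI ballI allI)
      show "0 \<in> H"
        using subspace_0[OF sub] unfolding H_def zero_prod_def
        by (metis (mono_tags, lifting) add.right_neutral mem_Collect_eq mult_zero_left scaleR_zero_left)
    next
      fix a b assume "a \<in> H" "b \<in> H"
      then obtain z t r z' t' r' where "(z, t) \<in> G" "a = (z + r *\<^sub>R y, t + r * s0)"
        "(z', t') \<in> G" "b = (z' + r' *\<^sub>R y, t' + r' * s0)"
        unfolding H_def mem_Collect_eq by metis
      then have "a + b = ((z + z') + (r + r') *\<^sub>R y, (t + t') + (r + r') * s0)" "(z + z', t + t') \<in> G"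
        using add by (auto simp: algebra_simps)
      then show "a + b \<in> H" unfolding H_def by blast
    next
      fix a c assume "a \<in> H"
      then obtain z t r where "(z, t) \<in> G" "a = (z + r *\<^sub>R y, t + r * s0)"
        by (auto simp: H_def)
      then have "c *\<^sub>R a = (c *\<^sub>R z + (c * r) *\<^sub>R y, c * t + (c * r) * s0)"
        by (simp add: algebra_simps)
      moreover have "(c *\<^sub>R z, c * t) \<in> G"
        using scale \<open>(z, t) \<in> G\<close> .
      ultimately show "c *\<^sub>R a \<in> H" unfolding H_def by blast
    qed
    moreover have GH: "G \<subseteq> H"
    proof
      fix a assume "a \<in> G"
      then show "a \<in> H" unfolding H_def
        by (cases a) (metis (mono_tags, lifting) add.right_neutral mem_Collect_eq mult_zero_left scaleR_zero_left)
    qed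
    moreover have "fst ` H \<subseteq> V"
      using GV y by (auto simp: H_def intro!: subspace_add[OF V] subspace_scale[OF V])
    moreover have "0 \<le> t + r * s0" if zt: "(z, t) \<in> G" and K: "z + r *\<^sub>R y \<in> K" for z t r
    proof (cases r "0::real" rule: linorder_cases)
      case equal
      then show ?thesis using pos zt K by simp
    next
      case greater
      have "inverse r *\<^sub>R z + y \<in> K"
        using K_scale[OF _ K, of "inverse r"] greater by (simp add: algebra_simps)
      then have "- (inverse r * t) \<le> s0"
        by (rule upper[OF scale[OF zt]])
      then show ?thesis using greater by (simp add: field_simps)
    next
      case less
      have "inverse (- r) *\<^sub>R z - y \<in> K"
        using K_scale[OF _ K, of "inverse (- r)"] less by (simp add: scaleR_add_right)
      then have "s0 \<le> inverse (- r) * t"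
        by (rule lower[OF scale[OF zt]])
      then show ?thesis using less by (simp add: field_simps)
    qed
    ultimately have "H \<in> \<G>"
      using GF unfolding \<G>_def H_def by blast
    then have "H = G" using max GH by blast
    moreover have "(y, s0) \<in> H"
      using subspace_0[OF sub] unfolding H_def zero_prod_def
      by (metis (mono_tags, lifting) add.left_neutral mem_Collect_eq mult_1 scaleR_one)
    ultimately show ?thesis by blast
  qed
  define g where "g y = (THE t. (y, t) \<in> G)" for y
  have g: "(y, g y) \<in> G" if "y \<in> V" for y
    unfolding g_def using total[OF that] single by (metis theI)
  show ?thesis
  proof (rule that[of g])
    fix x y assume "x \<in> V" "y \<in> V"
    then show "g (x + y) = g x + g y"
      using single[OF g add[OF g g]] subspace_add[OF V] by blast
  next
    fix r x assume "x \<in> V"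
    then show "g (r *\<^sub>R x) = r * g x"
      using single[OF g scale[OF g]] subspace_scale[OF V] by blast
  next
    fix x assume "x \<in> F"
    then show "g x = f x" using single[OF g GF] F by blast
  next
    fix x assume "x \<in> V" "x \<in> K"
    then show "0 \<le> g x" using pos[OF g] by blast
  qed
qed

text \<open>The minimiser of \<open>\<parallel>x\<parallel>\<^sup>2 - 2 f x\<close> represents \<open>f\<close>.\<close>

theorem riesz_representation:
  fixes f :: "'a::{real_inner, complete_space} \<Rightarrow> real"
  assumes "bounded_linear f"
  obtains z where "\<And>x. f x = inner z x"
proof -
  interpret f: bounded_linear f by fact
  define Q where "Q x = (norm x)\<^sup>2 - 2 * f x" for x
  obtain B where B: "\<And>x. norm (f x) \<le> norm x * B" "B > 0"
    using f.pos_bounded by blast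
  have low: "- B\<^sup>2 \<le> Q x" for x
  proof -
    have "f x \<le> norm x * B" using B(1)[of x] by simp
    then have "(norm x - B)\<^sup>2 - B\<^sup>2 \<le> Q x" by (simp add: Q_def power2_eq_square algebra_simps)
    moreover have "0 \<le> (norm x - B)\<^sup>2" by simp
    ultimately show ?thesis by linarith
  qed
  define m where "m = Inf (range Q)"
  have bdd: "bdd_below (range Q)" using low by (auto simp: bdd_below_def)
  have m: "m \<le> Q x" for x unfolding m_def by (rule cInf_lower[OF _ bdd]) simp
  have "\<exists>x. Q x < m + inverse (Suc n)" for n
    using cInf_lessD[of "range Q" "m + inverse (Suc n)"] by (auto simp: m_def)
  then obtain s where s: "\<And>n. Q (s n) < m + inverse (Suc n)" by metis
  \<comment> \<open>The linear parts cancel in this parallelogram identity, so a minimising sequence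
    is Cauchy.\<close>
  have par: "(norm (x - y))\<^sup>2 = 2 * Q x + 2 * Q y - 4 * Q ((1/2) *\<^sub>R (x + y))" for x y
    unfolding Q_def power2_norm_eq_inner f.scaleR f.add
    by (simp add: inner_diff_left inner_diff_right inner_add_left inner_add_right inner_commute algebra_simps)
  have close: "(norm (s i - s j))\<^sup>2 \<le> 4 * inverse (Suc k)" if "k \<le> i" "k \<le> j" for i j k
  proof -
    have "inverse (real (Suc i)) \<le> inverse (Suc k)" "inverse (real (Suc j)) \<le> inverse (Suc k)"
      using that by (auto intro!: le_imp_inverse_le)
    then show ?thesis
      using par[of "s i" "s j"] s[of i] s[of j] m[of "(1/2) *\<^sub>R (s i + s j)"] by linarith
  qed
  have "Cauchy s"
  proof (rule metric_CauchyI)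
    fix e :: real assume e: "e > 0"
    obtain k where k: "inverse (real (Suc k)) < e\<^sup>2 / 4"
      using reals_Archimedean[of "e\<^sup>2 / 4"] e by auto
    have "dist (s i) (s j) < e" if "k \<le> i" "k \<le> j" for i j
    proof -
      have "(norm (s i - s j))\<^sup>2 < e\<^sup>2" using close[OF that] k by linarith
      then show ?thesis using e by (simp add: dist_norm power2_less_imp_less)
    qed
    then show "\<exists>M. \<forall>m\<ge>M. \<forall>n\<ge>M. dist (s m) (s n) < e" by blast
  qed
  then obtain z where z: "s \<longlonglongrightarrow> z" using convergent_eq_Cauchy by blast
  have "(\<lambda>n. Q (s n)) \<longlonglongrightarrow> Q z"
    unfolding Q_def by (intro tendsto_intros f.tendsto z)
  moreover have "(\<lambda>n. m + inverse (real (Suc n))) \<longlonglongrightarrow> m + 0"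
    by (intro tendsto_intros LIMSEQ_inverse_real_of_nat)
  ultimately have "Q z \<le> m + 0"
    using s by (intro LIMSEQ_le[of "\<lambda>n. Q (s n)" _ "\<lambda>n. m + inverse (real (Suc n))"])
      (auto intro: less_imp_le)
  then have min: "Q z \<le> Q x" for x using m[of x] by simp
  have "f x = inner z x" for x
  proof -
    define D where "D = inner z x - f x"
    have *: "0 \<le> 2 * t * D + t\<^sup>2 * (norm x)\<^sup>2" for t
      using min[of "z + t *\<^sub>R x"] unfolding Q_def D_def power2_norm_eq_inner f.scaleR f.add
      by (simp add: inner_add_left inner_add_right inner_commute power2_eq_square algebra_simps)
    \<comment> \<open>The quadratic in \<open>*\<close> is smallest at
      \<open>- D / (norm x)\<^sup>2\<close>; the added 1 avoids division by zero and still makes it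
      negative unless \<open>D = 0\<close>.\<close>
    define t where "t = - D / (1 + (norm x)\<^sup>2)"
    have pos: "0 < 1 + (norm x)\<^sup>2" by (simp add: add_pos_nonneg)
    have "t * (1 + (norm x)\<^sup>2) = - D" using pos by (simp add: t_def)
    then have "t\<^sup>2 * (norm x)\<^sup>2 = - D * t - t\<^sup>2"
      by (simp add: power2_eq_square algebra_simps) (metis minus_mult_right mult.commute distrib_left)
    then have "0 \<le> t * D - t\<^sup>2" using *[of t] by (simp add: algebra_simps)
    moreover have "t * D = - (D\<^sup>2) / (1 + (norm x)\<^sup>2)" by (simp add: t_def power2_eq_square)
    moreover have "0 \<le> t\<^sup>2" by simp
    ultimately have "D\<^sup>2 / (1 + (norm x)\<^sup>2) \<le> 0" by linarith
    then have "D\<^sup>2 \<le> 0" using pos by (metis divide_pos_pos not_le)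
    then show ?thesis by (simp add: D_def)
  qed
  then show ?thesis by (rule that)
qed

section \<open>Inner products, adjoints and finite-rank operators\<close>

lemma cinner_zero_right [simp]: "cinner (x::'a::complex_hilbert) 0 = 0"
  using cinner_add_right[of x 0 0] by simp

lemma cinner_sum_right: "cinner (x::'a::complex_hilbert) (sum f S) = (\<Sum>i\<in>S. cinner x (f i))"
  by (induction S rule: infinite_finite_induct) (auto simp: cinner_add_right)

lemma cinner_scaleR_left: "cinner (r *\<^sub>R x) (y::'a::complex_hilbert) = of_real r * cinner x y"
  by (metis cinner_scaleC_left scaleC_of_real)

lemma cinner_scaleR_right: "cinner (x::'a::complex_hilbert) (r *\<^sub>R y) = of_real r * cinner x y"
  by (metis cinner_scaleC_right scaleC_of_real complex_cnj_complex_of_real)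

lemma scaleC_zero_left [simp]: "0 *\<^sub>C (x::'a::complex_hilbert) = 0"
  by (rule cvec.scale_zero_left)

lemma scaleC_scaleR: "c *\<^sub>C (r *\<^sub>R x) = r *\<^sub>R (c *\<^sub>C (x::'a::complex_hilbert))"
  by (metis scaleC_of_real scaleC_scaleC mult.commute)

lemma ex_rotation: "\<exists>c. cmod c = 1 \<and> c * z = complex_of_real (cmod z)"
proof (cases "z = 0")
  case True
  then show ?thesis by (intro exI[of _ 1]) simp
next
  case False
  then have "cnj z / of_real (cmod z) * z = of_real (cmod z)"
    by (simp add: complex_norm_square[symmetric] mult.commute[of "cnj z"] power2_eq_square)
  then show ?thesis
    using False by (intro exI[of _ "cnj z / of_real (cmod z)"]) (simp add: norm_divide)
qed

lemma cmod_cinner_le: "cmod (cinner x y) \<le> norm x * norm (y::'a::complex_hilbert)"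
proof -
  obtain c where c: "cmod c = 1" "c * cinner x y = of_real (cmod (cinner x y))"
    using ex_rotation by blast
  have "cmod (cinner x y) = Re (cinner (c *\<^sub>C x) y)"
    using c by (simp add: cinner_scaleC_left)
  also have "\<dots> \<le> norm (c *\<^sub>C x) * norm y"
    unfolding Re_cinner by (rule norm_cauchy_schwarz)
  finally show ?thesis using c by (simp add: norm_scaleC)
qed

lemma bounded_linear_cinner_left: "bounded_linear (\<lambda>x. cinner x (y::'a::complex_hilbert))"
  by (rule bounded_linear_intro[of _ "norm y"])
    (auto simp: cinner_add_left cinner_scaleR_left cmod_cinner_le scaleR_conv_of_real)

lemma bounded_linear_cinner_right: "bounded_linear (\<lambda>x. cinner (y::'a::complex_hilbert) x)"
  by (rule bounded_linear_intro[of _ "norm y"])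
    (simp_all add: cinner_add_right cinner_scaleR_right scaleR_conv_of_real cmod_cinner_le
      mult.commute[of "norm _" "norm y"])

lemma bounded_linear_scaleC_left: "bounded_linear (\<lambda>c. c *\<^sub>C (y::'a::complex_hilbert))"
  by (rule bounded_linear_intro[of _ "norm y"])
    (simp_all add: scaleC_add_left norm_scaleC scaleR_conv_of_real flip: scaleC_scaleC scaleC_of_real)

lemma cinner_left_eqI: "(\<And>z. cinner x z = cinner y z) \<Longrightarrow> x = (y::'a::complex_hilbert)"
proof -
  assume "\<And>z. cinner x z = cinner y z"
  then have "cinner (x - y) (x - y) = 0"
    by (simp add: cinner_diff_left)
  then show "x = y"
    by (simp add: cinner_self)
qed

lemma clinear_id: "id_blinfun \<in> clinear_ops"
  by (simp add: clinear_ops_def)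

lemma clinear_zero: "0 \<in> clinear_ops"
  by (simp add: clinear_ops_def)

lemma clinear_add: "A \<in> clinear_ops \<Longrightarrow> B \<in> clinear_ops \<Longrightarrow> A + B \<in> clinear_ops"
  by (simp add: clinear_ops_def blinfun.add_left scaleC_add_right)

lemma clinear_scaleR: "A \<in> clinear_ops \<Longrightarrow> r *\<^sub>R A \<in> clinear_ops"
  by (simp add: clinear_ops_def blinfun.scaleR_left scaleC_scaleR)

lemma clinear_compose: "A \<in> clinear_ops \<Longrightarrow> B \<in> clinear_ops \<Longrightarrow> A o\<^sub>L B \<in> clinear_ops"
  by (simp add: clinear_ops_def)

lemma clinear_sum: "(\<And>i. i \<in> S \<Longrightarrow> A i \<in> clinear_ops) \<Longrightarrow> sum A S \<in> clinear_ops"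
  by (induction S rule: infinite_finite_induct) (auto simp: clinear_zero clinear_add)

lemma clinear_word_op: "(\<And>j. T j \<in> clinear_ops) \<Longrightarrow> word_op T w \<in> clinear_ops"
  by (induction w) (auto simp: clinear_id clinear_compose)

text \<open>A relation suffices: adjoints are taken only of finite sums of rank-one operators and of
  their ampliations, where they can be written down.\<close>

definition adjoint_pair :: "('a::complex_hilbert \<Rightarrow>\<^sub>L 'a) \<Rightarrow> ('a \<Rightarrow>\<^sub>L 'a) \<Rightarrow> bool" where
  "adjoint_pair A B \<longleftrightarrow> (\<forall>x y. cinner (blinfun_apply A x) y = cinner x (blinfun_apply B y))"

lemma adjoint_pairD:
  "adjoint_pair A B \<Longrightarrow> cinner (blinfun_apply A x) y = cinner x (blinfun_apply B y)"
  by (simp add: adjoint_pair_def)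

lemma adjoint_pair_sym: "adjoint_pair A B \<Longrightarrow> adjoint_pair B A"
  unfolding adjoint_pair_def
proof safe
  fix x y assume "\<forall>x y. cinner (blinfun_apply A x) y = cinner x (blinfun_apply B y)"
  then have "cinner (blinfun_apply A y) x = cinner y (blinfun_apply B x)" by blast
  then have "cnj (cinner (blinfun_apply A y) x) = cnj (cinner y (blinfun_apply B x))" by simp
  then show "cinner (blinfun_apply B x) y = cinner x (blinfun_apply A y)"
    unfolding cinner_commute[symmetric] by simp
qed

lemma adjoint_pair_sum:
  "(\<And>i. i \<in> S \<Longrightarrow> adjoint_pair (A i) (B i)) \<Longrightarrow> adjoint_pair (sum A S) (sum B S)"
  by (simp add: adjoint_pair_def blinfun.sum_left cinner_sum_left cinner_sum_right)

definition rank_one :: "'a::complex_hilbert \<Rightarrow> 'a \<Rightarrow> 'a \<Rightarrow>\<^sub>L 'a" where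
  "rank_one a b = Blinfun (\<lambda>x. cinner x b *\<^sub>C a)"

lemma rank_one_apply [simp]: "blinfun_apply (rank_one a b) x = cinner x b *\<^sub>C a"
  unfolding rank_one_def
  by (rule bounded_linear_Blinfun_apply[THEN fun_cong])
    (rule bounded_linear_compose[OF bounded_linear_scaleC_left bounded_linear_cinner_left])

lemma clinear_rank_one: "rank_one a b \<in> clinear_ops"
  by (simp add: clinear_ops_def cinner_scaleC_left scaleC_scaleC)

lemma adjoint_pair_rank_one: "adjoint_pair (rank_one a b) (rank_one b a)"
  unfolding adjoint_pair_def
proof safe
  fix x y
  have "cnj (cinner y a) = cinner a y" by (rule cinner_commute[symmetric])
  then show "cinner (blinfun_apply (rank_one a b) x) y = cinner x (blinfun_apply (rank_one b a) y)"
    by (simp add: cinner_scaleC_left cinner_scaleC_right)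
qed

section \<open>Orthonormal sets\<close>

definition orthonormal :: "'a::complex_hilbert set \<Rightarrow> bool" where
  "orthonormal E \<longleftrightarrow> (\<forall>e\<in>E. \<forall>e'\<in>E. cinner e e' = (if e = e' then 1 else 0))"

text \<open>Meant for finite orthonormal \<open>E\<close>, where it is the orthogonal projection
  onto \<open>cspan E\<close>; for infinite \<open>E\<close> the sum is 0.\<close>

definition proj :: "'a::complex_hilbert set \<Rightarrow> 'a \<Rightarrow>\<^sub>L 'a" where
  "proj E = (\<Sum>e\<in>E. rank_one e e)"

lemma proj_apply: "blinfun_apply (proj E) x = (\<Sum>e\<in>E. cinner x e *\<^sub>C e)"
  by (simp add: proj_def blinfun.sum_left)

lemma clinear_proj: "proj E \<in> clinear_ops"
  unfolding proj_def by (intro clinear_sum clinear_rank_one)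

lemma adjoint_pair_proj: "adjoint_pair (proj E) (proj E)"
  unfolding proj_def by (intro adjoint_pair_sum adjoint_pair_rank_one)

lemma proj_in_cspan: "blinfun_apply (proj E) x \<in> cspan E"
  unfolding proj_apply by (intro cvec.span_sum cvec.span_scale cvec.span_base)

lemma cinner_proj_base:
  assumes "orthonormal E" "finite E" "e \<in> E"
  shows "cinner (blinfun_apply (proj E) x) e = cinner x e"
proof -
  have "(\<Sum>e'\<in>E. cinner x e' * cinner e' e) = (\<Sum>e'\<in>E. if e' = e then cinner x e' else 0)"
    using assms by (intro sum.cong) (auto simp: orthonormal_def)
  then show ?thesis
    using assms by (simp add: proj_apply cinner_sum_left cinner_scaleC_left)
qed

lemma proj_cspan:
  assumes E: "orthonormal E" "finite E" and x: "x \<in> cspan E"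
  shows "blinfun_apply (proj E) x = x"
  using x
proof (induction rule: cvec.span_induct_alt)
  case base
  then show ?case by simp
next
  case (step c e y)
  have "(\<Sum>e'\<in>E. cinner e e' *\<^sub>C e') = (\<Sum>e'\<in>E. if e' = e then e' else 0)"
    using E step(1) by (intro sum.cong) (auto simp: orthonormal_def)
  then have "blinfun_apply (proj E) e = e"
    using E step(1) by (simp add: proj_apply)
  then show ?case
    using step by (simp add: blinfun.add_right clinear_opsD[OF clinear_proj])
qed

text \<open>The operator is a self-adjoint idempotent, so Cauchy-Schwarz for \<open>x\<close> and
  its image gives the bound.\<close>

lemma norm_proj_le:
  assumes "orthonormal E" "finite E"
  shows "norm (blinfun_apply (proj E) x) \<le> norm x"
proof -
  let ?P = "blinfun_apply (proj E)"
  have "cinner (?P x) (?P x) = cinner x (?P x)"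
    using adjoint_pairD[OF adjoint_pair_proj, of E x "?P x"] proj_cspan[OF assms proj_in_cspan] by simp
  then have "(norm (?P x))\<^sup>2 = inner x (?P x)"
    by (metis Re_cinner power2_norm_eq_inner)
  also have "\<dots> \<le> norm x * norm (?P x)"
    by (rule norm_cauchy_schwarz)
  finally show ?thesis
    by (cases "?P x = 0") (auto simp: power2_eq_square)
qed

text \<open>One Gram-Schmidt step: \<open>e\<close> is \<open>h\<close> minus its projection,
  normalised.\<close>

lemma orthonormal_insert:
  assumes E: "orthonormal E" "finite E" and h: "h \<notin> cspan E"
  obtains e where "e \<notin> E" "orthonormal (insert e E)" "cspan (insert e E) = cspan (insert h E)"
proof -
  define r where "r = h - blinfun_apply (proj E) h"
  have r0: "r \<noteq> 0" using h proj_in_cspan[of E h] by (auto simp: r_def)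
  have orth: "cinner r e = 0" "cinner e r = 0" if "e \<in> E" for e
    using cinner_proj_base[OF E that, of h] cinner_commute[of e r] by (auto simp: r_def cinner_diff_left)
  define e0 where "e0 = inverse (norm r) *\<^sub>R r"
  have e0: "cinner e0 e0 = 1"
    using r0 by (simp add: e0_def cinner_self del: of_real_inverse)
  have o: "cinner e0 e = 0" "cinner e e0 = 0" if "e \<in> E" for e
    using orth[OF that] by (simp_all add: e0_def cinner_scaleR_left cinner_scaleR_right)
  have notin: "e0 \<notin> E" using o e0 by fastforce
  have on: "orthonormal (insert e0 E)"
    using E(1) e0 o notin unfolding orthonormal_def by auto
  have sp: "cspan (insert e0 E) = cspan (insert h E)"
  proof (rule cvec.span_eq[THEN iffD2], intro conjI subsetI)
    have P: "blinfun_apply (proj E) h \<in> cspan (insert h E)"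
      using proj_in_cspan cvec.span_mono by blast
    fix x assume "x \<in> insert e0 E"
    moreover have "r \<in> cspan (insert h E)"
      unfolding r_def by (intro cvec.span_diff P cvec.span_base) simp
    then have "e0 \<in> cspan (insert h E)"
      unfolding e0_def scaleC_of_real[symmetric] by (rule cvec.span_scale)
    ultimately show "x \<in> cspan (insert h E)"
      by (auto intro: cvec.span_base)
  next
    have P: "blinfun_apply (proj E) h \<in> cspan (insert e0 E)"
      using proj_in_cspan cvec.span_mono by blast
    fix x assume "x \<in> insert h E"
    moreover have "h = of_real (norm r) *\<^sub>C e0 + blinfun_apply (proj E) h"
      using r0 by (simp add: e0_def scaleC_of_real) (simp add: r_def)
    then have "h \<in> cspan (insert e0 E)"
      using P by (metis cvec.span_add cvec.span_scale cvec.span_base insertI1)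
    ultimately show "x \<in> cspan (insert e0 E)"
      by (auto intro: cvec.span_base)
  qed
  show ?thesis using that notin on sp by blast
qed

text \<open>That \<open>E\<close> stays inside \<open>E'\<close> lets the compression below describe
  an orthogonal difference of two spans by the difference of their bases.\<close>

lemma orthonormal_extend:
  assumes E: "orthonormal E" "finite E" and S: "finite S"
  obtains E' where "E \<subseteq> E'" "finite E'" "orthonormal E'" "cspan E' = cspan (E \<union> S)"
proof -
  have "\<exists>E'. E \<subseteq> E' \<and> finite E' \<and> orthonormal E' \<and> cspan E' = cspan (E \<union> S)"
    using S
  proof induction
    case empty
    then show ?case using E by auto
  next
    case (insert h S)
    then obtain E' where E': "E \<subseteq> E'" "finite E'" "orthonormal E'" "cspan E' = cspan (E \<union> S)" by blast
    have eq: "cspan (insert h E') = cspan (E \<union> insert h S)"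
      using E'(4) by (simp add: cvec.span_insert)
    show ?case
    proof (cases "h \<in> cspan E'")
      case True
      then show ?thesis using E' eq cvec.span_redundant by blast
    next
      case False
      then obtain e where "orthonormal (insert e E')" "cspan (insert e E') = cspan (insert h E')"
        using orthonormal_insert E' by metis
      then show ?thesis using E' eq by (intro exI[of _ "insert e E'"]) auto
    qed
  qed
  then show ?thesis using that by blast
qed

lemma orthonormal_basis:
  assumes "finite S"
  obtains E where "finite E" "orthonormal E" "cspan E = cspan S"
proof (rule orthonormal_extend[of "{}" S])
  show "orthonormal {}" "finite {}" "finite S"
    using assms by (auto simp: orthonormal_def)
qed (use that in auto)

lemma ex_orthonormal_card:
  assumes "infinite_dimensional TYPE('a::complex_hilbert)"
  shows "\<exists>E :: 'a set. finite E \<and> orthonormal E \<and> card E = n"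
proof (induction n)
  case 0
  then show ?case by (intro exI[of _ "{}"]) (simp add: orthonormal_def)
next
  case (Suc n)
  then obtain E :: "'a set" where E: "finite E" "orthonormal E" "card E = n" by blast
  obtain h where "h \<notin> cspan E" using assms E(1) unfolding infinite_dimensional_def by blast
  then obtain e where "e \<notin> E" "orthonormal (insert e E)"
    using orthonormal_insert[OF E(2,1)] by metis
  then show ?case using E by (intro exI[of _ "insert e E"]) simp
qed

section \<open>Block operators\<close>

text \<open>An orthonormal set with as many members as \<open>{..N} \<times> E\<close> is split into
  \<open>N + 1\<close> copies of \<open>E\<close>. \<open>V i\<close> sends each \<open>e\<close> to
  its copy number \<open>i\<close> and kills the orthogonal complement of \<open>E\<close>;
  \<open>W i\<close> goes back. Products with an index beyond \<open>N\<close> are left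
  open.\<close>

lemma ex_copies:
  fixes E :: "'a::complex_hilbert set"
  assumes inf: "infinite_dimensional TYPE('a)" and E: "finite E" "orthonormal E"
  obtains V W :: "nat \<Rightarrow> 'a \<Rightarrow>\<^sub>L 'a" where "\<And>i. V i \<in> clinear_ops" "\<And>i. W i \<in> clinear_ops"
    "\<And>i. adjoint_pair (V i) (W i)"
    "\<And>i j. i \<le> N \<Longrightarrow> j \<le> N \<Longrightarrow> W i o\<^sub>L V j = (if i = j then proj E else 0)"
proof -
  obtain B :: "'a set" where B: "finite B" "orthonormal B" "card B = card ({..N} \<times> E)"
    using ex_orthonormal_card[OF inf] by blast
  obtain f where f: "bij_betw f ({..N} \<times> E) B"
    using finite_same_card_bij[of "{..N} \<times> E" B] B E by auto
  have ff: "cinner (f (i, e)) (f (j, e')) = (if i = j \<and> e = e' then 1 else 0)"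
    if "i \<le> N" "j \<le> N" "e \<in> E" "e' \<in> E" for i j e e'
  proof -
    have "f (i, e) \<in> B" "f (j, e') \<in> B"
      using f that by (auto simp: bij_betw_def)
    moreover have "f (i, e) = f (j, e') \<longleftrightarrow> i = j \<and> e = e'"
      using f that by (auto simp: bij_betw_def inj_on_def)
    ultimately show ?thesis using B(2) by (simp add: orthonormal_def)
  qed
  show ?thesis
  proof (rule that)
    let ?V = "\<lambda>i. \<Sum>e\<in>E. rank_one (f (i, e)) e"
    let ?W = "\<lambda>i. \<Sum>e\<in>E. rank_one e (f (i, e))"
    show "?V i \<in> clinear_ops" "?W i \<in> clinear_ops" "adjoint_pair (?V i) (?W i)" for i
      by (intro clinear_sum clinear_rank_one adjoint_pair_sum adjoint_pair_rank_one)+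
    fix i j assume ij: "i \<le> N" "j \<le> N"
    show "?W i o\<^sub>L ?V j = (if i = j then proj E else 0)"
    proof (rule blinfun_eqI)
      fix x
      have "blinfun_apply (?W i o\<^sub>L ?V j) x =
          (\<Sum>e\<in>E. (\<Sum>e'\<in>E. cinner x e' * cinner (f (j, e')) (f (i, e))) *\<^sub>C e)"
        by (simp add: blinfun.sum_left cinner_sum_left cinner_scaleC_left)
      also have "\<dots> = (\<Sum>e\<in>E. (if i = j then cinner x e else 0) *\<^sub>C e)"
      proof (intro sum.cong refl arg_cong[where f = "\<lambda>c. c *\<^sub>C _"])
        fix e assume e: "e \<in> E"
        have "(\<Sum>e'\<in>E. cinner x e' * cinner (f (j, e')) (f (i, e))) =
            (\<Sum>e'\<in>E. if e' = e then (if i = j then cinner x e else 0) else 0)"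
          by (intro sum.cong refl) (use ff ij e in auto)
        then show "(\<Sum>e'\<in>E. cinner x e' * cinner (f (j, e')) (f (i, e))) = (if i = j then cinner x e else 0)"
          using e E by simp
      qed
      also have "\<dots> = blinfun_apply (if i = j then proj E else 0) x"
        by (simp add: proj_apply)
      finally show "blinfun_apply (?W i o\<^sub>L ?V j) x = blinfun_apply (if i = j then proj E else 0) x" .
    qed
  qed
qed

text \<open>The relations \<open>WV\<close> make the ranges of the \<open>V i\<close> pairwise
  orthogonal, so the first bound is Pythagoras and the second a Bessel inequality. \<open>P\<close>
  stays abstract because the lemma serves both the operators on the given space and their
  ampliations on the tensor product.\<close>

lemma sum_injective_copies:
  assumes adj: "\<And>i. adjoint_pair (V i) (W i)" and P: "\<And>x. norm (blinfun_apply P x) \<le> norm x"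
    and WV: "\<And>i j. i \<in> J \<Longrightarrow> j \<in> J \<Longrightarrow> W i o\<^sub>L V j = (if i = j then P else 0)"
    and I: "finite I" "inj_on \<alpha> I" "\<alpha> ` I \<subseteq> J"
  shows "(norm (\<Sum>i\<in>I. blinfun_apply (V (\<alpha> i)) (a i)))\<^sup>2 \<le> (\<Sum>i\<in>I. (norm (a i))\<^sup>2)"
    and "(\<Sum>i\<in>I. (norm (blinfun_apply (W (\<alpha> i)) h))\<^sup>2) \<le> (norm h)\<^sup>2"
proof -
  have bound: "(norm (\<Sum>i\<in>I. blinfun_apply (V (\<alpha> i)) (a i)))\<^sup>2 \<le> (\<Sum>i\<in>I. (norm (a i))\<^sup>2)" for a
  proof -
    let ?s = "\<Sum>i\<in>I. blinfun_apply (V (\<alpha> i)) (a i)"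
    have "cinner (blinfun_apply (V (\<alpha> i)) (a i)) (blinfun_apply (V (\<alpha> j)) (a j))
        = (if i = j then cinner (blinfun_apply (P) (a i)) (a i) else 0)" if "i \<in> I" "j \<in> I" for i j
    proof -
      have eq: "\<alpha> i = \<alpha> j \<longleftrightarrow> i = j" using I that by (auto simp: inj_on_def)
      have J: "\<alpha> i \<in> J" "\<alpha> j \<in> J"
        using that I(3) by blast+
      have "cinner (blinfun_apply (V (\<alpha> i)) (a i)) (blinfun_apply (V (\<alpha> j)) (a j))
          = cinner (blinfun_apply (W (\<alpha> j) o\<^sub>L V (\<alpha> i)) (a i)) (a j)"
        using adjoint_pairD[OF adjoint_pair_sym[OF adj]] by simp
      also have "\<dots> = (if \<alpha> i = \<alpha> j then cinner (blinfun_apply (P) (a i)) (a j) else 0)"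
        unfolding WV[OF J(2,1)] by simp
      finally show ?thesis
        by (simp add: eq)
    qed
    then have "cinner ?s ?s = (\<Sum>i\<in>I. cinner (blinfun_apply (P) (a i)) (a i))"
      using I(1) by (simp add: cinner_sum_left cinner_sum_right)
    then have "(norm ?s)\<^sup>2 = (\<Sum>i\<in>I. inner (blinfun_apply (P) (a i)) (a i))"
      by (metis (no_types, lifting) Re_cinner Re_sum power2_norm_eq_inner sum.cong)
    also have "\<dots> \<le> (\<Sum>i\<in>I. (norm (a i))\<^sup>2)"
    proof (rule sum_mono)
      fix i
      have "inner (blinfun_apply (P) (a i)) (a i) \<le> norm (blinfun_apply (P) (a i)) * norm (a i)"
        by (rule norm_cauchy_schwarz)
      also have "\<dots> \<le> norm (a i) * norm (a i)"
        by (intro mult_right_mono P) simp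
      finally show "inner (blinfun_apply (P) (a i)) (a i) \<le> (norm (a i))\<^sup>2"
        by (simp add: power2_eq_square)
    qed
    finally show ?thesis .
  qed
  then show "(norm (\<Sum>i\<in>I. blinfun_apply (V (\<alpha> i)) (a i)))\<^sup>2 \<le> (\<Sum>i\<in>I. (norm (a i))\<^sup>2)" .
  \<comment> \<open>Duality: \<open>inner k h = s\<close>, while
    \<open>(norm k)\<^sup>2 \<le> s\<close> by the first part. Expanding the square of
    \<open>norm (k - h)\<close> then gives the Bessel inequality.\<close>
  define k where "k = (\<Sum>i\<in>I. blinfun_apply (V (\<alpha> i)) (blinfun_apply (W (\<alpha> i)) h))"
  define s where "s = (\<Sum>i\<in>I. (norm (blinfun_apply (W (\<alpha> i)) h))\<^sup>2)"
  have "cinner k h = (\<Sum>i\<in>I. cinner (blinfun_apply (W (\<alpha> i)) h) (blinfun_apply (W (\<alpha> i)) h))"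
    by (simp add: k_def cinner_sum_left adjoint_pairD[OF adj])
  then have "inner k h = s"
    by (metis (no_types, lifting) Re_cinner Re_sum power2_norm_eq_inner s_def sum.cong)
  moreover have "(norm k)\<^sup>2 \<le> s"
    unfolding k_def s_def by (rule bound)
  moreover have "0 \<le> (norm (k - h))\<^sup>2" by simp
  ultimately have "s \<le> (norm h)\<^sup>2"
    unfolding power2_norm_eq_inner by (simp add: inner_diff_left inner_diff_right inner_commute)
  then show "(\<Sum>i\<in>I. (norm (blinfun_apply (W (\<alpha> i)) h))\<^sup>2) \<le> (norm h)\<^sup>2"
    by (simp add: s_def)
qed

text \<open>Injectivity of \<open>\<alpha>\<close> and \<open>\<beta>\<close> means at most one
  block in each row and column, so the blocks have orthogonal inputs and outputs. Direct sums take
  both maps to be the identity; shifts take \<open>\<beta> = Suc\<close>.\<close>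

lemma norm_block_le:
  assumes adj: "\<And>i. adjoint_pair (V i) (W i)" and P: "\<And>x. norm (blinfun_apply P x) \<le> norm x"
    and WV: "\<And>i j. i \<in> J \<Longrightarrow> j \<in> J \<Longrightarrow> W i o\<^sub>L V j = (if i = j then P else 0)"
    and I: "finite I" and \<alpha>: "inj_on \<alpha> I" "\<alpha> ` I \<subseteq> J" and \<beta>: "inj_on \<beta> I" "\<beta> ` I \<subseteq> J"
    and A: "\<And>i. i \<in> I \<Longrightarrow> norm (A i) \<le> r" and r: "0 \<le> r"
  shows "norm (\<Sum>i\<in>I. V (\<alpha> i) o\<^sub>L A i o\<^sub>L W (\<beta> i)) \<le> r"
proof (rule norm_blinfun_bound[OF r])
  fix h
  have "(norm (blinfun_apply (\<Sum>i\<in>I. V (\<alpha> i) o\<^sub>L A i o\<^sub>L W (\<beta> i)) h))\<^sup>2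
      = (norm (\<Sum>i\<in>I. blinfun_apply (V (\<alpha> i)) (blinfun_apply (A i) (blinfun_apply (W (\<beta> i)) h))))\<^sup>2"
    by (simp add: blinfun.sum_left)
  also have "\<dots> \<le> (\<Sum>i\<in>I. (norm (blinfun_apply (A i) (blinfun_apply (W (\<beta> i)) h)))\<^sup>2)"
    by (rule sum_injective_copies(1)[OF adj P WV I \<alpha>])
  also have "\<dots> \<le> (\<Sum>i\<in>I. (r * norm (blinfun_apply (W (\<beta> i)) h))\<^sup>2)"
    by (intro sum_mono power_mono order_trans[OF norm_blinfun] mult_right_mono A) auto
  also have "\<dots> = r\<^sup>2 * (\<Sum>i\<in>I. (norm (blinfun_apply (W (\<beta> i)) h))\<^sup>2)"
    by (simp add: power_mult_distrib sum_distrib_left)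
  also have "\<dots> \<le> r\<^sup>2 * (norm h)\<^sup>2"
    by (intro mult_left_mono sum_injective_copies(2)[OF adj P WV I \<beta>]) auto
  finally have "(norm (blinfun_apply (\<Sum>i\<in>I. V (\<alpha> i) o\<^sub>L A i o\<^sub>L W (\<beta> i)) h))\<^sup>2 \<le> (r * norm h)\<^sup>2"
    by (simp add: power_mult_distrib)
  then show "norm (blinfun_apply (\<Sum>i\<in>I. V (\<alpha> i) o\<^sub>L A i o\<^sub>L W (\<beta> i)) h) \<le> r * norm h"
    by (rule power2_le_imp_le) (simp add: r)
qed

section \<open>Calculus of tensor products of operators\<close>

text \<open>No closure is taken: a finite sum involves only finitely many right factors, whose span
  can be copied inside the space.\<close>

definition algebraic_tensors ::
    "('u::complex_hilbert \<Rightarrow> 'h::complex_hilbert \<Rightarrow> 'k::complex_hilbert) \<Rightarrow> 'k set" where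
  "algebraic_tensors \<tau> = cspan {\<tau> u h | u h. True}"

context
  fixes \<tau> :: "'u::complex_hilbert \<Rightarrow> 'h::complex_hilbert \<Rightarrow> 'k::complex_hilbert"
  assumes tau: "hilbert_tensor \<tau>"
begin

lemma tau_sum_left: "\<tau> (sum f S) h = (\<Sum>i\<in>S. \<tau> (f i) h)"
  by (rule tau_sum_right[OF hilbert_tensor_swap[OF tau]])

lemma tau_in_algebraic: "\<tau> u h \<in> algebraic_tensors \<tau>"
  unfolding algebraic_tensors_def by (rule cvec.span_base) blast

lemma subspace_algebraic: "cvec.subspace (algebraic_tensors \<tau>)"
  unfolding algebraic_tensors_def by (rule cvec.subspace_span)

lemmas algebraic_zero = cvec.subspace_0[OF subspace_algebraic]
  and algebraic_add = cvec.subspace_add[OF subspace_algebraic]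
  and algebraic_scale = cvec.subspace_scale[OF subspace_algebraic]
  and algebraic_sum = cvec.subspace_sum[OF subspace_algebraic]

lemma algebraic_induct [consumes 1, case_names zero add]:
  assumes "\<xi> \<in> algebraic_tensors \<tau>" and "P 0"
    and "\<And>u h \<xi>. \<xi> \<in> algebraic_tensors \<tau> \<Longrightarrow> P \<xi> \<Longrightarrow> P (\<tau> u h + \<xi>)"
  shows "P \<xi>"
proof -
  have "\<xi> \<in> algebraic_tensors \<tau> \<and> P \<xi>"
    using assms(1) unfolding algebraic_tensors_def
  proof (induction rule: cvec.span_induct_alt)
    case base
    show ?case using assms(2) cvec.span_zero by blast
  next
    case (step c x y)
    then obtain u h where "x = \<tau> u h" by blast
    then have x: "c *\<^sub>C x = \<tau> (c *\<^sub>C u) h" by (simp add: tau_scale_left[OF tau])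
    have y: "y \<in> algebraic_tensors \<tau>" "P y"
      using step by (simp_all add: algebraic_tensors_def)
    show ?case
      unfolding x algebraic_tensors_def[symmetric]
      using assms(3)[OF y] algebraic_add[OF tau_in_algebraic y(1)] by blast
  qed
  then show ?thesis ..
qed

lemma algebraic_dense_induct [case_names closed algebraic]:
  assumes "closed {\<xi>. P \<xi>}" and "\<And>\<xi>. \<xi> \<in> algebraic_tensors \<tau> \<Longrightarrow> P \<xi>"
  shows "P \<xi>"
proof -
  have "closure (algebraic_tensors \<tau>) \<subseteq> {\<xi>. P \<xi>}"
    by (rule closure_minimal) (use assms in auto)
  then show ?thesis
    using tau_dense[OF tau] unfolding algebraic_tensors_def by blast
qed

lemma tensor_op_eqI:
  assumes "A \<in> clinear_ops" "B \<in> clinear_ops"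
    and "\<And>u h. blinfun_apply C (\<tau> u h) = \<tau> (blinfun_apply A u) (blinfun_apply B h)"
  shows "tensor_op \<tau> A B = C"
  by (rule tensor_op_unique[OF tau]) (simp add: tensor_op_apply[OF tau] assms)

lemma tensor_op_zero_left: "B \<in> clinear_ops \<Longrightarrow> tensor_op \<tau> 0 B = 0"
  by (rule tensor_op_eqI) (auto simp: clinear_zero tau_zero_left[OF tau])

lemma tensor_op_zero_right: "A \<in> clinear_ops \<Longrightarrow> tensor_op \<tau> A 0 = 0"
  by (rule tensor_op_eqI) (auto simp: clinear_zero tau_zero_right[OF tau])

lemma tensor_op_scaleR_right:
  assumes "A \<in> clinear_ops" "B \<in> clinear_ops"
  shows "tensor_op \<tau> A (r *\<^sub>R B) = r *\<^sub>R tensor_op \<tau> A B"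
  by (rule tensor_op_eqI)
    (simp_all add: assms clinear_scaleR blinfun.scaleR_left tensor_op_apply[OF tau] tau_scale_right[OF tau]
      flip: scaleC_of_real)

lemma tensor_op_compose:
  assumes "A \<in> clinear_ops" "B \<in> clinear_ops" "C \<in> clinear_ops" "D \<in> clinear_ops"
  shows "tensor_op \<tau> A B o\<^sub>L tensor_op \<tau> C D = tensor_op \<tau> (A o\<^sub>L C) (B o\<^sub>L D)"
  by (rule tensor_op_eqI[symmetric])
    (simp_all add: assms clinear_compose tensor_op_apply[OF tau])

lemma tensor_op_compose_apply:
  assumes "A \<in> clinear_ops" "B \<in> clinear_ops" "C \<in> clinear_ops" "D \<in> clinear_ops"
  shows "blinfun_apply (tensor_op \<tau> A B) (blinfun_apply (tensor_op \<tau> C D) \<xi>) =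
    blinfun_apply (tensor_op \<tau> (A o\<^sub>L C) (B o\<^sub>L D)) \<xi>"
  using tensor_op_compose[OF assms] by (metis blinfun_apply_blinfun_compose)

lemma tensor_op_id: "tensor_op \<tau> id_blinfun id_blinfun = id_blinfun"
  by (rule tensor_op_eqI) (auto simp: clinear_id)

lemma tensor_op_algebraic:
  assumes "A \<in> clinear_ops" "B \<in> clinear_ops" "\<xi> \<in> algebraic_tensors \<tau>"
  shows "blinfun_apply (tensor_op \<tau> A B) \<xi> \<in> algebraic_tensors \<tau>"
  using assms(3)
  by (induction rule: algebraic_induct)
    (auto simp: blinfun.add_right tensor_op_apply[OF tau] assms algebraic_zero
      intro!: algebraic_add tau_in_algebraic)

lemma norm_tensor_op_le:
  assumes A: "A \<in> clinear_ops" and B: "B \<in> clinear_ops"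
  shows "norm (tensor_op \<tau> A B) \<le> norm A * norm B"
proof (rule norm_blinfun_bound)
  show "norm (blinfun_apply (tensor_op \<tau> A B) \<xi>) \<le> norm A * norm B * norm \<xi>" for \<xi>
  proof (induction \<xi> rule: algebraic_dense_induct)
    case closed
    show ?case by (intro closed_Collect_le continuous_intros)
  next
    case (algebraic \<xi>)
    then obtain xs where xs: "\<xi> = (\<Sum>(u, h)\<leftarrow>xs. \<tau> u h)"
      using tensor_cspan[OF tau] unfolding algebraic_tensors_def by auto
    have "blinfun_apply (tensor_op \<tau> A B) (\<Sum>(u, h)\<leftarrow>xs. \<tau> u h)
        = (\<Sum>(u, h)\<leftarrow>xs. \<tau> (blinfun_apply A u) (blinfun_apply B h))"
      by (induction xs) (auto simp: blinfun.add_right tensor_op_apply[OF tau] A B)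
    then show ?case
      using tensor_bound[OF tau A B, of xs] by (simp add: xs)
  qed
qed simp

lemma adjoint_pair_tensor:
  assumes adj: "adjoint_pair B C" and B: "B \<in> clinear_ops" and C: "C \<in> clinear_ops"
  shows "adjoint_pair (tensor_op \<tau> id_blinfun B) (tensor_op \<tau> id_blinfun C)"
proof -
  let ?B = "blinfun_apply (tensor_op \<tau> id_blinfun B)" and ?C = "blinfun_apply (tensor_op \<tau> id_blinfun C)"
  have gen: "cinner (?B (\<tau> u h)) (\<tau> u' h') = cinner (\<tau> u h) (?C (\<tau> u' h'))" for u h u' h'
    by (simp add: tensor_op_apply[OF tau] clinear_id B C tau_cinner[OF tau] adjoint_pairD[OF adj])
  have alg: "cinner (?B (\<tau> u h)) \<eta> = cinner (\<tau> u h) (?C \<eta>)" if "\<eta> \<in> algebraic_tensors \<tau>" for u h \<eta>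
    using that by (induction rule: algebraic_induct) (auto simp: blinfun.add_right cinner_add_right gen)
  have alg2: "cinner (?B \<xi>) \<eta> = cinner \<xi> (?C \<eta>)"
    if "\<xi> \<in> algebraic_tensors \<tau>" "\<eta> \<in> algebraic_tensors \<tau>" for \<xi> \<eta>
    using that(1) by (induction rule: algebraic_induct) (auto simp: blinfun.add_right cinner_add_left alg that(2))
  have cl: "continuous_on UNIV (\<lambda>x. cinner x (y::'k))" "continuous_on UNIV (\<lambda>x. cinner (y::'k) x)" for y
    by (rule linear_continuous_on bounded_linear_cinner_left bounded_linear_cinner_right)+
  have comp: "continuous_on UNIV (\<lambda>x. cinner (blinfun_apply A x) (y::'k))"
    "continuous_on UNIV (\<lambda>x. cinner (y::'k) (blinfun_apply A x))" for A y
    by (rule continuous_on_compose2[OF cl(1)] continuous_on_compose2[OF cl(2)];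
        auto intro: continuous_intros)+
  have alg3: "cinner (?B \<xi>) \<eta> = cinner \<xi> (?C \<eta>)" if \<xi>: "\<xi> \<in> algebraic_tensors \<tau>" for \<xi> \<eta>
  proof (induction \<eta> rule: algebraic_dense_induct)
    case closed
    show ?case by (intro closed_Collect_eq cl comp)
  qed (rule alg2[OF \<xi>])
  have "cinner (?B \<xi>) \<eta> = cinner \<xi> (?C \<eta>)" for \<xi> \<eta>
  proof (induction \<xi> rule: algebraic_dense_induct)
    case closed
    show ?case by (intro closed_Collect_eq cl comp)
  qed (rule alg3)
  then show ?thesis by (simp add: adjoint_pair_def)
qed

text \<open>With a common orthonormal family of left factors, matrix coefficients of
  \<open>A \<otimes> B\<close> at these vectors become double sums over \<open>G\<close>, and the
  right factors can be read off one by one.\<close>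

lemma algebraic_expansion:
  assumes "\<xi> \<in> algebraic_tensors \<tau>" "\<eta> \<in> algebraic_tensors \<tau>"
  obtains G h k where "finite G" "orthonormal G" "\<xi> = (\<Sum>g\<in>G. \<tau> g (h g))" "\<eta> = (\<Sum>g\<in>G. \<tau> g (k g))"
proof -
  \<comment> \<open>Quantifying over every \<open>G\<close> whose span contains \<open>S\<close>
    makes the claim stable under enlarging \<open>G\<close>, so that one \<open>G\<close> can serve
    both vectors.\<close>
  have ex: "\<exists>S. finite S \<and> (\<forall>G. finite G \<longrightarrow> orthonormal G \<longrightarrow> S \<subseteq> cspan G \<longrightarrow> (\<exists>h. \<zeta> = (\<Sum>g\<in>G. \<tau> g (h g))))"
    if "\<zeta> \<in> algebraic_tensors \<tau>" for \<zeta>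
    using that
  proof (induction rule: algebraic_induct)
    case zero
    show ?case
      by (intro exI[of _ "{}"]) (auto intro!: exI[of _ "\<lambda>_. 0"] simp: tau_zero_right[OF tau])
  next
    case (add u h \<xi>)
    then obtain S where S: "finite S"
      "\<And>G. finite G \<Longrightarrow> orthonormal G \<Longrightarrow> S \<subseteq> cspan G \<Longrightarrow> \<exists>h. \<xi> = (\<Sum>g\<in>G. \<tau> g (h g))"
      by blast
    show ?case
    proof (intro exI[of _ "insert u S"] conjI allI impI)
      fix G assume G: "finite G" "orthonormal G" "insert u S \<subseteq> cspan G"
      then obtain k where k: "\<xi> = (\<Sum>g\<in>G. \<tau> g (k g))" using S(2)[of G] by auto
      have "u = (\<Sum>g\<in>G. cinner u g *\<^sub>C g)"
        using proj_cspan[of G u] G by (simp add: proj_apply)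
      then have "\<tau> u h = (\<Sum>g\<in>G. \<tau> (cinner u g *\<^sub>C g) h)"
        using tau_sum_left by metis
      then have "\<tau> u h + \<xi> = (\<Sum>g\<in>G. \<tau> g (cinner u g *\<^sub>C h + k g))"
        by (simp add: k tau_add_right[OF tau] tau_scale_left[OF tau] tau_scale_right[OF tau] sum.distrib)
      then show "\<exists>k. \<tau> u h + \<xi> = (\<Sum>g\<in>G. \<tau> g (k g))"
        by (rule exI[of _ "\<lambda>g. cinner u g *\<^sub>C h + k g"])
    qed (use S in auto)
  qed
  obtain S where S: "finite S"
    "\<And>G. finite G \<Longrightarrow> orthonormal G \<Longrightarrow> S \<subseteq> cspan G \<Longrightarrow> \<exists>h. \<xi> = (\<Sum>g\<in>G. \<tau> g (h g))"
    using ex[OF assms(1)] by blast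
  obtain S' where S': "finite S'"
    "\<And>G. finite G \<Longrightarrow> orthonormal G \<Longrightarrow> S' \<subseteq> cspan G \<Longrightarrow> \<exists>h. \<eta> = (\<Sum>g\<in>G. \<tau> g (h g))"
    using ex[OF assms(2)] by blast
  obtain G where G: "finite G" "orthonormal G" "cspan G = cspan (S \<union> S')"
    using orthonormal_basis[of "S \<union> S'"] S S' by auto
  then have "S \<subseteq> cspan G" "S' \<subseteq> cspan G"
    using cvec.span_superset[of "S \<union> S'"] by auto
  then show ?thesis
    using S(2) S'(2) G that by metis
qed

text \<open>\<open>E\<close> is a basis of the span of all right factors that occur, and projecting
  onto this span leaves each of them fixed.\<close>

lemma algebraic_carrier:
  assumes "finite Z" "Z \<subseteq> algebraic_tensors \<tau>"
  obtains E where "finite E" "orthonormal E"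
    "\<And>\<zeta>. \<zeta> \<in> Z \<Longrightarrow> blinfun_apply (tensor_op \<tau> id_blinfun (proj E)) \<zeta> = \<zeta>"
proof -
  have "\<exists>S. finite S \<and> (\<forall>E. finite E \<longrightarrow> orthonormal E \<longrightarrow> S \<subseteq> cspan E \<longrightarrow>
      blinfun_apply (tensor_op \<tau> id_blinfun (proj E)) \<zeta> = \<zeta>)" if "\<zeta> \<in> algebraic_tensors \<tau>" for \<zeta>
    using that
  proof (induction rule: algebraic_induct)
    case zero
    show ?case by (intro exI[of _ "{}"]) auto
  next
    case (add u h \<xi>)
    then obtain S where S: "finite S" "\<And>E. finite E \<Longrightarrow> orthonormal E \<Longrightarrow> S \<subseteq> cspan E \<Longrightarrow>
      blinfun_apply (tensor_op \<tau> id_blinfun (proj E)) \<xi> = \<xi>" by blast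
    show ?case
      by (intro exI[of _ "insert h S"])
        (use S in \<open>auto simp: blinfun.add_right tensor_op_apply[OF tau] clinear_id clinear_proj proj_cspan\<close>)
  qed
  then obtain S where S: "\<And>\<zeta>. \<zeta> \<in> Z \<Longrightarrow> finite (S \<zeta>)" and
    *: "\<And>\<zeta> E. \<zeta> \<in> Z \<Longrightarrow> finite E \<Longrightarrow> orthonormal E \<Longrightarrow> S \<zeta> \<subseteq> cspan E \<Longrightarrow>
      blinfun_apply (tensor_op \<tau> id_blinfun (proj E)) \<zeta> = \<zeta>"
    using assms(2) by (metis subsetD)
  obtain E where E: "finite E" "orthonormal E" "cspan E = cspan (\<Union>\<zeta>\<in>Z. S \<zeta>)"
    using orthonormal_basis[of "\<Union>\<zeta>\<in>Z. S \<zeta>"] S assms(1) by auto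
  then have "S \<zeta> \<subseteq> cspan E" if "\<zeta> \<in> Z" for \<zeta>
    using cvec.span_superset[of "\<Union>\<zeta>\<in>Z. S \<zeta>"] that by auto
  then show ?thesis
    using that E * by metis
qed

end

text \<open>
  The operators \<open>V 0, \<dots>, V N\<close> embed a finite-dimensional space, the range of \<open>P\<close>, isometrically
  onto pairwise orthogonal subspaces of \<open>\<H>\<close>, so that direct sums can be formed inside \<open>\<H>\<close>.
\<close>

locale tensor_copies =
  fixes \<tau> :: "'u::complex_hilbert \<Rightarrow> 'h::complex_hilbert \<Rightarrow> 'k::complex_hilbert"
    and N :: nat and V W :: "nat \<Rightarrow> 'h \<Rightarrow>\<^sub>L 'h" and P :: "'h \<Rightarrow>\<^sub>L 'h"
  assumes tau: "hilbert_tensor \<tau>"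
    and V: "V i \<in> clinear_ops" and W: "W i \<in> clinear_ops" and P: "P \<in> clinear_ops"
    and adj: "adjoint_pair (V i) (W i)"
    and WV: "i \<le> N \<Longrightarrow> j \<le> N \<Longrightarrow> W i o\<^sub>L V j = (if i = j then P else 0)"
    and norm_P: "norm (blinfun_apply P h) \<le> norm h"
begin

lemma amp_WV:
  assumes "i \<le> N" "j \<le> N"
  shows "tensor_op \<tau> id_blinfun (W i) o\<^sub>L tensor_op \<tau> id_blinfun (V j) =
    (if i = j then tensor_op \<tau> id_blinfun P else 0)"
proof -
  have "id_blinfun o\<^sub>L id_blinfun = (id_blinfun :: 'u \<Rightarrow>\<^sub>L 'u)"
    by (rule blinfun_eqI) simp
  then show ?thesis
    using tensor_op_compose[OF tau clinear_id W clinear_id V, of i j] WV[OF assms]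
    by (simp add: tensor_op_zero_right[OF tau] clinear_id)
qed

lemma amp_adj: "adjoint_pair (tensor_op \<tau> id_blinfun (V i)) (tensor_op \<tau> id_blinfun (W i))"
  by (rule adjoint_pair_tensor[OF tau adj V W])

lemma norm_amp_P: "norm (blinfun_apply (tensor_op \<tau> id_blinfun P) x) \<le> norm x"
proof -
  have "norm P \<le> 1"
    by (rule norm_blinfun_bound) (use norm_P in auto)
  moreover have "norm (tensor_op \<tau> id_blinfun P) \<le> norm (id_blinfun :: 'u \<Rightarrow>\<^sub>L 'u) * norm P"
    by (rule norm_tensor_op_le[OF tau clinear_id P])
  ultimately have "norm (tensor_op \<tau> id_blinfun P) \<le> 1 * 1"
    using mult_mono[OF norm_blinfun_id_le[where 'a = 'u], of "norm P" 1] by simp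
  then show ?thesis
    using norm_blinfun[of "tensor_op \<tau> id_blinfun P" x]
      mult_right_mono[of "norm (tensor_op \<tau> id_blinfun P)" 1 "norm x"] by simp
qed

lemma cinner_amp_V:
  assumes "i \<le> N" "j \<le> N" "blinfun_apply (tensor_op \<tau> id_blinfun P) \<zeta> = \<zeta>"
  shows "cinner (blinfun_apply (tensor_op \<tau> id_blinfun (V i)) \<zeta>) (blinfun_apply (tensor_op \<tau> id_blinfun (V j)) \<eta>)
    = (if i = j then cinner \<zeta> \<eta> else 0)"
proof -
  have "cinner (blinfun_apply (tensor_op \<tau> id_blinfun (V i)) \<zeta>) (blinfun_apply (tensor_op \<tau> id_blinfun (V j)) \<eta>)
      = cinner (blinfun_apply (tensor_op \<tau> id_blinfun (W j) o\<^sub>L tensor_op \<tau> id_blinfun (V i)) \<zeta>) \<eta>"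
    using adjoint_pairD[OF adjoint_pair_sym[OF amp_adj]] by simp
  then show ?thesis
    using amp_WV[OF assms(2,1)] assms(3) by simp
qed

lemma norm_sum_amp_V:
  assumes "I \<subseteq> {..N}"
  shows "(norm (\<Sum>i\<in>I. blinfun_apply (tensor_op \<tau> id_blinfun (V i)) (\<zeta> i)))\<^sup>2 \<le> (\<Sum>i\<in>I. (norm (\<zeta> i))\<^sup>2)"
  by (rule sum_injective_copies(1)[where \<alpha> = "\<lambda>i. i" and J = "{..N}", OF amp_adj norm_amp_P])
    (use assms amp_WV finite_subset[OF assms] in auto)

lemma norm_block:
  assumes "finite I" "inj_on \<alpha> I" "\<alpha> ` I \<subseteq> {..N}" "inj_on \<beta> I" "\<beta> ` I \<subseteq> {..N}"
    and "\<And>i. i \<in> I \<Longrightarrow> norm (A i) \<le> r" "0 \<le> r"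
  shows "norm (\<Sum>i\<in>I. V (\<alpha> i) o\<^sub>L A i o\<^sub>L W (\<beta> i)) \<le> r"
  by (rule norm_block_le[where J = "{..N}", OF adj norm_P]) (use assms WV in auto)

end

lemma ex_tensor_copies:
  fixes \<tau> :: "'u::complex_hilbert \<Rightarrow> 'h::complex_hilbert \<Rightarrow> 'k::complex_hilbert"
  assumes "hilbert_tensor \<tau>" "infinite_dimensional TYPE('h)" "finite Z" "Z \<subseteq> algebraic_tensors \<tau>"
  obtains V W P where "tensor_copies \<tau> N V W P"
    "\<And>\<zeta>. \<zeta> \<in> Z \<Longrightarrow> blinfun_apply (tensor_op \<tau> id_blinfun P) \<zeta> = \<zeta>"
proof -
  obtain E where E: "finite E" "orthonormal E"
    and EZ: "\<And>\<zeta>. \<zeta> \<in> Z \<Longrightarrow> blinfun_apply (tensor_op \<tau> id_blinfun (proj E)) \<zeta> = \<zeta>"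
    using algebraic_carrier[OF assms(1,3,4)] by blast
  obtain V W where VW: "\<And>i. V i \<in> clinear_ops" "\<And>i. W i \<in> clinear_ops"
    "\<And>i::nat. adjoint_pair (V i) (W i)"
    "\<And>i j. i \<le> N \<Longrightarrow> j \<le> N \<Longrightarrow> W i o\<^sub>L V j = (if i = j then proj E else 0)"
    using ex_copies[OF assms(2) E, of N] by blast
  have "tensor_copies \<tau> N V W (proj E)"
    by unfold_locales (use assms(1) VW clinear_proj norm_proj_le[OF E(2,1)] in auto)
  then show ?thesis
    using that EZ by blast
qed

section \<open>Functionals on power series\<close>

abbreviation ampliation ::
    "('u::complex_hilbert \<Rightarrow> 'h::complex_hilbert \<Rightarrow> 'k::complex_hilbert) \<Rightarrow> ('h \<Rightarrow>\<^sub>L 'h) \<Rightarrow> 'k \<Rightarrow> 'k" where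
  "ampliation \<tau> A \<equiv> blinfun_apply (tensor_op \<tau> id_blinfun A)"

text \<open>Nilpotency is asked on one vector only. This is enough to make a test functional a
  finite sum that does not depend on the cutoff, and it is inherited by direct sums.\<close>

definition vanishes_beyond ::
    "('u::complex_hilbert \<Rightarrow> 'h::complex_hilbert \<Rightarrow> 'k::complex_hilbert) \<Rightarrow>
     ('d \<Rightarrow> 'h \<Rightarrow>\<^sub>L 'h) \<Rightarrow> nat \<Rightarrow> 'k \<Rightarrow> bool" where
  "vanishes_beyond \<tau> T N \<xi> \<longleftrightarrow> (\<forall>w. N < length w \<longrightarrow> ampliation \<tau> (word_op T w) \<xi> = 0)"

text \<open>
  Off the families of complex-linear operators \<open>tensor_op\<close> may be a junk value, and the functional is
  set to 0 there.
\<close>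

definition test_functional ::
    "('u::complex_hilbert \<Rightarrow> 'h::complex_hilbert \<Rightarrow> 'k::complex_hilbert) \<Rightarrow>
     ('d::finite \<Rightarrow> 'h \<Rightarrow>\<^sub>L 'h) \<Rightarrow> nat \<Rightarrow> 'k \<Rightarrow> 'k \<Rightarrow> ('d list \<Rightarrow> 'u \<Rightarrow>\<^sub>L 'u) \<Rightarrow> complex" where
  "test_functional \<tau> T N \<xi> \<eta> x = (if range x \<subseteq> clinear_ops
     then \<Sum>w | length w \<le> N. cinner (blinfun_apply (tensor_op \<tau> (x w) (word_op T w)) \<xi>) \<eta> else 0)"

lemma finite_words_le: "finite {w :: 'd::finite list. length w \<le> N}"
  using finite_lists_length_le[of "UNIV :: 'd set" N] by simp

lemma sum_words_le:
  "(\<Sum>w | length (w :: 'd::finite list) \<le> N. f w) = (\<Sum>j\<le>N. \<Sum>w | length w = j. f w)"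
  for f :: "'d::finite list \<Rightarrow> 'a::comm_monoid_add"
proof -
  have "(\<Sum>j\<in>{..N}. \<Sum>w\<in>{w \<in> {w. length w \<le> N}. length w = j}. f w) = sum f {w. length w \<le> N}"
    by (intro sum.group finite_words_le) auto
  moreover have "{w \<in> {w :: 'd list. length w \<le> N}. length w = j} = {w. length w = j}" if "j \<in> {..N}" for j
    using that by auto
  ultimately show ?thesis by simp
qed

lemma polydisc_clinear: "T \<in> polydisc \<Longrightarrow> T j \<in> clinear_ops"
  and polydisc_norm: "T \<in> polydisc \<Longrightarrow> norm (T j) < 1"
  and polydisc_word: "T \<in> polydisc \<Longrightarrow> word_op T w \<in> clinear_ops"
  by (auto simp: polydisc_def intro: clinear_word_op)

lemma polydisc_radius:
  fixes T :: "'d::finite \<Rightarrow> 'h::complex_hilbert \<Rightarrow>\<^sub>L 'h"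
  assumes "T \<in> polydisc"
  obtains r where "0 < r" "r < 1" "\<And>j. norm (T j) < r"
proof -
  define m where "m = Max (range (\<lambda>j. norm (T j)))"
  have "m < 1"
    unfolding m_def using polydisc_norm[OF assms] by (subst Max_less_iff) auto
  have le: "norm (T j) \<le> m" for j
    unfolding m_def by (rule Max_ge) auto
  then have "0 \<le> m" using norm_ge_zero order_trans by blast
  show ?thesis
  \<comment> \<open>The midpoint, unlike \<open>m\<close>, lies strictly above all the norms and is
    positive even for the zero tuple.\<close>
  proof (rule that[of "(m + 1) / 2"])
    show "norm (T j) < (m + 1) / 2" for j
      using le[of j] \<open>m < 1\<close> by simp
  qed (use \<open>m < 1\<close> \<open>0 \<le> m\<close> in auto)
qed

lemma blinfun_compose_id [simp]: "A o\<^sub>L id_blinfun = A" "id_blinfun o\<^sub>L A = A"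
  by (rule blinfun_eqI; simp)+

section \<open>Ampliations and elementary properties of test functionals\<close>

context
  fixes \<tau> :: "'u::complex_hilbert \<Rightarrow> 'h::complex_hilbert \<Rightarrow> 'k::complex_hilbert"
  assumes tau: "hilbert_tensor \<tau>"
begin

text \<open>Separates the coefficient from the word. As \<open>A \<otimes> 1\<close> commutes with
  ampliations, intertwining relations need to be checked for ampliations only.\<close>

lemma tensor_op_ampliation:
  assumes "A \<in> clinear_ops" "B \<in> clinear_ops"
  shows "blinfun_apply (tensor_op \<tau> A B) \<xi> = blinfun_apply (tensor_op \<tau> A id_blinfun) (ampliation \<tau> B \<xi>)"
  by (simp add: tensor_op_compose_apply[OF tau] assms clinear_id)

lemma ampliation_commute:
  assumes "A \<in> clinear_ops" "B \<in> clinear_ops"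
  shows "ampliation \<tau> B (blinfun_apply (tensor_op \<tau> A id_blinfun) \<xi>) =
    blinfun_apply (tensor_op \<tau> A id_blinfun) (ampliation \<tau> B \<xi>)"
  by (simp add: tensor_op_compose_apply[OF tau] assms clinear_id)

lemma ampliation_compose:
  assumes "A \<in> clinear_ops" "B \<in> clinear_ops"
  shows "ampliation \<tau> (A o\<^sub>L B) \<xi> = ampliation \<tau> A (ampliation \<tau> B \<xi>)"
  by (simp add: tensor_op_compose_apply[OF tau] assms clinear_id)

lemma ampliation_word_Cons:
  assumes "T \<in> polydisc"
  shows "ampliation \<tau> (word_op T (j # w)) \<xi> = ampliation \<tau> (T j) (ampliation \<tau> (word_op T w) \<xi>)"
  by (simp add: ampliation_compose polydisc_clinear polydisc_word assms)

lemma ampliation_zero: "ampliation \<tau> 0 \<xi> = 0"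
  by (simp add: tensor_op_zero_right[OF tau] clinear_id)

text \<open>Longer words kill \<open>\<xi>\<close> and contribute nothing. Two functionals can thus
  be given a common cutoff before they are added.\<close>

lemma test_functional_mono:
  fixes T :: "'d::finite \<Rightarrow> 'h \<Rightarrow>\<^sub>L 'h"
  assumes "T \<in> polydisc" "vanishes_beyond \<tau> T N \<xi>" "N \<le> M"
  shows "test_functional \<tau> T M \<xi> \<eta> = test_functional \<tau> T N \<xi> \<eta>"
proof
  fix x :: "'d list \<Rightarrow> 'u \<Rightarrow>\<^sub>L 'u"
  have "(\<Sum>w | length w \<le> M. cinner (blinfun_apply (tensor_op \<tau> (x w) (word_op T w)) \<xi>) \<eta>)
      = (\<Sum>w | length w \<le> N. cinner (blinfun_apply (tensor_op \<tau> (x w) (word_op T w)) \<xi>) \<eta>)"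
    if x: "range x \<subseteq> clinear_ops"
  proof (rule sum.mono_neutral_right[OF finite_words_le])
    show "\<forall>w\<in>{w. length w \<le> M} - {w. length w \<le> N}.
        cinner (blinfun_apply (tensor_op \<tau> (x w) (word_op T w)) \<xi>) \<eta> = 0"
    proof
      fix w :: "'d list" assume "w \<in> {w. length w \<le> M} - {w. length w \<le> N}"
      then have "ampliation \<tau> (word_op T w) \<xi> = 0"
        using assms(2) by (auto simp: vanishes_beyond_def)
      moreover have "x w \<in> clinear_ops" using x by auto
      ultimately show "cinner (blinfun_apply (tensor_op \<tau> (x w) (word_op T w)) \<xi>) \<eta> = 0"
        using tensor_op_ampliation[of "x w" "word_op T w" \<xi>] assms(1) by (simp add: polydisc_word)
    qed
  qed (use assms(3) in auto)
  then show "test_functional \<tau> T M \<xi> \<eta> x = test_functional \<tau> T N \<xi> \<eta> x"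
    by (simp add: test_functional_def)
qed

lemma vanishes_beyond_mono: "vanishes_beyond \<tau> T N \<xi> \<Longrightarrow> N \<le> M \<Longrightarrow> vanishes_beyond \<tau> T M \<xi>"
  by (auto simp: vanishes_beyond_def)

lemma test_functional_scale:
  assumes T: "T \<in> polydisc"
  shows "test_functional \<tau> T N (a *\<^sub>C \<xi>) (b *\<^sub>C \<eta>) x = a * cnj b * test_functional \<tau> T N \<xi> \<eta> x"
proof (cases "range x \<subseteq> clinear_ops")
  case True
  then have x: "x w \<in> clinear_ops" for w by auto
  have "blinfun_apply (tensor_op \<tau> (x w) (word_op T w)) (a *\<^sub>C \<xi>)
      = a *\<^sub>C blinfun_apply (tensor_op \<tau> (x w) (word_op T w)) \<xi>" for w
    by (rule clinear_opsD) (rule tensor_op_clinear[OF tau x polydisc_word[OF T]])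
  then show ?thesis
    by (simp add: test_functional_def cinner_scaleC_left cinner_scaleC_right sum_distrib_left mult_ac)
qed (simp add: test_functional_def)

section \<open>Functionals built from orthogonal copies\<close>

context
  assumes inf: "infinite_dimensional TYPE('h)"
begin

text \<open>\<open>S\<close> is block diagonal with blocks \<open>T i\<close> on orthogonal copies.
  \<open>V i\<close> intertwines \<open>T i\<close> with \<open>S\<close> only up to the factor
  \<open>P = W i V i\<close>, but \<open>P\<close> fixes all vectors obtained from
  \<open>\<xi> i\<close> by words, of which only finitely many are nonzero.\<close>

lemma direct_sum_functional:
  fixes T :: "nat \<Rightarrow> 'd::finite \<Rightarrow> 'h \<Rightarrow>\<^sub>L 'h"
  assumes T: "\<And>i. T i \<in> polydisc" and \<xi>: "\<And>i. \<xi> i \<in> algebraic_tensors \<tau>"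
    and \<eta>: "\<And>i. \<eta> i \<in> algebraic_tensors \<tau>" and van: "\<And>i. vanishes_beyond \<tau> (T i) N (\<xi> i)"
  obtains S \<xi>' \<eta>' where "S \<in> polydisc" "\<xi>' \<in> algebraic_tensors \<tau>" "\<eta>' \<in> algebraic_tensors \<tau>"
    "vanishes_beyond \<tau> S N \<xi>'"
    "\<And>x. test_functional \<tau> S N \<xi>' \<eta>' x = (\<Sum>i\<le>M. test_functional \<tau> (T i) N (\<xi> i) (\<eta> i) x)"
    "(norm \<xi>')\<^sup>2 \<le> (\<Sum>i\<le>M. (norm (\<xi> i))\<^sup>2)" "(norm \<eta>')\<^sup>2 \<le> (\<Sum>i\<le>M. (norm (\<eta> i))\<^sup>2)"
proof -
  define Z where "Z = (\<Union>i\<le>M. (\<lambda>w. ampliation \<tau> (word_op (T i) w) (\<xi> i)) ` {w. length w \<le> N})"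
  have Z: "finite Z" "Z \<subseteq> algebraic_tensors \<tau>"
    using T \<xi> by (auto simp: Z_def finite_words_le clinear_id polydisc_word intro!: tensor_op_algebraic[OF tau])
  obtain V W P where copies: "tensor_copies \<tau> M V W P"
    and PZ: "\<And>\<zeta>. \<zeta> \<in> Z \<Longrightarrow> ampliation \<tau> P \<zeta> = \<zeta>"
    using ex_tensor_copies[OF tau inf Z] by blast
  interpret C: tensor_copies \<tau> M V W P by (fact copies)
  have carried: "ampliation \<tau> P (ampliation \<tau> (word_op (T i) w) (\<xi> i)) = ampliation \<tau> (word_op (T i) w) (\<xi> i)"
    if "i \<le> M" for i w
  proof (cases "length w \<le> N")
    case True
    then show ?thesis using that by (intro PZ) (auto simp: Z_def)
  next
    case False
    then have "ampliation \<tau> (word_op (T i) w) (\<xi> i) = 0"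
      using van[of i] by (auto simp: vanishes_beyond_def)
    then show ?thesis by simp
  qed
  define S where "S j = (\<Sum>i\<le>M. V i o\<^sub>L T i j o\<^sub>L W i)" for j
  have S: "S \<in> polydisc"
    unfolding polydisc_def
  proof (intro CollectI allI conjI)
    fix j
    show "S j \<in> clinear_ops"
      unfolding S_def using C.V C.W polydisc_clinear[OF T] by (intro clinear_sum clinear_compose)
    define r where "r = Max ((\<lambda>i. norm (T i j)) ` {..M})"
    have r: "norm (T i j) \<le> r" if "i \<le> M" for i
      unfolding r_def using that by (intro Max_ge) auto
    have "r < 1"
      unfolding r_def using polydisc_norm[OF T] by (subst Max_less_iff) auto
    moreover have "norm (S j) \<le> r"
      unfolding S_def
      by (rule C.norm_block[where \<alpha> = "\<lambda>i. i" and \<beta> = "\<lambda>i. i"]) (use r order_trans[OF norm_ge_zero r[of 0]] in auto)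
    ultimately show "norm (S j) < 1" by simp
  qed
  have SV: "S j o\<^sub>L V i = V i o\<^sub>L T i j o\<^sub>L P" if "i \<le> M" for i j
  proof (rule blinfun_eqI)
    fix h
    have "blinfun_apply (V i' o\<^sub>L T i' j o\<^sub>L W i') (blinfun_apply (V i) h) =
        (if i' = i then blinfun_apply (V i o\<^sub>L T i j o\<^sub>L P) h else 0)" if "i' \<le> M" for i'
    proof -
      have "blinfun_apply (W i') (blinfun_apply (V i) h) = blinfun_apply (W i' o\<^sub>L V i) h" by simp
      then show ?thesis
        using C.WV[OF that \<open>i \<le> M\<close>] by simp
    qed
    then show "blinfun_apply (S j o\<^sub>L V i) h = blinfun_apply (V i o\<^sub>L T i j o\<^sub>L P) h"
      using \<open>i \<le> M\<close> by (simp add: S_def blinfun.sum_left)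
  qed
  have word: "ampliation \<tau> (word_op S w) (ampliation \<tau> (V i) (\<xi> i)) =
      ampliation \<tau> (V i) (ampliation \<tau> (word_op (T i) w) (\<xi> i))" if i: "i \<le> M" for i w
  proof (induction w)
    case Nil
    then show ?case by (simp add: tensor_op_id[OF tau])
  next
    case (Cons j w)
    have "ampliation \<tau> (word_op S (j # w)) (ampliation \<tau> (V i) (\<xi> i)) =
        ampliation \<tau> (S j o\<^sub>L V i) (ampliation \<tau> (word_op (T i) w) (\<xi> i))"
      by (simp only: ampliation_word_Cons[OF S] Cons ampliation_compose[OF polydisc_clinear[OF S] C.V])
    also have "\<dots> = ampliation \<tau> (V i) (ampliation \<tau> (T i j) (ampliation \<tau> P (ampliation \<tau> (word_op (T i) w) (\<xi> i))))"
      unfolding SV[OF i] using C.V C.P polydisc_clinear[OF T] by (simp add: ampliation_compose clinear_compose)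
    finally show ?case
      by (simp only: carried[OF i] ampliation_word_Cons[OF T])
  qed
  define \<xi>' where "\<xi>' = (\<Sum>i\<le>M. ampliation \<tau> (V i) (\<xi> i))"
  \<comment> \<open>\<open>P\<close> need not fix \<open>\<eta> i\<close>: in
    \<open>cinner_amp_V\<close> it lands on the first argument, which it does fix.\<close>
  define \<eta>' where "\<eta>' = (\<Sum>i\<le>M. ampliation \<tau> (V i) (\<eta> i))"
  show ?thesis
  proof (rule that[OF S])
    show "\<xi>' \<in> algebraic_tensors \<tau>" "\<eta>' \<in> algebraic_tensors \<tau>"
      unfolding \<xi>'_def \<eta>'_def using \<xi> \<eta> C.V
      by (auto intro!: algebraic_sum[OF tau] tensor_op_algebraic[OF tau] clinear_id)
    show "(norm \<xi>')\<^sup>2 \<le> (\<Sum>i\<le>M. (norm (\<xi> i))\<^sup>2)" "(norm \<eta>')\<^sup>2 \<le> (\<Sum>i\<le>M. (norm (\<eta> i))\<^sup>2)"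
      unfolding \<xi>'_def \<eta>'_def by (rule C.norm_sum_amp_V; simp)+
    have word': "ampliation \<tau> (word_op S w) \<xi>' =
        (\<Sum>i\<le>M. ampliation \<tau> (V i) (ampliation \<tau> (word_op (T i) w) (\<xi> i)))" for w
      by (simp add: \<xi>'_def blinfun.sum_right word)
    show "vanishes_beyond \<tau> S N \<xi>'"
      using van by (simp add: vanishes_beyond_def word')
    fix x
    show "test_functional \<tau> S N \<xi>' \<eta>' x = (\<Sum>i\<le>M. test_functional \<tau> (T i) N (\<xi> i) (\<eta> i) x)"
    proof (cases "range x \<subseteq> clinear_ops")
      case True
      then have x: "x w \<in> clinear_ops" for w by auto
      have "cinner (blinfun_apply (tensor_op \<tau> (x w) (word_op S w)) \<xi>') \<eta>' =
          (\<Sum>i\<le>M. cinner (blinfun_apply (tensor_op \<tau> (x w) (word_op (T i) w)) (\<xi> i)) (\<eta> i))" for w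
      proof -
        define a where "a i = blinfun_apply (tensor_op \<tau> (x w) (word_op (T i) w)) (\<xi> i)" for i
        have a: "a i = blinfun_apply (tensor_op \<tau> (x w) id_blinfun) (ampliation \<tau> (word_op (T i) w) (\<xi> i))" for i
          unfolding a_def by (rule tensor_op_ampliation[OF x polydisc_word[OF T]])
        have Pa: "ampliation \<tau> P (a i) = a i" if "i \<le> M" for i
          by (simp add: a ampliation_commute[OF x C.P] carried[OF that])
        have "blinfun_apply (tensor_op \<tau> (x w) (word_op S w)) \<xi>' = (\<Sum>i\<le>M. ampliation \<tau> (V i) (a i))"
          unfolding tensor_op_ampliation[OF x polydisc_word[OF S]] word' a
          by (simp add: blinfun.sum_right ampliation_commute[OF x C.V])
        then have "cinner (blinfun_apply (tensor_op \<tau> (x w) (word_op S w)) \<xi>') \<eta>' =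
            (\<Sum>i\<le>M. \<Sum>j\<le>M. if i = j then cinner (a i) (\<eta> j) else 0)"
          unfolding \<eta>'_def cinner_sum_left cinner_sum_right
          by (simp add: cinner_sum_left cinner_sum_right C.cinner_amp_V Pa)
        then show ?thesis by (simp add: a_def)
      qed
      then show ?thesis
        using True by (simp add: test_functional_def sum.swap[of _ "{..M}"])
    qed (simp add: test_functional_def)
  qed
qed

text \<open>\<open>S\<close> is a copy of \<open>T\<close> tensored with the nilpotent shift on $\mathbb C^{N+1}$.\<close>

lemma shift_functional:
  fixes T :: "'d::finite \<Rightarrow> 'h \<Rightarrow>\<^sub>L 'h" and a b :: "nat \<Rightarrow> real"
  assumes T: "T \<in> polydisc" and \<xi>: "\<xi> \<in> algebraic_tensors \<tau>" and \<eta>: "\<eta> \<in> algebraic_tensors \<tau>"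
  obtains S \<xi>' \<eta>' where "S \<in> polydisc" "\<xi>' \<in> algebraic_tensors \<tau>" "\<eta>' \<in> algebraic_tensors \<tau>"
    "vanishes_beyond \<tau> S N \<xi>'"
    "\<And>x. range x \<subseteq> clinear_ops \<Longrightarrow> test_functional \<tau> S N \<xi>' \<eta>' x =
      (\<Sum>j\<le>N. of_real (\<Sum>m=j..N. a m * b (m - j)) * cinner (blinfun_apply (homogeneous_part \<tau> x T j) \<xi>) \<eta>)"
    "(norm \<xi>')\<^sup>2 \<le> (\<Sum>m\<le>N. (a m)\<^sup>2) * (norm \<xi>)\<^sup>2" "(norm \<eta>')\<^sup>2 \<le> (\<Sum>m\<le>N. (b m)\<^sup>2) * (norm \<eta>)\<^sup>2"
proof -
  define Z where "Z = (\<lambda>w. ampliation \<tau> (word_op T w) \<xi>) ` {w. length w \<le> N}"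
  have Z: "finite Z" "Z \<subseteq> algebraic_tensors \<tau>"
    using T \<xi> by (auto simp: Z_def finite_words_le clinear_id polydisc_word intro!: tensor_op_algebraic[OF tau])
  obtain V W P where copies: "tensor_copies \<tau> N V W P"
    and PZ: "\<And>\<zeta>. \<zeta> \<in> Z \<Longrightarrow> ampliation \<tau> P \<zeta> = \<zeta>"
    using ex_tensor_copies[OF tau inf Z] by blast
  interpret C: tensor_copies \<tau> N V W P by (fact copies)
  have carried: "ampliation \<tau> P (ampliation \<tau> (word_op T w) \<xi>) = ampliation \<tau> (word_op T w) \<xi>"
    if "length w \<le> N" for w
    using that by (intro PZ) (auto simp: Z_def)
  \<comment> \<open>Each letter lowers the copy by one, so a word of length \<open>l\<close> sends
    copy \<open>m\<close> to copy \<open>m - l\<close>, or to 0 if \<open>l > m\<close>. This alone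
    makes \<open>S\<close> vanish beyond \<open>N\<close>; nothing of the kind is assumed of
    \<open>T\<close>.\<close>
  define S where "S j = (\<Sum>i<N. V i o\<^sub>L T j o\<^sub>L W (Suc i))" for j
  have S: "S \<in> polydisc"
    unfolding polydisc_def
  proof (intro CollectI allI conjI)
    fix j
    show "S j \<in> clinear_ops"
      unfolding S_def using C.V C.W polydisc_clinear[OF T] by (intro clinear_sum clinear_compose)
    have "norm (S j) \<le> norm (T j)"
      unfolding S_def by (rule C.norm_block[where \<alpha> = "\<lambda>i. i" and \<beta> = Suc]) auto
    then show "norm (S j) < 1"
      using polydisc_norm[OF T, of j] by simp
  qed
  have SV: "S j o\<^sub>L V m = (if m = 0 then 0 else V (m - 1) o\<^sub>L T j o\<^sub>L P)" if m: "m \<le> N" for m j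
  proof (rule blinfun_eqI)
    fix h
    have "blinfun_apply (V i o\<^sub>L T j o\<^sub>L W (Suc i)) (blinfun_apply (V m) h) =
        (if Suc i = m then blinfun_apply (V (m - 1) o\<^sub>L T j o\<^sub>L P) h else 0)" if "i < N" for i
    proof -
      have "blinfun_apply (W (Suc i)) (blinfun_apply (V m) h) = blinfun_apply (W (Suc i) o\<^sub>L V m) h" by simp
      then show ?thesis
        using C.WV[of "Suc i" m] that m by auto
    qed
    then have "blinfun_apply (S j o\<^sub>L V m) h =
        (\<Sum>i<N. if Suc i = m then blinfun_apply (V (m - 1) o\<^sub>L T j o\<^sub>L P) h else 0)"
      by (simp add: S_def blinfun.sum_left)
    also have "\<dots> = blinfun_apply (if m = 0 then 0 else V (m - 1) o\<^sub>L T j o\<^sub>L P) h"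
      using m by (cases m) auto
    finally show "blinfun_apply (S j o\<^sub>L V m) h =
        blinfun_apply (if m = 0 then 0 else V (m - 1) o\<^sub>L T j o\<^sub>L P) h" .
  qed
  have word: "ampliation \<tau> (word_op S w) (ampliation \<tau> (V m) \<xi>) =
      (if length w \<le> m then ampliation \<tau> (V (m - length w)) (ampliation \<tau> (word_op T w) \<xi>) else 0)"
    if m: "m \<le> N" for m w
  proof (induction w)
    case Nil
    then show ?case by (simp add: tensor_op_id[OF tau])
  next
    case (Cons j w)
    have step: "ampliation \<tau> (word_op S (j # w)) (ampliation \<tau> (V m) \<xi>) =
        ampliation \<tau> (S j) (ampliation \<tau> (word_op S w) (ampliation \<tau> (V m) \<xi>))"
      by (rule ampliation_word_Cons[OF S])
    show ?case
    proof (cases "length w \<le> m")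
      case True
      have "ampliation \<tau> (S j) (ampliation \<tau> (V (m - length w)) (ampliation \<tau> (word_op T w) \<xi>)) =
          ampliation \<tau> (S j o\<^sub>L V (m - length w)) (ampliation \<tau> (word_op T w) \<xi>)"
        by (rule ampliation_compose[OF polydisc_clinear[OF S] C.V, symmetric])
      also have "\<dots> = (if m = length w then 0 else ampliation \<tau> (V (m - length w - 1))
          (ampliation \<tau> (T j) (ampliation \<tau> P (ampliation \<tau> (word_op T w) \<xi>))))"
        using SV[of "m - length w" j] m True C.V C.P polydisc_clinear[OF T]
        by (simp add: ampliation_compose clinear_compose ampliation_zero)
      also have "ampliation \<tau> P (ampliation \<tau> (word_op T w) \<xi>) = ampliation \<tau> (word_op T w) \<xi>"
        using True m by (intro carried) simp
      finally show ?thesis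
        using True by (auto simp: step Cons ampliation_word_Cons[OF T] simp del: word_op.simps)
    next
      case False
      then show ?thesis by (simp add: step Cons del: word_op.simps)
    qed
  qed
  \<comment> \<open>A word of length \<open>j\<close> moves copy \<open>m\<close>, of weight
    \<open>a m\<close>, onto copy \<open>m - j\<close>, where it meets the weight
    \<open>b (m - j)\<close> of \<open>\<eta>'\<close>. This is the origin of the coefficients
    \<open>\<Sum>m=j..N. a m * b (m - j)\<close>.\<close>
  define \<xi>' where "\<xi>' = (\<Sum>m\<le>N. ampliation \<tau> (V m) (a m *\<^sub>R \<xi>))"
  define \<eta>' where "\<eta>' = (\<Sum>m\<le>N. ampliation \<tau> (V m) (b m *\<^sub>R \<eta>))"
  show ?thesis
  proof (rule that[OF S])
    have "a m *\<^sub>R \<xi> \<in> algebraic_tensors \<tau>" "b m *\<^sub>R \<eta> \<in> algebraic_tensors \<tau>" for m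
      using \<xi> \<eta> by (auto simp flip: scaleC_of_real intro: algebraic_scale[OF tau])
    then show "\<xi>' \<in> algebraic_tensors \<tau>" "\<eta>' \<in> algebraic_tensors \<tau>"
      unfolding \<xi>'_def \<eta>'_def using C.V
      by (auto intro!: algebraic_sum[OF tau] tensor_op_algebraic[OF tau] clinear_id)
    show "(norm \<xi>')\<^sup>2 \<le> (\<Sum>m\<le>N. (a m)\<^sup>2) * (norm \<xi>)\<^sup>2" "(norm \<eta>')\<^sup>2 \<le> (\<Sum>m\<le>N. (b m)\<^sup>2) * (norm \<eta>)\<^sup>2"
      using C.norm_sum_amp_V[of "{..N}" "\<lambda>m. a m *\<^sub>R \<xi>"] C.norm_sum_amp_V[of "{..N}" "\<lambda>m. b m *\<^sub>R \<eta>"]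
      by (simp_all add: \<xi>'_def \<eta>'_def power_mult_distrib sum_distrib_right)
    have word': "ampliation \<tau> (word_op S w) \<xi>' = (\<Sum>m\<in>{length w..N}.
        a m *\<^sub>R ampliation \<tau> (V (m - length w)) (ampliation \<tau> (word_op T w) \<xi>))" for w
    proof -
      have "ampliation \<tau> (word_op S w) \<xi>' = (\<Sum>m\<le>N. if length w \<le> m
          then a m *\<^sub>R ampliation \<tau> (V (m - length w)) (ampliation \<tau> (word_op T w) \<xi>) else 0)"
        unfolding \<xi>'_def by (auto simp: blinfun.sum_right blinfun.scaleR_right word intro!: sum.cong)
      also have "\<dots> = (\<Sum>m\<in>{m \<in> {..N}. length w \<le> m}.
          a m *\<^sub>R ampliation \<tau> (V (m - length w)) (ampliation \<tau> (word_op T w) \<xi>))"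
        by (rule sum.inter_filter[symmetric]) simp
      also have "{m \<in> {..N}. length w \<le> m} = {length w..N}" by auto
      finally show ?thesis .
    qed
    show "vanishes_beyond \<tau> S N \<xi>'"
      by (simp add: vanishes_beyond_def word')
    fix x :: "'d list \<Rightarrow> 'u \<Rightarrow>\<^sub>L 'u" assume x': "range x \<subseteq> clinear_ops"
    then have x: "x w \<in> clinear_ops" for w by auto
    let ?c = "\<lambda>j. complex_of_real (\<Sum>m=j..N. a m * b (m - j))"
    have "cinner (blinfun_apply (tensor_op \<tau> (x w) (word_op S w)) \<xi>') \<eta>' =
        ?c (length w) * cinner (blinfun_apply (tensor_op \<tau> (x w) (word_op T w)) \<xi>) \<eta>"
      if w: "length w \<le> N" for w
    proof -
      define c where "c = blinfun_apply (tensor_op \<tau> (x w) (word_op T w)) \<xi>"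
      have c: "c = blinfun_apply (tensor_op \<tau> (x w) id_blinfun) (ampliation \<tau> (word_op T w) \<xi>)"
        unfolding c_def by (rule tensor_op_ampliation[OF x polydisc_word[OF T]])
      have Pc: "ampliation \<tau> P c = c"
        by (simp add: c ampliation_commute[OF x C.P] carried[OF w])
      have "blinfun_apply (tensor_op \<tau> (x w) (word_op S w)) \<xi>' =
          (\<Sum>m\<in>{length w..N}. a m *\<^sub>R ampliation \<tau> (V (m - length w)) c)"
        unfolding tensor_op_ampliation[OF x polydisc_word[OF S]] word' c
        by (simp add: blinfun.sum_right blinfun.scaleR_right ampliation_commute[OF x C.V])
      then have "cinner (blinfun_apply (tensor_op \<tau> (x w) (word_op S w)) \<xi>') \<eta>' =
          (\<Sum>m\<in>{length w..N}. cinner (a m *\<^sub>R ampliation \<tau> (V (m - length w)) c) \<eta>')"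
        by (simp add: cinner_sum_left)
      also have "\<dots> = (\<Sum>m\<in>{length w..N}. \<Sum>k\<le>N. if m - length w = k then of_real (a m * b k) * cinner c \<eta> else 0)"
        unfolding \<eta>'_def cinner_sum_right
        by (intro sum.cong refl)
          (auto simp: cinner_scaleR_left cinner_scaleR_right blinfun.scaleR_right C.cinner_amp_V Pc)
      also have "\<dots> = (\<Sum>m\<in>{length w..N}. of_real (a m * b (m - length w)) * cinner c \<eta>)"
        by (intro sum.cong refl) auto
      also have "\<dots> = ?c (length w) * cinner c \<eta>"
        by (simp add: sum_distrib_right)
      finally show ?thesis by (simp add: c_def)
    qed
    then have "test_functional \<tau> S N \<xi>' \<eta>' x = (\<Sum>w | length w \<le> N.
        ?c (length w) * cinner (blinfun_apply (tensor_op \<tau> (x w) (word_op T w)) \<xi>) \<eta>)"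
      using x' by (simp add: test_functional_def)
    also have "\<dots> = (\<Sum>j\<le>N. ?c j * cinner (blinfun_apply (homogeneous_part \<tau> x T j) \<xi>) \<eta>)"
      unfolding sum_words_le
      by (intro sum.cong refl)
        (simp add: homogeneous_part_def blinfun.sum_left cinner_sum_left sum_distrib_left)
    finally show "test_functional \<tau> S N \<xi>' \<eta>' x =
      (\<Sum>j\<le>N. ?c j * cinner (blinfun_apply (homogeneous_part \<tau> x T j) \<xi>) \<eta>)" .
  qed
qed

text \<open>Here \<open>S\<close> is a weighted shift along the letters of \<open>w\<close>; the weight \<open>1/2\<close> keeps it in the open polydisc.\<close>

lemma unit_functional:
  fixes w :: "'d::finite list"
  obtains S :: "'d \<Rightarrow> 'h \<Rightarrow>\<^sub>L 'h" and \<xi> \<eta> where "S \<in> polydisc" "\<xi> \<in> algebraic_tensors \<tau>" "\<eta> \<in> algebraic_tensors \<tau>"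
    "vanishes_beyond \<tau> S (length w) \<xi>"
    "\<And>x. range x \<subseteq> clinear_ops \<Longrightarrow> test_functional \<tau> S (length w) \<xi> \<eta> x = cinner (blinfun_apply (x w) u) v"
    "norm \<xi> = norm u" "norm \<eta> = 2 ^ length w * norm v"
proof -
  define n where "n = length w"
  obtain E :: "'h set" where E: "finite E" "orthonormal E" "card E = 1"
    using ex_orthonormal_card[OF inf] by blast
  then obtain e where e: "E = {e}" by (auto simp: card_1_singleton_iff)
  obtain V W where VW: "\<And>i. V i \<in> clinear_ops" "\<And>i. W i \<in> clinear_ops"
    and adj: "\<And>i::nat. adjoint_pair (V i) (W i)"
    and WV: "\<And>i j. i \<le> n \<Longrightarrow> j \<le> n \<Longrightarrow> W i o\<^sub>L V j = (if i = j then proj E else 0)"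
    using ex_copies[OF inf E(1,2), of n] by blast
  define f where "f i = blinfun_apply (V i) e" for i
  have Wf: "blinfun_apply (W i) (f j) = (if i = j then e else 0)" if "i \<le> n" "j \<le> n" for i j
  proof -
    have "blinfun_apply (W i) (f j) = blinfun_apply (W i o\<^sub>L V j) e" by (simp add: f_def)
    moreover have "blinfun_apply (proj E) e = e"
      by (rule proj_cspan[OF E(2,1)]) (auto simp: e intro: cvec.span_base)
    ultimately show ?thesis by (simp add: WV[OF that])
  qed
  have ff: "cinner (f i) (f j) = (if i = j then 1 else 0)" if "i \<le> n" "j \<le> n" for i j
    using adjoint_pairD[OF adjoint_pair_sym[OF adj], of j "f i" e] Wf[OF that(2,1)] E(2)
    by (auto simp: f_def[of j] e orthonormal_def)
  have nf: "norm (f i) = 1" if "i \<le> n" for i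
    using ff[OF that that] cinner_self[of "f i"]
    by (metis norm_ge_zero of_real_eq_1_iff power2_eq_1_iff le_minus_one_simps(3))
  \<comment> \<open>The letter \<open>j\<close> lowers \<open>f (i + 1)\<close> to half of
    \<open>f i\<close> exactly when it stands at position \<open>i\<close> of \<open>w\<close>,
    counted from 0.\<close>
  define S where "S j = (\<Sum>i | i < n \<and> w ! i = j. V i o\<^sub>L ((1/2) *\<^sub>R id_blinfun) o\<^sub>L W (Suc i))" for j
  have S: "S \<in> polydisc"
    unfolding polydisc_def
  proof (intro CollectI allI conjI)
    fix j
    show "S j \<in> clinear_ops"
      unfolding S_def using VW by (intro clinear_sum clinear_compose clinear_scaleR clinear_id)
    have "norm ((1/2) *\<^sub>R id_blinfun :: 'h \<Rightarrow>\<^sub>L 'h) \<le> 1/2"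
      using norm_blinfun_id_le[where 'a = 'h] by simp
    then have "norm (S j) \<le> 1/2"
      unfolding S_def
      by (intro norm_block_le[where \<alpha> = "\<lambda>i. i" and \<beta> = Suc and J = "{..n}", OF adj norm_proj_le[OF E(2,1)]])
        (use WV in auto)
    then show "norm (S j) < 1" by simp
  qed
  have Sf: "blinfun_apply (S j) (f m) = (if 0 < m \<and> w ! (m - 1) = j then (1/2) *\<^sub>R f (m - 1) else 0)"
    if m: "m \<le> n" for j m
  proof -
    have "blinfun_apply (S j) (f m) =
        (\<Sum>i | i < n \<and> w ! i = j. (1/2) *\<^sub>R (if Suc i = m then f i else 0))"
      unfolding S_def using Wf m
      by (auto simp: blinfun.sum_left blinfun.scaleR_left blinfun.scaleR_right f_def[symmetric] intro!: sum.cong)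
    also have "\<dots> = (\<Sum>i | i < n \<and> w ! i = j. if i = m - 1 then (if 0 < m then (1/2) *\<^sub>R f (m - 1) else 0) else 0)"
      by (intro sum.cong refl) auto
    also have "\<dots> = (if 0 < m \<and> w ! (m - 1) = j then (1/2) *\<^sub>R f (m - 1) else 0)"
      using m by (subst sum.delta) auto
    finally show ?thesis .
  qed
  \<comment> \<open>The last letter acts first, so from \<open>f n\<close> only suffixes of
    \<open>w\<close> survive, and only \<open>w\<close> itself arrives at
    \<open>f 0\<close>.\<close>
  have word: "blinfun_apply (word_op S v) (f n) = (if length v \<le> n \<and> v = drop (n - length v) w
      then (1/2) ^ length v *\<^sub>R f (n - length v) else 0)" for v
  proof (induction v)
    case Nil
    then show ?case by (simp add: n_def)
  next
    case (Cons j v)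
    show ?case
    proof (cases "length v \<le> n \<and> v = drop (n - length v) w")
      case True
      define m where "m = n - length v"
      have "m - 1 = n - length (j # v)" by (simp add: m_def)
      have "j # v = drop (m - 1) w \<longleftrightarrow> w ! (m - 1) = j" if "0 < m"
      proof -
        have "drop (m - 1) w = w ! (m - 1) # drop m w"
          using Cons_nth_drop_Suc[of "m - 1" w] that by (simp add: m_def n_def Suc_diff_Suc)
        then show ?thesis using True by (auto simp: m_def)
      qed
      moreover have "0 < m \<longleftrightarrow> length (j # v) \<le> n" by (auto simp: m_def)
      ultimately have Q: "(length (j # v) \<le> n \<and> j # v = drop (m - 1) w) \<longleftrightarrow> 0 < m \<and> w ! (m - 1) = j"
        by blast
      have "blinfun_apply (word_op S (j # v)) (f n) = (1/2) ^ length v *\<^sub>R blinfun_apply (S j) (f m)"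
        using True by (simp add: Cons blinfun.scaleR_right m_def)
      moreover have "m \<le> n" by (simp add: m_def)
      ultimately show ?thesis
        unfolding \<open>m - 1 = n - length (j # v)\<close>[symmetric] Q by (simp add: Sf del: word_op.simps)
    next
      case False
      have "drop (n - length (j # v)) w \<noteq> j # v" if "length (j # v) \<le> n"
      proof
        assume "drop (n - length (j # v)) w = j # v"
        then have "drop 1 (drop (n - length (j # v)) w) = v" by simp
        then have "drop (n - length v) w = v" using that by (simp add: Suc_diff_Suc)
        then show False using False that by simp
      qed
      then show ?thesis using False by (auto simp: Cons)
    qed
  qed
  show ?thesis
  proof (rule that[OF S])
    \<comment> \<open>The factor \<open>2 ^ n\<close> cancels the \<open>(1/2) ^ n\<close> picked up
      along \<open>w\<close>.\<close>
    show "\<tau> u (f n) \<in> algebraic_tensors \<tau>" "of_real (2 ^ n) *\<^sub>C \<tau> v (f 0) \<in> algebraic_tensors \<tau>"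
      by (intro tau_in_algebraic[OF tau] algebraic_scale[OF tau])+
    show "norm (\<tau> u (f n)) = norm u"
      by (simp add: norm_tau[OF tau] nf)
    show "norm (of_real (2 ^ n) *\<^sub>C \<tau> v (f 0)) = 2 ^ length w * norm v"
      by (simp add: norm_scaleC norm_tau[OF tau] nf n_def norm_power)
    show "vanishes_beyond \<tau> S (length w) (\<tau> u (f n))"
      unfolding n_def[symmetric]
      by (auto simp: vanishes_beyond_def tensor_op_apply[OF tau] clinear_id polydisc_word[OF S] word
          tau_zero_right[OF tau])
    fix x :: "'d list \<Rightarrow> 'u \<Rightarrow>\<^sub>L 'u" assume x': "range x \<subseteq> clinear_ops"
    then have x: "x w \<in> clinear_ops" for w by auto
    have "cinner (blinfun_apply (word_op S z) (f n)) (f 0) = (if z = w then (1/2) ^ n else 0)"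
      if "length z \<le> n" for z
    proof (cases "length z = n")
      case True
      then show ?thesis using ff[of 0 0] n_def[symmetric] by (simp add: word cinner_scaleR_left)
    next
      case False
      then have "cinner (f (n - length z)) (f 0) = 0" using that ff[of "n - length z" 0] by simp
      moreover have "z \<noteq> w" using False by (auto simp: n_def)
      ultimately show ?thesis by (simp add: word cinner_scaleR_left)
    qed
    then have "cinner (blinfun_apply (tensor_op \<tau> (x z) (word_op S z)) (\<tau> u (f n))) (of_real (2 ^ n) *\<^sub>C \<tau> v (f 0))
        = (if z = w then cinner (blinfun_apply (x w) u) v else 0)" if "length z \<le> n" for z
      using that by (simp add: tensor_op_apply[OF tau x polydisc_word[OF S]] cinner_scaleC_right tau_cinner[OF tau]
          power_one_over)
    then show "test_functional \<tau> S (length w) (\<tau> u (f n)) (of_real (2 ^ n) *\<^sub>C \<tau> v (f 0)) x =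
        cinner (blinfun_apply (x w) u) v"
      using x' by (simp add: test_functional_def n_def finite_words_le)
  qed
qed

end
end

section \<open>Compression to a tuple that is nilpotent of type \<open>\<Lambda>\<close>\<close>

lemma word_op_append: "word_op T (v @ w) = word_op T v o\<^sub>L word_op T w"
  by (induction v) (auto intro!: blinfun_eqI)

lemma initial_segment_append:
  assumes "initial_segment \<Lambda>" "v \<notin> \<Lambda>"
  shows "v @ w \<notin> \<Lambda>"
proof (induction w rule: rev_induct)
  case (snoc j w)
  then show ?case
    using assms(1) by (metis append_assoc initial_segment_def)
qed (use assms in simp)

lemma initial_segment_Nil:
  assumes "initial_segment \<Lambda>" "\<Lambda> \<noteq> {}"
  shows "[] \<in> \<Lambda>"
  using initial_segment_append[OF assms(1), of "[]"] assms(2) by auto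

lemma clinear_maps_cspan:
  assumes A: "A \<in> clinear_ops" and gen: "\<And>x. x \<in> X \<Longrightarrow> blinfun_apply A x \<in> cspan Y" and x: "x \<in> cspan X"
  shows "blinfun_apply A x \<in> cspan Y"
  using x
proof (induction rule: cvec.span_induct_alt)
  case base
  then show ?case by (simp add: cvec.span_zero)
next
  case (step c x y)
  then show ?case
    by (simp add: blinfun.add_right clinear_opsD[OF A] cvec.span_add cvec.span_scale gen)
qed

context
  fixes \<tau> :: "'u::complex_hilbert \<Rightarrow> 'h::complex_hilbert \<Rightarrow> 'k::complex_hilbert"
  assumes tau: "hilbert_tensor \<tau>"
begin

lemma cinner_tensor_op_expansion:
  assumes "A \<in> clinear_ops" "B \<in> clinear_ops"
  shows "cinner (blinfun_apply (tensor_op \<tau> A B) (\<Sum>g\<in>G. \<tau> g (h g))) (\<Sum>g\<in>G. \<tau> g (k g)) =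
    (\<Sum>g'\<in>G. \<Sum>g\<in>G. cinner (blinfun_apply A g') g * cinner (blinfun_apply B (h g')) (k g))"
  by (simp add: blinfun.sum_right tensor_op_apply[OF tau] assms cinner_sum_left)
    (simp add: cinner_sum_right tau_cinner[OF tau])

lemma series_eval_nilpotent:
  fixes S :: "'d::finite \<Rightarrow> 'h \<Rightarrow>\<^sub>L 'h"
  assumes "range p \<subseteq> clinear_ops" and nil: "\<And>w. N < length w \<Longrightarrow> word_op S w = 0"
  shows "series_eval \<tau> p S = (\<Sum>w | length w \<le> N. tensor_op \<tau> (p w) (word_op S w))"
proof -
  have p: "p w \<in> clinear_ops" for w using assms(1) by auto
  have "homogeneous_part \<tau> p S j = 0" if "j \<notin> {..N}" for j
    unfolding homogeneous_part_def using that
    by (intro sum.neutral) (auto simp: nil tensor_op_zero_right[OF tau p])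
  then have "series_eval \<tau> p S = (\<Sum>j\<le>N. homogeneous_part \<tau> p S j)"
    unfolding series_eval_def by (intro suminf_finite) auto
  then show ?thesis
    by (simp add: homogeneous_part_def sum_words_le)
qed

text \<open>Both spans are invariant under all words, so compressing to their orthogonal difference
  respects products. A word outside \<open>\<Lambda>\<close> carries \<open>M\<close> into
  \<open>M0\<close>, which the compression kills. Finally \<open>kill\<close> makes the components
  of \<open>\<eta>\<close> orthogonal to \<open>M0\<close>, so no matrix coefficient
  changes.\<close>

lemma nilpotent_compression:
  fixes T :: "'d::finite \<Rightarrow> 'h \<Rightarrow>\<^sub>L 'h"
  assumes T: "T \<in> polydisc" and \<xi>: "\<xi> \<in> algebraic_tensors \<tau>" and \<eta>: "\<eta> \<in> algebraic_tensors \<tau>"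
    and van: "vanishes_beyond \<tau> T N \<xi>" and p: "range p \<subseteq> clinear_ops"
    and \<Lambda>: "initial_segment \<Lambda>" "[] \<in> \<Lambda>"
    and kill: "\<And>x. range x \<subseteq> clinear_ops \<Longrightarrow> (\<And>w. w \<in> \<Lambda> \<Longrightarrow> x w = 0) \<Longrightarrow> test_functional \<tau> T N \<xi> \<eta> x = 0"
  obtains S where "S \<in> polydisc" "nilpotent_tuple \<Lambda> S"
    "test_functional \<tau> T N \<xi> \<eta> p = cinner (blinfun_apply (series_eval \<tau> p S) \<xi>) \<eta>"
proof -
  obtain G h k where G: "finite G" "orthonormal G"
    and \<xi>_eq: "\<xi> = (\<Sum>g\<in>G. \<tau> g (h g))" and \<eta>_eq: "\<eta> = (\<Sum>g\<in>G. \<tau> g (k g))"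
    using algebraic_expansion[OF tau \<xi> \<eta>] by metis
  let ?T = "\<lambda>w. blinfun_apply (word_op T w)"
  have Tw: "word_op T w \<in> clinear_ops" for w by (rule polydisc_word[OF T])
  \<comment> \<open>Orthonormality of the left factors turns the vanishing of a tensor into the
    vanishing of each of its components.\<close>
  have long: "?T w (h g) = 0" if "N < length w" "g \<in> G" for w g
  proof -
    have "(\<Sum>g'\<in>G. \<tau> g' (?T w (h g'))) = 0"
      using van that by (simp add: vanishes_beyond_def \<xi>_eq blinfun.sum_right tensor_op_apply[OF tau] clinear_id Tw)
    then have "0 = cinner (\<Sum>g'\<in>G. \<tau> g' (?T w (h g'))) (\<tau> g (?T w (h g)))" by simp
    also have "\<dots> = (\<Sum>g'\<in>G. if g' = g then cinner (?T w (h g)) (?T w (h g)) else 0)"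
      unfolding cinner_sum_left tau_cinner[OF tau]
      using G that by (intro sum.cong) (auto simp: orthonormal_def)
    also have "\<dots> = cinner (?T w (h g)) (?T w (h g))"
      using G that by simp
    finally show ?thesis by (simp add: cinner_self)
  qed
  \<comment> \<open>A coefficient family supported at \<open>w\<close>, with value
    \<open>rank_one g g'\<close>, reads off a single matrix entry. Hence every \<open>k g\<close> is
    orthogonal to \<open>M0\<close>.\<close>
  have orth: "cinner (?T w (h g')) (k g) = 0" if w: "w \<notin> \<Lambda>" "length w \<le> N" and g: "g \<in> G" "g' \<in> G" for w g g'
  proof -
    define x :: "'d list \<Rightarrow> 'u \<Rightarrow>\<^sub>L 'u" where "x v = (if v = w then rank_one g g' else 0)" for v
    have x: "range x \<subseteq> clinear_ops"
      by (auto simp: x_def clinear_rank_one clinear_zero)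
    have "cinner (blinfun_apply (tensor_op \<tau> (x v) (word_op T v)) \<xi>) \<eta> =
        (if v = w then cinner (?T w (h g')) (k g) else 0)" for v
    proof (cases "v = w")
      case True
      have "cinner (blinfun_apply (tensor_op \<tau> (x v) (word_op T v)) \<xi>) \<eta> =
          (\<Sum>a\<in>G. \<Sum>b\<in>G. cinner a g' * cinner g b * cinner (?T w (h a)) (k b))"
        unfolding \<xi>_eq \<eta>_eq using True
        by (simp add: x_def cinner_tensor_op_expansion clinear_rank_one Tw cinner_scaleC_left)
      also have "\<dots> = (\<Sum>a\<in>G. \<Sum>b\<in>G. if b = g then (if a = g' then cinner (?T w (h g')) (k g) else 0) else 0)"
        using G g by (intro sum.cong refl) (auto simp: orthonormal_def)
      also have "\<dots> = cinner (?T w (h g')) (k g)"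
        using G g by simp
      finally show ?thesis using True by simp
    qed (simp add: x_def tensor_op_zero_left[OF tau Tw])
    then have "test_functional \<tau> T N \<xi> \<eta> x = cinner (?T w (h g')) (k g)"
      using x w by (simp add: test_functional_def finite_words_le)
    moreover have "test_functional \<tau> T N \<xi> \<eta> x = 0"
      by (rule kill[OF x]) (use w in \<open>auto simp: x_def\<close>)
    ultimately show ?thesis by simp
  qed
  define M where "M = (\<lambda>(w, g). ?T w (h g)) ` ({w. length w \<le> N} \<times> G)"
  define M0 where "M0 = (\<lambda>(w, g). ?T w (h g)) ` ({w. length w \<le> N \<and> w \<notin> \<Lambda>} \<times> G)"
  have fin: "finite M" "finite M0"
    unfolding M_def M0_def using G finite_words_le
    by (auto intro!: finite_imageI finite_cartesian_product intro: finite_subset[OF _ finite_words_le[of N]])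
  have M_mem: "?T w (h g) \<in> cspan M" if "g \<in> G" for w g
  proof (cases "length w \<le> N")
    case True
    then show ?thesis using that by (intro cvec.span_base) (auto simp: M_def)
  next
    case False
    then show ?thesis using long that by (simp add: cvec.span_zero)
  qed
  have M0_mem: "?T w (h g) \<in> cspan M0" if "g \<in> G" "w \<notin> \<Lambda>" for w g
  proof (cases "length w \<le> N")
    case True
    then show ?thesis using that by (intro cvec.span_base) (auto simp: M0_def)
  next
    case False
    then show ?thesis using long that by (simp add: cvec.span_zero)
  qed
  have TT: "?T v (?T w x) = ?T (v @ w) x" for v w x
    by (simp add: word_op_append)
  have T_M: "?T v x \<in> cspan M" if "x \<in> cspan M" for v x
    by (rule clinear_maps_cspan[OF Tw _ that]) (auto simp: M_def TT intro: M_mem[unfolded M_def])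
  have T_M_M0: "?T v x \<in> cspan M0" if "x \<in> cspan M" "v \<notin> \<Lambda>" for v x
    by (rule clinear_maps_cspan[OF Tw _ that(1)])
      (auto simp: M_def TT intro!: M0_mem initial_segment_append[OF \<Lambda>(1) that(2)])
  have T_long: "?T v x = 0" if "x \<in> cspan M" "N < length v" for v x
  proof -
    have "?T v x \<in> cspan {}"
      by (rule clinear_maps_cspan[OF Tw _ that(1)]) (use that(2) in \<open>auto simp: M_def TT long\<close>)
    then show ?thesis by simp
  qed
  \<comment> \<open>The complement of \<open>\<Lambda>\<close> is a two-sided ideal: closure under
    prefixing makes \<open>M0\<close> invariant, closure under appending gave
    \<open>T_M_M0\<close>.\<close>
  have prefix: "v @ w \<notin> \<Lambda>" if "w \<notin> \<Lambda>" for v w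
    using that \<Lambda>(1) by (induction v) (auto simp: initial_segment_def)
  have T_M0: "?T v x \<in> cspan M0" if "x \<in> cspan M0" for v x
    by (rule clinear_maps_cspan[OF Tw _ that]) (auto simp: M0_def TT intro!: M0_mem[unfolded M0_def] prefix)
  obtain E0 where E0: "finite E0" "orthonormal E0" "cspan E0 = cspan M0"
    using orthonormal_basis[OF fin(2)] by blast
  obtain E where E: "E0 \<subseteq> E" "finite E" "orthonormal E" "cspan E = cspan (E0 \<union> M)"
    using orthonormal_extend[OF E0(2,1) fin(1)] by blast
  have "M0 \<subseteq> M" by (auto simp: M0_def M_def)
  then have "E0 \<subseteq> cspan M"
    using E0(3) cvec.span_mono[of M0 M] cvec.span_superset[of E0] by blast
  then have "cspan (E0 \<union> M) = cspan M"
    by (intro cvec.span_eq[THEN iffD2]) (auto intro: cvec.span_base)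
  with E have spE: "cspan E = cspan M" by simp
  \<comment> \<open>\<open>E\<close> is a basis of \<open>M\<close> extending the basis
    \<open>E0\<close> of \<open>M0\<close>, so this is the projection onto the orthogonal difference
    of their spans.\<close>
  define P where "P = proj (E - E0)"
  have onE': "orthonormal (E - E0)" "finite (E - E0)"
    using E by (auto simp: orthonormal_def)
  have Pc: "P \<in> clinear_ops" unfolding P_def by (rule clinear_proj)
  have P_M: "blinfun_apply P x = x - blinfun_apply (proj E0) x" if "x \<in> cspan M" for x
  proof -
    have "proj E = P + proj E0"
      unfolding P_def proj_def using E by (simp add: sum.subset_diff add.commute)
    moreover have "blinfun_apply (proj E) x = x"
      by (rule proj_cspan[OF E(3,2)]) (simp add: spE that)
    ultimately show ?thesis by (simp add: blinfun.add_left algebra_simps)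
  qed
  have P_M0: "blinfun_apply P x = 0" if "x \<in> cspan M0" for x
  proof -
    have "x \<in> cspan M" using that cvec.span_mono[OF \<open>M0 \<subseteq> M\<close>] by blast
    then show ?thesis using proj_cspan[OF E0(2,1), of x] P_M that by (simp add: E0(3))
  qed
  have P_in: "blinfun_apply P x \<in> cspan M" for x
    using proj_in_cspan[of "E - E0" x] cvec.span_mono[of "E - E0" E] spE by (auto simp: P_def)
  have PP: "blinfun_apply P (blinfun_apply P x) = blinfun_apply P x" for x
    unfolding P_def by (rule proj_cspan[OF onE' proj_in_cspan])
  \<comment> \<open>Semi-invariance: \<open>x\<close> and \<open>P x\<close> differ by a vector of
    \<open>M0\<close>; words keep it there and \<open>P\<close> kills it. This makes the compression
    multiplicative on words.\<close>
  have PT: "blinfun_apply P (?T w (blinfun_apply P x)) = blinfun_apply P (?T w x)" if "x \<in> cspan M" for w x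
  proof -
    have "?T w (blinfun_apply (proj E0) x) \<in> cspan M0"
      by (rule T_M0) (use proj_in_cspan[of E0 x] E0(3) in simp)
    then show ?thesis
      by (simp add: P_M[OF that] blinfun.diff_right P_M0)
  qed
  define S where "S j = P o\<^sub>L T j o\<^sub>L P" for j
  have nP: "norm P \<le> 1"
    by (rule norm_blinfun_bound) (use norm_proj_le[OF onE'] in \<open>auto simp: P_def\<close>)
  have S: "S \<in> polydisc"
    unfolding polydisc_def
  proof (intro CollectI allI conjI)
    fix j
    show "S j \<in> clinear_ops"
      unfolding S_def using Pc polydisc_clinear[OF T] by (intro clinear_compose)
    have "norm (S j) \<le> norm (P o\<^sub>L T j) * norm P"
      unfolding S_def by (rule norm_blinfun_compose)
    also have "\<dots> \<le> (norm P * norm (T j)) * norm P"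
      by (intro mult_right_mono norm_blinfun_compose) auto
    also have "\<dots> \<le> (1 * norm (T j)) * 1"
      using nP by (intro mult_mono) auto
    finally show "norm (S j) < 1" using polydisc_norm[OF T, of j] by simp
  qed
  \<comment> \<open>The empty word must be excluded: it gives the identity on the left but
    \<open>P\<close> on the right.\<close>
  have word: "blinfun_apply (word_op S w) x = blinfun_apply P (?T w (blinfun_apply P x))" if "w \<noteq> []" for w x
    using that
  proof (induction w)
    case (Cons j w)
    show ?case
    proof (cases "w = []")
      case True
      then show ?thesis by (simp add: S_def)
    next
      case False
      have "?T w (blinfun_apply P x) \<in> cspan M" by (intro T_M P_in)
      then have "blinfun_apply P (?T [j] (blinfun_apply P (?T w (blinfun_apply P x)))) =
          blinfun_apply P (?T [j] (?T w (blinfun_apply P x)))"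
        by (rule PT)
      then show ?thesis using Cons False by (simp add: S_def PP)
    qed
  qed simp
  have nil: "word_op S w = 0" if "w \<notin> \<Lambda>" for w
  proof (rule blinfun_eqI)
    fix x
    have "w \<noteq> []" using that \<Lambda>(2) by auto
    then show "blinfun_apply (word_op S w) x = blinfun_apply 0 x"
      by (simp add: word P_M0 T_M_M0 P_in that)
  qed
  have nil_long: "word_op S w = 0" if "N < length w" for w
  proof (rule blinfun_eqI)
    fix x
    have "w \<noteq> []" using that by auto
    then show "blinfun_apply (word_op S w) x = blinfun_apply 0 x"
      by (simp add: word T_long P_in that)
  qed
  \<comment> \<open>For a nonempty word, passing from \<open>T\<close> to \<open>S\<close> subtracts
    a vector of \<open>M0\<close>, which \<open>k g\<close> does not see.\<close>
  have coeff: "cinner (blinfun_apply (word_op S w) (h g')) (k g) = cinner (?T w (h g')) (k g)"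
    if g: "g \<in> G" "g' \<in> G" for w g g'
  proof (cases "w = []")
    case False
    have hM: "h g' \<in> cspan M" using M_mem[of g' "[]"] g by simp
    have m: "?T w (h g') \<in> cspan M" by (rule M_mem[OF g(2)])
    have "cinner y (k g) = 0" if "y \<in> cspan M0" for y
      using that
    proof (induction rule: cvec.span_induct_alt)
      case (step c x y)
      then have "cinner x (k g) = 0" using orth g by (auto simp: M0_def)
      then show ?case using step by (simp add: cinner_add_left cinner_scaleC_left)
    qed simp
    then have "cinner (blinfun_apply (proj E0) (?T w (h g'))) (k g) = 0"
      using proj_in_cspan[of E0] E0(3) by blast
    then show ?thesis
      by (simp add: word[OF False] PT[OF hM] P_M[OF m] cinner_diff_left)
  qed simp
  have "test_functional \<tau> T N \<xi> \<eta> p = (\<Sum>w | length w \<le> N. cinner (blinfun_apply (tensor_op \<tau> (p w) (word_op S w)) \<xi>) \<eta>)"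
  proof -
    have "cinner (blinfun_apply (tensor_op \<tau> (p w) (word_op T w)) \<xi>) \<eta> =
        cinner (blinfun_apply (tensor_op \<tau> (p w) (word_op S w)) \<xi>) \<eta>" for w
    proof -
      have "p w \<in> clinear_ops" using p by auto
      then show ?thesis
        unfolding \<xi>_eq \<eta>_eq by (simp add: cinner_tensor_op_expansion Tw polydisc_word[OF S] coeff)
    qed
    then show ?thesis using p by (simp add: test_functional_def)
  qed
  also have "\<dots> = cinner (blinfun_apply (series_eval \<tau> p S) \<xi>) \<eta>"
    by (simp add: series_eval_nilpotent[OF p nil_long] blinfun.sum_left cinner_sum_left)
  finally show ?thesis
    using that S nil by (auto simp: nilpotent_tuple_def)
qed

end

section \<open>Extension of the functional\<close>

text \<open>Read \<open>Q y c\<close> as "the gauge of \<open>y\<close> is at most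
  \<open>c\<close>". The pairs with \<open>Q y c\<close> form a cone, and the domination of
  evaluation at \<open>p\<close> by \<open>\<gamma> * c\<close> becomes positivity of a functional
  on pairs, which \<open>riesz_extension\<close> preserves.\<close>

lemma dominated_complex_extension:
  fixes Q :: "('i \<Rightarrow> complex) \<Rightarrow> real \<Rightarrow> bool" and Z :: "('i \<Rightarrow> complex) set"
  assumes Q_ne: "Q y0 c0"
    and Q_add: "\<And>y y' c c'. Q y c \<Longrightarrow> Q y' c' \<Longrightarrow> Q (\<lambda>x. y x + y' x) (c + c')"
    and Q_scale: "\<And>y c z. Q y c \<Longrightarrow> Q (\<lambda>x. z * y x) (cmod z * c)"
    and Z_Q: "\<And>y. y \<in> Z \<Longrightarrow> \<exists>c. Q y c"
    and Z_zero: "(\<lambda>x. 0) \<in> Z"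
    and Z_add: "\<And>y y'. y \<in> Z \<Longrightarrow> y' \<in> Z \<Longrightarrow> (\<lambda>x. y x + y' x) \<in> Z"
    and Z_scale: "\<And>y z. y \<in> Z \<Longrightarrow> (\<lambda>x. z * y x) \<in> Z"
    and bound: "\<And>y c. y \<in> Z \<Longrightarrow> Q y c \<Longrightarrow> cmod (y p) \<le> \<gamma> * c"
  obtains \<phi> where
    "\<And>y y' c c'. Q y c \<Longrightarrow> Q y' c' \<Longrightarrow> \<phi> (\<lambda>x. y x + y' x) = \<phi> y + \<phi> y'"
    "\<And>y c z. Q y c \<Longrightarrow> \<phi> (\<lambda>x. z * y x) = z * \<phi> y"
    "\<And>y. y \<in> Z \<Longrightarrow> \<phi> y = y p"
    "\<And>y c. Q y c \<Longrightarrow> cmod (\<phi> y) \<le> \<gamma> * c"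
proof -
  define Y where "Y = {y. \<exists>c. Q y c}"
  have plus: "y + y' = (\<lambda>x. y x + y' x)" for y y' :: "'i \<Rightarrow> complex"
    by (simp add: plus_fun_def)
  have scl: "r *\<^sub>R y = (\<lambda>x. of_real r * y x)" for r and y :: "'i \<Rightarrow> complex"
    by (simp add: scaleR_fun_def scaleR_conv_of_real)
  have zro: "(0 :: 'i \<Rightarrow> complex) = (\<lambda>x. 0)"
    by (simp add: zero_fun_def)
  have Q0: "Q (\<lambda>x. 0) 0"
    using Q_scale[OF Q_ne, of 0] by simp
  have Y: "subspace Y"
    unfolding subspace_def Y_def zro plus scl using Q0 Q_add Q_scale by blast
  have Z: "subspace Z"
    unfolding subspace_def zro plus scl using Z_zero Z_add Z_scale by blast
  define K where "K = {(y, c). Q y c}"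
  define f where "f = (\<lambda>(y, c). \<gamma> * c - Re (y p))"
  obtain g where g_add: "\<And>a b. a \<in> Y \<times> UNIV \<Longrightarrow> b \<in> Y \<times> UNIV \<Longrightarrow> g (a + b) = g a + g b"
    and g_scale: "\<And>r a. a \<in> Y \<times> UNIV \<Longrightarrow> g (r *\<^sub>R a) = r * g a"
    and g_eq: "\<And>a. a \<in> Z \<times> UNIV \<Longrightarrow> g a = f a"
    and g_pos: "\<And>a. a \<in> Y \<times> UNIV \<Longrightarrow> a \<in> K \<Longrightarrow> 0 \<le> g a"
  proof (rule riesz_extension[of "Y \<times> UNIV" "Z \<times> UNIV" K f])
    show "subspace (Y \<times> (UNIV :: real set))" "subspace (Z \<times> (UNIV :: real set))"
      by (intro subspace_Times Y Z subspace_UNIV)+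
    show "Z \<times> UNIV \<subseteq> Y \<times> (UNIV :: real set)"
      using Z_Q by (auto simp: Y_def)
    show "a + b \<in> K" if "a \<in> K" "b \<in> K" for a b
      using that Q_add by (auto simp: K_def plus)
    show "r *\<^sub>R a \<in> K" if "0 \<le> r" "a \<in> K" for r a
      using that Q_scale[of _ _ "of_real r"] by (auto simp: K_def scl)
    show "\<exists>z\<in>Z \<times> UNIV. z + a \<in> K" if "a \<in> Y \<times> UNIV" for a
    proof -
      obtain y c c' where a: "a = (y, c)" "Q y c'" using \<open>a \<in> Y \<times> UNIV\<close> by (auto simp: Y_def)
      then have "(0, c' - c) + a \<in> K" by (simp add: K_def)
      moreover have "(0, c' - c) \<in> Z \<times> UNIV" using Z_zero by (simp add: zro)
      ultimately show ?thesis by blast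
    qed
    show "f (a + b) = f a + f b" for a b
      by (cases a; cases b) (simp add: f_def algebra_simps)
    show "f (r *\<^sub>R a) = r * f a" for r a
      by (cases a) (simp add: f_def scl algebra_simps)
    show "0 \<le> f a" if a: "a \<in> Z \<times> UNIV" "a \<in> K" for a
    proof -
      obtain y c where "a = (y, c)" "y \<in> Z" "Q y c" using a by (auto simp: K_def)
      then show ?thesis
        using bound[of y c] complex_Re_le_cmod[of "y p"] by (simp add: f_def)
    qed
  qed (use that in blast)
  \<comment> \<open>As \<open>g (0, c) = \<gamma> * c\<close>, positivity of
    \<open>g (y, c) = \<gamma> * c - r y\<close> is precisely the bound on \<open>r\<close>.\<close>
  define r where "r y = - g (y, 0)" for y
  have r_add: "r (\<lambda>x. y x + y' x) = r y + r y'" if "y \<in> Y" "y' \<in> Y" for y y'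
    using g_add[of "(y, 0)" "(y', 0)"] that by (simp add: r_def plus)
  have r_scale: "r (\<lambda>x. of_real s * y x) = s * r y" if "y \<in> Y" for y s
    using g_scale[of "(y, 0)" s] that by (simp add: r_def scl)
  have r_le: "r y \<le> \<gamma> * c" if "Q y c" for y c
  proof -
    have y: "y \<in> Y" "0 \<in> Y" using that Q0 by (auto simp: Y_def zro)
    have "g (y, c) = g (y, 0) + g (0, c)"
      using g_add[of "(y, 0)" "(0, c)"] y by simp
    moreover have "g (0, c) = \<gamma> * c"
      using g_eq[of "(0, c)"] Z_zero by (simp add: f_def zro)
    moreover have "0 \<le> g (y, c)"
      by (rule g_pos) (use that y in \<open>auto simp: K_def\<close>)
    ultimately show ?thesis by (simp add: r_def)
  qed
  have r_Z: "r y = Re (y p)" if "y \<in> Z" for y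
    using g_eq[of "(y, 0)"] that by (simp add: r_def f_def)
  have Yscale: "(\<lambda>x. z * y x) \<in> Y" if "y \<in> Y" for y z
    using that Q_scale unfolding Y_def by blast
  \<comment> \<open>The usual complex-linear functional with real part \<open>r\<close>. Its modulus
    is bounded by rotating \<open>y\<close>, since by \<open>Q_scale\<close> a unimodular factor
    does not change the gauge.\<close>
  define \<phi> where "\<phi> y = Complex (r y) (- r (\<lambda>x. \<i> * y x))" for y
  have \<phi>_add: "\<phi> (\<lambda>x. y x + y' x) = \<phi> y + \<phi> y'" if "y \<in> Y" "y' \<in> Y" for y y'
    using r_add[OF that] r_add[OF Yscale[OF that(1), of \<i>] Yscale[OF that(2), of \<i>]]
    by (simp add: \<phi>_def complex_eq_iff algebra_simps)
  have \<phi>_scale: "\<phi> (\<lambda>x. z * y x) = z * \<phi> y" if y: "y \<in> Y" for y z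
  proof -
    have split: "r (\<lambda>x. z * y x) = Re z * r y + Im z * r (\<lambda>x. \<i> * y x)" if "y \<in> Y" for y z
    proof -
      have "(\<lambda>x. z * y x) = (\<lambda>x. of_real (Re z) * y x + of_real (Im z) * (\<i> * y x))"
        by (rule ext) (metis (no_types, lifting) complex_eq distrib_right mult.assoc mult.commute)
      then show ?thesis
        using r_add[of "\<lambda>x. of_real (Re z) * y x" "\<lambda>x. of_real (Im z) * (\<i> * y x)"]
          r_scale[OF that] r_scale[OF Yscale[OF that]] Yscale[OF that] Yscale[OF Yscale[OF that]]
        by metis
    qed
    have "r (\<lambda>x. \<i> * (z * y x)) = Re (\<i> * z) * r y + Im (\<i> * z) * r (\<lambda>x. \<i> * y x)"
      using split[OF y, of "\<i> * z"] by (simp add: mult.assoc)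
    then show ?thesis
      using split[OF y, of z] by (simp add: \<phi>_def complex_eq_iff algebra_simps)
  qed
  show ?thesis
  proof (rule that[of \<phi>])
    fix y y' c c' assume "Q y c" "Q y' c'"
    then show "\<phi> (\<lambda>x. y x + y' x) = \<phi> y + \<phi> y'" using \<phi>_add by (auto simp: Y_def)
  next
    fix y c z assume "Q y c"
    then show "\<phi> (\<lambda>x. z * y x) = z * \<phi> y" using \<phi>_scale by (auto simp: Y_def)
  next
    fix y assume "y \<in> Z"
    then show "\<phi> y = y p"
      using r_Z Z_scale[of y \<i>] by (simp add: \<phi>_def complex_eq_iff)
  next
    fix y c assume Q: "Q y c"
    obtain z where z: "cmod z = 1" "z * \<phi> y = of_real (cmod (\<phi> y))" using ex_rotation by blast
    have "Q (\<lambda>x. z * y x) c" using Q_scale[OF Q, of z] z by simp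
    then have "r (\<lambda>x. z * y x) \<le> \<gamma> * c" by (rule r_le)
    moreover have "y \<in> Y" using Q by (auto simp: Y_def)
    then have "Re (\<phi> (\<lambda>x. z * y x)) = cmod (\<phi> y)"
      by (simp add: \<phi>_scale z)
    ultimately show "cmod (\<phi> y) \<le> \<gamma> * c" by (simp add: \<phi>_def)
  qed
qed

text \<open>For fixed \<open>u\<close>, Riesz representation is applied to the real part of
  \<open>B u\<close>; the imaginary part is recovered by replacing \<open>v\<close> by
  \<open>\<i> *\<^sub>C v\<close>.\<close>

lemma sesquilinear_operator:
  fixes B :: "'a::complex_hilbert \<Rightarrow> 'a \<Rightarrow> complex"
  assumes add_left: "\<And>u u' v. B (u + u') v = B u v + B u' v"
    and add_right: "\<And>u v v'. B u (v + v') = B u v + B u v'"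
    and scale_left: "\<And>c u v. B (c *\<^sub>C u) v = c * B u v"
    and scale_right: "\<And>c u v. B u (c *\<^sub>C v) = cnj c * B u v"
    and bound: "\<And>u v. cmod (B u v) \<le> C * (norm u * norm v)"
  obtains A where "A \<in> clinear_ops" "\<And>u v. cinner (blinfun_apply A u) v = B u v"
proof -
  have "\<exists>z. \<forall>v. Re (B u v) = inner z v" for u
  proof -
    have "bounded_linear (\<lambda>v. Re (B u v))"
    proof (rule bounded_linear_intro)
      show "Re (B u (r *\<^sub>R v)) = r *\<^sub>R Re (B u v)" for r v
        using scale_right[of u "of_real r" v] by (simp add: scaleC_of_real)
      show "norm (Re (B u v)) \<le> norm v * (C * norm u)" for v
        using abs_Re_le_cmod[of "B u v"] bound[of u v] by (simp add: mult_ac)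
    qed (simp add: add_right)
    then show ?thesis using riesz_representation by metis
  qed
  then obtain X where X: "\<And>u v. Re (B u v) = inner (X u) v" by metis
  have XB: "cinner (X u) v = B u v" for u v
  proof (rule complex_eqI)
    show "Re (cinner (X u) v) = Re (B u v)" by (simp add: X Re_cinner)
    have "Im (cinner (X u) v) = Re (cinner (X u) (\<i> *\<^sub>C v))" by (simp add: cinner_scaleC_right)
    also have "\<dots> = Re (B u (\<i> *\<^sub>C v))" by (simp add: X Re_cinner)
    also have "\<dots> = Im (B u v)" by (simp add: scale_right)
    finally show "Im (cinner (X u) v) = Im (B u v)" .
  qed
  have X_add: "X (u + u') = X u + X u'" for u u'
    by (rule cinner_left_eqI) (simp add: XB add_left cinner_add_left)
  have X_scale: "X (c *\<^sub>C u) = c *\<^sub>C X u" for c u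
    by (rule cinner_left_eqI) (simp add: XB scale_left cinner_scaleC_left)
  have X_bound: "norm (X u) \<le> norm u * C" for u
  proof (cases "X u = 0")
    case True
    \<comment> \<open>\<open>C\<close> is not assumed nonnegative; the bound at \<open>v = u\<close>
      supplies the sign.\<close>
    have "0 \<le> cmod (B u u)" by simp
    also have "\<dots> \<le> C * (norm u * norm u)" by (rule bound)
    finally have "0 \<le> (norm u * C) * norm u" by (simp add: mult_ac)
    then have "0 \<le> norm u * C"
      by (cases "u = 0") (auto simp: zero_le_mult_iff)
    then show ?thesis using True by simp
  next
    case False
    have "(norm (X u))\<^sup>2 = cmod (B u (X u))"
      by (metis XB abs_norm_cancel cinner_self norm_of_real norm_power real_norm_def)
    also have "\<dots> \<le> C * (norm u * norm (X u))" by (rule bound)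
    finally show ?thesis using False by (simp add: power2_eq_square mult_ac)
  qed
  have "bounded_linear X"
    by (rule bounded_linear_intro[of _ C])
      (auto simp: X_add X_bound X_scale simp flip: scaleC_of_real)
  then have "blinfun_apply (Blinfun X) = X" by (rule bounded_linear_Blinfun_apply)
  then show ?thesis
    using that[of "Blinfun X"] X_scale XB by (simp add: clinear_ops_def)
qed

text \<open>
  Scaling the two vectors by \<open>s\<close> and \<open>1 / s\<close> turns a bound by the arithmetic mean of the squared
  norms into one by their product.
\<close>

lemma le_product_of_le_scaled_mean:
  fixes a b t \<gamma> :: real
  assumes "0 \<le> a" "0 \<le> b" "0 \<le> \<gamma>"
    and le: "\<And>s. 0 < s \<Longrightarrow> t \<le> \<gamma> * (((s * a)\<^sup>2 + (b / s)\<^sup>2) / 2)"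
  shows "t \<le> \<gamma> * (a * b)"
proof -
  have "t \<le> \<gamma> * ((a + e) * (b + e))" if e: "0 < e" for e
  proof -
    \<comment> \<open>This \<open>s\<close> balances the two squares; \<open>e\<close> keeps it
      defined and positive when \<open>a\<close> or \<open>b\<close> is 0, and is sent to 0 at the
      end.\<close>
    define s where "s = sqrt ((b + e) / (a + e))"
    have pos: "0 < a + e" "0 < b + e" using assms e by auto
    then have s: "0 < s" "s\<^sup>2 = (b + e) / (a + e)"
      by (auto simp: s_def)
    have "(s * a)\<^sup>2 \<le> (s * (a + e))\<^sup>2" "(b / s)\<^sup>2 \<le> ((b + e) / s)\<^sup>2"
      using assms e s by (intro power_mono mult_left_mono divide_right_mono; simp)+
    moreover have "(s * (a + e))\<^sup>2 = (a + e) * (b + e)" "((b + e) / s)\<^sup>2 = (a + e) * (b + e)"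
      using pos by (simp_all add: power_mult_distrib power_divide s(2)) (simp_all add: power2_eq_square)
    ultimately have "((s * a)\<^sup>2 + (b / s)\<^sup>2) / 2 \<le> (a + e) * (b + e)" by simp
    then have "\<gamma> * (((s * a)\<^sup>2 + (b / s)\<^sup>2) / 2) \<le> \<gamma> * ((a + e) * (b + e))"
      using assms(3) by (rule mult_left_mono)
    then show ?thesis using le[OF s(1)] by linarith
  qed
  moreover have "((\<lambda>e. \<gamma> * ((a + e) * (b + e))) \<longlongrightarrow> \<gamma> * ((a + 0) * (b + 0))) (at_right 0)"
    by (intro tendsto_intros)
  ultimately show ?thesis
    by (intro tendsto_lowerbound[of _ "\<gamma> * (a * b)" "at_right 0"])
      (auto simp: eventually_at_right_less eventually_at_filter)
qed

text \<open>The weight of \<open>c j\<close> falls short of 1 by \<open>j / (N + 1)\<close>, so the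
  mean differs from the partial sum by \<open>1 / (N + 1)\<close> times a convergent sum.\<close>

lemma fejer_means_tendsto:
  fixes c :: "nat \<Rightarrow> complex"
  assumes c: "summable c" and jc: "summable (\<lambda>j. of_nat j * c j)"
  shows "(\<lambda>N. \<Sum>j\<le>N. of_real (real (Suc N - j) / real (Suc N)) * c j) \<longlonglongrightarrow> suminf c"
proof -
  have "(\<Sum>j\<le>N. of_real (real (Suc N - j) / real (Suc N)) * c j) =
      (\<Sum>j\<le>N. c j) - of_real (inverse (real (Suc N))) * (\<Sum>j\<le>N. of_nat j * c j)" for N
  proof -
    have "of_real (real (Suc N - j) / real (Suc N)) * c j = c j - of_real (inverse (real (Suc N))) * (of_nat j * c j)"
      if "j \<le> N" for j
    proof -
      have "real (Suc N - j) / real (Suc N) = 1 - inverse (real (Suc N)) * real j"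
        using that by (simp add: of_nat_diff field_simps)
      then show ?thesis
        by (simp only: of_real_diff of_real_1 of_real_mult of_real_of_nat_eq left_diff_distrib mult_1_left mult.assoc)
    qed
    then show ?thesis by (simp add: sum_subtractf sum_distrib_left)
  qed
  moreover have "(\<lambda>N. (\<Sum>j\<le>N. c j) - of_real (inverse (real (Suc N))) * (\<Sum>j\<le>N. of_nat j * c j))
      \<longlonglongrightarrow> suminf c - of_real 0 * suminf (\<lambda>j. of_nat j * c j)"
    by (intro tendsto_intros LIMSEQ_inverse_real_of_nat summable_LIMSEQ' c jc)
  ultimately show ?thesis by simp
qed

text \<open>The gauge \<open>Q\<close> to which \<open>dominated_complex_extension\<close> is
  applied. Only an inequality is asked of \<open>c\<close>, which absorbs the losses in the norm
  estimates for direct sums.\<close>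

definition admissible ::
    "('u::complex_hilbert \<Rightarrow> 'h::complex_hilbert \<Rightarrow> 'k::complex_hilbert) \<Rightarrow>
     (('d::finite list \<Rightarrow> 'u \<Rightarrow>\<^sub>L 'u) \<Rightarrow> complex) \<Rightarrow> real \<Rightarrow> bool" where
  "admissible \<tau> y c \<longleftrightarrow> (\<exists>T N \<xi> \<eta>. T \<in> polydisc \<and> \<xi> \<in> algebraic_tensors \<tau> \<and> \<eta> \<in> algebraic_tensors \<tau> \<and>
     vanishes_beyond \<tau> T N \<xi> \<and> y = test_functional \<tau> T N \<xi> \<eta> \<and> ((norm \<xi>)\<^sup>2 + (norm \<eta>)\<^sup>2) / 2 \<le> c)"

text \<open>The value 0 off the families of complex-linear operators matches
  \<open>test_functional\<close>, so that an entry is equal to a test functional as a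
  function.\<close>

definition entry :: "'d list \<Rightarrow> 'u::complex_hilbert \<Rightarrow> 'u \<Rightarrow> ('d list \<Rightarrow> 'u \<Rightarrow>\<^sub>L 'u) \<Rightarrow> complex" where
  "entry w u v x = (if range x \<subseteq> clinear_ops then cinner (blinfun_apply (x w) u) v else 0)"

section \<open>The cone of admissible functionals and the extension\<close>

context
  fixes \<tau> :: "'u::complex_hilbert \<Rightarrow> 'h::complex_hilbert \<Rightarrow> 'k::complex_hilbert"
  assumes tau: "hilbert_tensor \<tau>" and inf: "infinite_dimensional TYPE('h)"
begin

text \<open>A direct sum of two tuples, after passing to a common cutoff; weights add.\<close>

lemma admissible_add:
  assumes "admissible \<tau> y c" "admissible \<tau> y' c'"
  shows "admissible \<tau> (\<lambda>x. y x + y' x) (c + c')"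
proof -
  obtain T N \<xi> \<eta> where 1: "T \<in> polydisc" "\<xi> \<in> algebraic_tensors \<tau>" "\<eta> \<in> algebraic_tensors \<tau>"
    "vanishes_beyond \<tau> T N \<xi>" "y = test_functional \<tau> T N \<xi> \<eta>" "((norm \<xi>)\<^sup>2 + (norm \<eta>)\<^sup>2) / 2 \<le> c"
    using assms(1) unfolding admissible_def by blast
  obtain T' N' \<xi>' \<eta>' where 2: "T' \<in> polydisc" "\<xi>' \<in> algebraic_tensors \<tau>" "\<eta>' \<in> algebraic_tensors \<tau>"
    "vanishes_beyond \<tau> T' N' \<xi>'" "y' = test_functional \<tau> T' N' \<xi>' \<eta>'" "((norm \<xi>')\<^sup>2 + (norm \<eta>')\<^sup>2) / 2 \<le> c'"
    using assms(2) unfolding admissible_def by blast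
  define K where "K = max N N'"
  define S where "S i = (if i = 0 then T else T')" for i :: nat
  define \<zeta> where "\<zeta> i = (if i = 0 then \<xi> else \<xi>')" for i :: nat
  define \<theta> where "\<theta> i = (if i = 0 then \<eta> else \<eta>')" for i :: nat
  have K: "N \<le> K" "N' \<le> K" by (auto simp: K_def)
  have van: "vanishes_beyond \<tau> T K \<xi>" "vanishes_beyond \<tau> T' K \<xi>'"
    using 1(4) 2(4) K vanishes_beyond_mono[OF tau] by blast+
  obtain R \<xi>'' \<eta>'' where R: "R \<in> polydisc" "\<xi>'' \<in> algebraic_tensors \<tau>" "\<eta>'' \<in> algebraic_tensors \<tau>"
    "vanishes_beyond \<tau> R K \<xi>''"
    "\<And>x. test_functional \<tau> R K \<xi>'' \<eta>'' x = (\<Sum>i\<le>1. test_functional \<tau> (S i) K (\<zeta> i) (\<theta> i) x)"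
    "(norm \<xi>'')\<^sup>2 \<le> (\<Sum>i\<le>1. (norm (\<zeta> i))\<^sup>2)" "(norm \<eta>'')\<^sup>2 \<le> (\<Sum>i\<le>1. (norm (\<theta> i))\<^sup>2)"
    by (rule direct_sum_functional[OF tau inf, of S \<zeta> \<theta> K 1])
      (use 1 2 van in \<open>auto simp: S_def \<zeta>_def \<theta>_def\<close>)
  have "test_functional \<tau> R K \<xi>'' \<eta>'' = (\<lambda>x. y x + y' x)"
    unfolding 1(5) 2(5) test_functional_mono[OF tau 1(1,4) K(1), symmetric]
      test_functional_mono[OF tau 2(1,4) K(2), symmetric]
    by (rule ext) (simp add: R(5) S_def \<zeta>_def \<theta>_def)
  moreover have "((norm \<xi>'')\<^sup>2 + (norm \<eta>'')\<^sup>2) / 2 \<le> c + c'"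
    using R(6,7) 1(6) 2(6) by (simp add: \<zeta>_def \<theta>_def)
  ultimately show ?thesis
    unfolding admissible_def using R(1-4) by metis
qed

lemma admissible_scale:
  assumes "admissible \<tau> y c"
  shows "admissible \<tau> (\<lambda>x. z * y x) (cmod z * c)"
proof -
  obtain T N \<xi> \<eta> where 1: "T \<in> polydisc" "\<xi> \<in> algebraic_tensors \<tau>" "\<eta> \<in> algebraic_tensors \<tau>"
    "vanishes_beyond \<tau> T N \<xi>" "y = test_functional \<tau> T N \<xi> \<eta>" "((norm \<xi>)\<^sup>2 + (norm \<eta>)\<^sup>2) / 2 \<le> c"
    using assms(1) unfolding admissible_def by blast
  \<comment> \<open>The scalar \<open>z\<close> is split into two factors of equal modulus, so that
    both squared norms scale by \<open>cmod z\<close>. For \<open>z = 0\<close>, division by zero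
    yields \<open>a = 0\<close>, as wanted.\<close>
  define b where "b = sqrt (cmod z)"
  define a where "a = z / of_real b"
  have b: "b\<^sup>2 = cmod z" by (simp add: b_def)
  have ab: "a * cnj (of_real b) = z"
    by (cases "z = 0") (auto simp: a_def b_def)
  have a: "(cmod a)\<^sup>2 = cmod z"
  proof (cases "z = 0")
    case False
    then have "(cmod a)\<^sup>2 = (cmod z)\<^sup>2 / cmod z"
      by (simp add: a_def norm_divide power_divide b)
    then show ?thesis using False by (simp add: power2_eq_square)
  qed (simp add: a_def)
  have "vanishes_beyond \<tau> T N (a *\<^sub>C \<xi>)"
    using 1(4) polydisc_word[OF 1(1)]
    by (simp add: vanishes_beyond_def clinear_opsD[OF tensor_op_clinear[OF tau clinear_id]])
  moreover have "(\<lambda>x. z * y x) = test_functional \<tau> T N (a *\<^sub>C \<xi>) (of_real b *\<^sub>C \<eta>)"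
    unfolding 1(5) by (rule ext) (simp only: test_functional_scale[OF tau 1(1)] ab)
  moreover have "((norm (a *\<^sub>C \<xi>))\<^sup>2 + (norm (of_real b *\<^sub>C \<eta>))\<^sup>2) / 2 \<le> cmod z * c"
  proof -
    have "((norm (a *\<^sub>C \<xi>))\<^sup>2 + (norm (of_real b *\<^sub>C \<eta>))\<^sup>2) / 2 = cmod z * (((norm \<xi>)\<^sup>2 + (norm \<eta>)\<^sup>2) / 2)"
      by (simp add: norm_scaleC power_mult_distrib a b algebra_simps add_divide_distrib)
    also have "\<dots> \<le> cmod z * c"
      by (rule mult_left_mono[OF 1(6)]) simp
    finally show ?thesis .
  qed
  ultimately show ?thesis
    unfolding admissible_def using 1(1-3) algebraic_scale[OF tau] by metis
qed

text \<open>Puts the matrix entries of the coefficients into the domain of the extended functional.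
  The factor growing with the word is harmless: it serves only to see that each coefficient is
  bounded.\<close>

lemma admissible_entry:
  "admissible \<tau> (entry w u v) (((norm u)\<^sup>2 + (2 ^ length w * norm v)\<^sup>2) / 2)"
proof -
  obtain S \<xi> \<eta> where S: "S \<in> polydisc" "\<xi> \<in> algebraic_tensors \<tau>" "\<eta> \<in> algebraic_tensors \<tau>"
    "vanishes_beyond \<tau> S (length w) \<xi>"
    "\<And>x. range x \<subseteq> clinear_ops \<Longrightarrow> test_functional \<tau> S (length w) \<xi> \<eta> x = cinner (blinfun_apply (x w) u) v"
    "norm \<xi> = norm u" "norm \<eta> = 2 ^ length w * norm v"
    using unit_functional[OF tau inf, of w u v] by blast
  have "entry w u v = test_functional \<tau> S (length w) \<xi> \<eta>"
    by (rule ext) (simp add: entry_def S(5), simp add: test_functional_def)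
  then show ?thesis
    unfolding admissible_def using S by (metis order_refl)
qed

text \<open>The coefficients of \<open>x\<close> are the operators whose entries are the values of
  the extension \<open>\<phi>\<close> at \<open>entry w u v\<close>. A test functional is a finite
  combination of entries, so evaluating it at \<open>x\<close> is applying \<open>\<phi>\<close>,
  and the bound on \<open>\<phi>\<close> passes to \<open>x\<close>.\<close>

lemma nilpotent_extension:
  fixes p :: "'d::finite list \<Rightarrow> 'u \<Rightarrow>\<^sub>L 'u"
  assumes p: "range p \<subseteq> clinear_ops" and \<Lambda>: "initial_segment \<Lambda>" "\<Lambda> \<noteq> {}" and \<gamma>: "0 \<le> \<gamma>"
    and bound: "\<And>S :: 'd \<Rightarrow> 'h \<Rightarrow>\<^sub>L 'h. S \<in> polydisc \<Longrightarrow> nilpotent_tuple \<Lambda> S \<Longrightarrow> norm (series_eval \<tau> p S) \<le> \<gamma>"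
  obtains x where "range x \<subseteq> clinear_ops" "\<And>w. w \<in> \<Lambda> \<Longrightarrow> x w = p w"
    "\<And>(T :: 'd \<Rightarrow> 'h \<Rightarrow>\<^sub>L 'h) N \<xi> \<eta>. T \<in> polydisc \<Longrightarrow> \<xi> \<in> algebraic_tensors \<tau> \<Longrightarrow> \<eta> \<in> algebraic_tensors \<tau> \<Longrightarrow>
      vanishes_beyond \<tau> T N \<xi> \<Longrightarrow>
      cmod (test_functional \<tau> T N \<xi> \<eta> x) \<le> \<gamma> * (((norm \<xi>)\<^sup>2 + (norm \<eta>)\<^sup>2) / 2)"
proof -
  \<comment> \<open>Test functionals are linear in the coefficients, so vanishing on the families
    that are 0 over \<open>\<Lambda>\<close> means depending on the coefficients over
    \<open>\<Lambda>\<close> alone.\<close>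
  define Z where "Z = {y. (\<exists>c. admissible \<tau> y c) \<and>
    (\<forall>x. range x \<subseteq> clinear_ops \<longrightarrow> (\<forall>w\<in>\<Lambda>. x w = 0) \<longrightarrow> y (x :: 'd list \<Rightarrow> 'u \<Rightarrow>\<^sub>L 'u) = 0)}"
  have Z_bound: "cmod (y p) \<le> \<gamma> * c" if y_Z: "y \<in> Z" and y_adm: "admissible \<tau> y c" for y c
  proof -
    obtain T N \<xi> \<eta> where 1: "T \<in> polydisc" "\<xi> \<in> algebraic_tensors \<tau>" "\<eta> \<in> algebraic_tensors \<tau>"
      "vanishes_beyond \<tau> T N \<xi>" "y = test_functional \<tau> T N \<xi> \<eta>" "((norm \<xi>)\<^sup>2 + (norm \<eta>)\<^sup>2) / 2 \<le> c"
      using y_adm unfolding admissible_def by blast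
    obtain S where S: "S \<in> polydisc" "nilpotent_tuple \<Lambda> S"
      "test_functional \<tau> T N \<xi> \<eta> p = cinner (blinfun_apply (series_eval \<tau> p S) \<xi>) \<eta>"
      by (rule nilpotent_compression[OF tau 1(1-4) p \<Lambda>(1) initial_segment_Nil[OF \<Lambda>]])
        (use y_Z in \<open>auto simp: Z_def 1(5)\<close>)
    have "cmod (y p) \<le> norm (blinfun_apply (series_eval \<tau> p S) \<xi>) * norm \<eta>"
      unfolding 1(5) S(3) by (rule cmod_cinner_le)
    also have "\<dots> \<le> (\<gamma> * norm \<xi>) * norm \<eta>"
      by (intro mult_right_mono order_trans[OF norm_blinfun] bound S) auto
    also have "\<dots> = \<gamma> * (norm \<xi> * norm \<eta>)" by simp
    also have "\<dots> \<le> \<gamma> * (((norm \<xi>)\<^sup>2 + (norm \<eta>)\<^sup>2) / 2)"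
      using sum_squares_bound[of "norm \<xi>" "norm \<eta>"] \<gamma> by (intro mult_left_mono) auto
    also have "\<dots> \<le> \<gamma> * c" by (rule mult_left_mono[OF 1(6) \<gamma>])
    finally show ?thesis .
  qed
  have Z_zero: "(\<lambda>x. 0) \<in> Z"
    using admissible_scale[OF admissible_entry, of 0] by (auto simp: Z_def)
  have Z_add: "(\<lambda>x. y x + y' x) \<in> Z" if y: "y \<in> Z" and y': "y' \<in> Z" for y y'
  proof -
    obtain c c' where "admissible \<tau> y c" "admissible \<tau> y' c'"
      using y y' by (auto simp: Z_def)
    from admissible_add[OF this] show ?thesis using y y' by (auto simp: Z_def)
  qed
  have Z_scale: "(\<lambda>x. z * y x) \<in> Z" if y: "y \<in> Z" for y z
  proof -
    obtain c where "admissible \<tau> y c"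
      using y by (auto simp: Z_def)
    from admissible_scale[OF this, of z] show ?thesis using y by (auto simp: Z_def)
  qed
  have Z_adm: "\<exists>c. admissible \<tau> y c" if y: "y \<in> Z" for y
    using y by (simp add: Z_def)
  define good where "good \<phi> \<longleftrightarrow>
      (\<forall>y y' c c'. admissible \<tau> y c \<longrightarrow> admissible \<tau> y' c' \<longrightarrow> \<phi> (\<lambda>x. y x + y' x) = \<phi> y + \<phi> y') \<and>
      (\<forall>y c z. admissible \<tau> y c \<longrightarrow> \<phi> (\<lambda>x. z * y x) = z * \<phi> y) \<and>
      (\<forall>y\<in>Z. \<phi> y = y p) \<and> (\<forall>y c. admissible \<tau> y c \<longrightarrow> cmod (\<phi> y) \<le> \<gamma> * c)"
    for \<phi> :: "(('d list \<Rightarrow> 'u \<Rightarrow>\<^sub>L 'u) \<Rightarrow> complex) \<Rightarrow> complex"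
  have "\<exists>\<phi>. good \<phi>"
  proof (rule dominated_complex_extension[where Q = "admissible \<tau>" and Z = Z and p = p and \<gamma> = \<gamma>,
        OF admissible_entry])
    show "admissible \<tau> (\<lambda>x. y x + y' x) (c + c')" if "admissible \<tau> y c" "admissible \<tau> y' c'"
      for y y' :: "('d list \<Rightarrow> 'u \<Rightarrow>\<^sub>L 'u) \<Rightarrow> complex" and c c'
      using that by (rule admissible_add)
    show "admissible \<tau> (\<lambda>x. z * y x) (cmod z * c)" if "admissible \<tau> y c"
      for y :: "('d list \<Rightarrow> 'u \<Rightarrow>\<^sub>L 'u) \<Rightarrow> complex" and c z
      using that by (rule admissible_scale)
    show "\<exists>c. admissible \<tau> y c" if "y \<in> Z" for y by (rule Z_adm[OF that])
    show "(\<lambda>x. 0) \<in> Z" by (rule Z_zero)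
    show "(\<lambda>x. y x + y' x) \<in> Z" if "y \<in> Z" "y' \<in> Z" for y y' by (rule Z_add[OF that])
    show "(\<lambda>x. z * y x) \<in> Z" if "y \<in> Z" for y z by (rule Z_scale[OF that])
    show "cmod (y p) \<le> \<gamma> * c" if "y \<in> Z" "admissible \<tau> y c" for y c by (rule Z_bound[OF that])
  next
    fix \<phi> :: "(('d list \<Rightarrow> 'u \<Rightarrow>\<^sub>L 'u) \<Rightarrow> complex) \<Rightarrow> complex"
    assume "\<And>y y' c c'. admissible \<tau> y c \<Longrightarrow> admissible \<tau> y' c' \<Longrightarrow> \<phi> (\<lambda>x. y x + y' x) = \<phi> y + \<phi> y'"
      "\<And>y c z. admissible \<tau> y c \<Longrightarrow> \<phi> (\<lambda>x. z * y x) = z * \<phi> y"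
      "\<And>y. y \<in> Z \<Longrightarrow> \<phi> y = y p" "\<And>y c. admissible \<tau> y c \<Longrightarrow> cmod (\<phi> y) \<le> \<gamma> * c"
    then show "\<exists>\<phi>. good \<phi>"
      unfolding good_def by (intro exI[of _ \<phi>] conjI allI impI ballI)
  qed
  then obtain \<phi> where "good \<phi>" ..
  then have \<phi>_add: "\<And>y y' c c'. admissible \<tau> y c \<Longrightarrow> admissible \<tau> y' c' \<Longrightarrow> \<phi> (\<lambda>x. y x + y' x) = \<phi> y + \<phi> y'"
    and \<phi>_scale: "\<And>y c z. admissible \<tau> y c \<Longrightarrow> \<phi> (\<lambda>x. z * y x) = z * \<phi> y"
    and \<phi>_Z: "\<And>y. y \<in> Z \<Longrightarrow> \<phi> y = y p"
    and \<phi>_bound: "\<And>y c. admissible \<tau> y c \<Longrightarrow> cmod (\<phi> y) \<le> \<gamma> * c"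
    unfolding good_def by meson+
  \<comment> \<open>Admissibility is proved along with linearity, because additivity of
    \<open>\<phi>\<close> is known only for admissible functionals.\<close>
  have \<phi>_sum: "(\<exists>c. admissible \<tau> (\<lambda>x. \<Sum>i\<in>I. a i * y i x) c) \<and> \<phi> (\<lambda>x. \<Sum>i\<in>I. a i * y i x) = (\<Sum>i\<in>I. a i * \<phi> (y i))"
    if y: "\<And>i. i \<in> I \<Longrightarrow> \<exists>c. admissible \<tau> (y i) c" for I :: "'i set" and a y
    using y
  proof (induction I rule: infinite_finite_induct)
    case (insert i I)
    obtain c where c: "admissible \<tau> (y i) c" using insert by blast
    obtain c' where c': "admissible \<tau> (\<lambda>x. \<Sum>i\<in>I. a i * y i x) c'" using insert by blast
    show ?case
      using admissible_add[OF admissible_scale[OF c, of "a i"] c']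
        \<phi>_add[OF admissible_scale[OF c, of "a i"] c'] \<phi>_scale[OF c, of "a i"] insert
      by auto
  qed (use Z_zero \<phi>_Z Z_adm in auto)
  have entry_lin: "entry w (u + u') v = (\<lambda>x. entry w u v x + entry w u' v x)"
    "entry w u (v + v') = (\<lambda>x. entry w u v x + entry w u v' x)"
    "entry w (c *\<^sub>C u) v = (\<lambda>x. c * entry w u v x)"
    "entry w u (c *\<^sub>C v) = (\<lambda>x. cnj c * entry w u v x)" for w :: "'d list" and u u' v v' c
  proof -
    have sc: "blinfun_apply (x w) (c *\<^sub>C u) = c *\<^sub>C blinfun_apply (x w) u" if x: "range x \<subseteq> clinear_ops" for x
      by (rule clinear_opsD) (use x in auto)
    show "entry w (u + u') v = (\<lambda>x. entry w u v x + entry w u' v x)"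
      "entry w u (v + v') = (\<lambda>x. entry w u v x + entry w u v' x)"
      "entry w (c *\<^sub>C u) v = (\<lambda>x. c * entry w u v x)"
      "entry w u (c *\<^sub>C v) = (\<lambda>x. cnj c * entry w u v x)"
      by (auto simp: entry_def fun_eq_iff blinfun.add_right cinner_add_left cinner_add_right
          cinner_scaleC_left cinner_scaleC_right sc)
  qed
  have "\<exists>A. A \<in> clinear_ops \<and> (\<forall>u v. cinner (blinfun_apply A u) v = \<phi> (entry w u v))" for w
  proof -
    have entry_bound: "cmod (\<phi> (entry w u v)) \<le> \<gamma> * 2 ^ length w * (norm u * norm v)" for u v
    proof -
      \<comment> \<open>Scaling \<open>u\<close> by \<open>s\<close> and \<open>v\<close> by
        \<open>1 / s\<close> leaves the entry unchanged but not its weight.\<close>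
      have "cmod (\<phi> (entry w u v)) \<le> \<gamma> * (((s * norm u)\<^sup>2 + (2 ^ length w * norm v / s)\<^sup>2) / 2)"
        if s: "0 < s" for s
      proof -
        have "entry w (of_real s *\<^sub>C u) (of_real (inverse s) *\<^sub>C v) = entry w u v"
          unfolding entry_lin using s by (simp add: field_simps)
        moreover have "norm (of_real s *\<^sub>C u) = s * norm u" "norm (of_real (inverse s) *\<^sub>C v) = norm v / s"
          using s by (simp_all add: scaleC_of_real divide_inverse mult.commute del: of_real_inverse)
        ultimately show ?thesis
          using \<phi>_bound[OF admissible_entry, of w "of_real s *\<^sub>C u" "of_real (inverse s) *\<^sub>C v"]
          by (simp only: times_divide_eq_right)
      qed
      then have "cmod (\<phi> (entry w u v)) \<le> \<gamma> * (norm u * (2 ^ length w * norm v))"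
        by (intro le_product_of_le_scaled_mean \<gamma>) auto
      then show ?thesis by (simp add: mult_ac)
    qed
    show ?thesis
    proof (rule sesquilinear_operator[of "\<lambda>u v. \<phi> (entry w u v)" "\<gamma> * 2 ^ length w"])
      show "cmod (\<phi> (entry w u v)) \<le> \<gamma> * 2 ^ length w * (norm u * norm v)" for u v by (rule entry_bound)
    qed (auto simp: entry_lin \<phi>_add[OF admissible_entry admissible_entry] \<phi>_scale[OF admissible_entry])
  qed
  then obtain x where x: "\<And>w. x w \<in> clinear_ops" "\<And>w u v. cinner (blinfun_apply (x w) u) v = \<phi> (entry w u v)"
    by metis
  have x': "range x \<subseteq> clinear_ops" using x by auto
  show ?thesis
  proof (rule that[OF x'])
    fix w assume w: "w \<in> \<Lambda>"
    \<comment> \<open>On \<open>Z\<close> the extension is evaluation at \<open>p\<close>, so over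
      \<open>\<Lambda>\<close> the recovered entries are those of \<open>p\<close>.\<close>
    have "entry w u v \<in> Z" for u v
      using admissible_entry w by (auto simp: Z_def entry_def)
    then have "cinner (blinfun_apply (x w) u) v = cinner (blinfun_apply (p w) u) v" for u v
      using \<phi>_Z x p by (simp add: entry_def)
    then have "blinfun_apply (x w) u = blinfun_apply (p w) u" for u
      by (rule cinner_left_eqI)
    then show "x w = p w"
      by (rule blinfun_eqI)
  next
    fix T :: "'d \<Rightarrow> 'h \<Rightarrow>\<^sub>L 'h" and N \<xi> \<eta>
    assume T: "T \<in> polydisc" and \<xi>: "\<xi> \<in> algebraic_tensors \<tau>" and \<eta>: "\<eta> \<in> algebraic_tensors \<tau>"
      and van: "vanishes_beyond \<tau> T N \<xi>"
    obtain G h k where G: "\<xi> = (\<Sum>g\<in>G. \<tau> g (h g))" "\<eta> = (\<Sum>g\<in>G. \<tau> g (k g))"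
      using algebraic_expansion[OF tau \<xi> \<eta>] by metis
    let ?I = "{w. length w \<le> N} \<times> (G \<times> G)"
    let ?a = "\<lambda>(w, g', g). cinner (blinfun_apply (word_op T w) (h g')) (k g)"
    let ?y = "\<lambda>(w, g', g). entry w g' g"
    \<comment> \<open>The scalars \<open>?a i\<close> depend on the tuple and the vectors only, so
      linearity of \<open>\<phi>\<close> applies with all coefficients collected in the
      entries.\<close>
    have eq: "test_functional \<tau> T N \<xi> \<eta> = (\<lambda>z. \<Sum>i\<in>?I. ?a i * ?y i z)"
    proof
      fix z :: "'d list \<Rightarrow> 'u \<Rightarrow>\<^sub>L 'u"
      show "test_functional \<tau> T N \<xi> \<eta> z = (\<Sum>i\<in>?I. ?a i * ?y i z)"
      proof (cases "range z \<subseteq> clinear_ops")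
        case True
        then have z: "z w \<in> clinear_ops" for w by auto
        have "test_functional \<tau> T N \<xi> \<eta> z = (\<Sum>w | length w \<le> N. \<Sum>g'\<in>G. \<Sum>g\<in>G.
            cinner (blinfun_apply (z w) g') g * cinner (blinfun_apply (word_op T w) (h g')) (k g))"
          using True by (simp add: test_functional_def G cinner_tensor_op_expansion[OF tau z polydisc_word[OF T]])
        also have "\<dots> = (\<Sum>w | length w \<le> N. \<Sum>g'\<in>G. \<Sum>g\<in>G. ?a (w, g', g) * ?y (w, g', g) z)"
          using True by (simp add: entry_def mult.commute)
        also have "\<dots> = (\<Sum>i\<in>?I. ?a i * ?y i z)"
          unfolding sum.cartesian_product by (intro sum.cong) auto
        finally show ?thesis .
      next
        case False
        then have "?a i * ?y i z = 0" for i
          by (cases i) (auto simp: entry_def)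
        then have "(\<Sum>i\<in>?I. ?a i * ?y i z) = 0"
          by (rule sum.neutral[OF ballI])
        then show ?thesis using False by (simp add: test_functional_def)
      qed
    qed
    have "\<phi> (test_functional \<tau> T N \<xi> \<eta>) = (\<Sum>i\<in>?I. ?a i * \<phi> (?y i))"
      unfolding eq by (rule \<phi>_sum[THEN conjunct2]) (use admissible_entry in auto)
    also have "\<dots> = (\<Sum>i\<in>?I. ?a i * ?y i x)"
      using x' by (intro sum.cong) (auto simp: entry_def x(2))
    also have "\<dots> = test_functional \<tau> T N \<xi> \<eta> x" by (simp add: eq)
    finally have "test_functional \<tau> T N \<xi> \<eta> x = \<phi> (test_functional \<tau> T N \<xi> \<eta>)" by simp
    moreover have "admissible \<tau> (test_functional \<tau> T N \<xi> \<eta>) (((norm \<xi>)\<^sup>2 + (norm \<eta>)\<^sup>2) / 2)"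
      unfolding admissible_def using T \<xi> \<eta> van by blast
    ultimately show "cmod (test_functional \<tau> T N \<xi> \<eta> x) \<le> \<gamma> * (((norm \<xi>)\<^sup>2 + (norm \<eta>)\<^sup>2) / 2)"
      using \<phi>_bound by metis
  qed
qed

section \<open>Evaluation of the extended series\<close>

text \<open>The form is unchanged under \<open>(s \<xi>, \<eta> / s)\<close>, which turns the mean
  into a product. Density then removes the restriction to algebraic tensors, first for
  \<open>\<eta>\<close>, then for \<open>\<xi>\<close>.\<close>

lemma norm_le_of_quadratic_bound:
  assumes \<gamma>: "0 \<le> \<gamma>"
    and le: "\<And>\<xi> \<eta>. \<xi> \<in> algebraic_tensors \<tau> \<Longrightarrow> \<eta> \<in> algebraic_tensors \<tau> \<Longrightarrow>
      cmod (cinner (blinfun_apply A \<xi>) \<eta>) \<le> \<gamma> * (((norm \<xi>)\<^sup>2 + (norm \<eta>)\<^sup>2) / 2)"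
  shows "norm A \<le> \<gamma>"
proof -
  have alg: "cmod (cinner (blinfun_apply A \<xi>) \<eta>) \<le> \<gamma> * (norm \<xi> * norm \<eta>)"
    if \<xi>: "\<xi> \<in> algebraic_tensors \<tau>" and \<eta>: "\<eta> \<in> algebraic_tensors \<tau>" for \<xi> \<eta>
  proof (rule le_product_of_le_scaled_mean[OF norm_ge_zero norm_ge_zero \<gamma>])
    fix s :: real assume s: "0 < s"
    have "s *\<^sub>R \<xi> \<in> algebraic_tensors \<tau>" "inverse s *\<^sub>R \<eta> \<in> algebraic_tensors \<tau>"
      unfolding scaleC_of_real[symmetric] by (intro algebraic_scale[OF tau] \<xi> \<eta>)+
    note bd = le[OF this]
    have e: "cinner (blinfun_apply A (s *\<^sub>R \<xi>)) (inverse s *\<^sub>R \<eta>) = cinner (blinfun_apply A \<xi>) \<eta>"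
      using s by (simp add: blinfun.scaleR_right cinner_scaleR_left cinner_scaleR_right)
    have n: "norm (s *\<^sub>R \<xi>) = s * norm \<xi>" "norm (inverse s *\<^sub>R \<eta>) = norm \<eta> / s"
      using s by (simp_all add: divide_inverse mult.commute[of "norm \<eta>"])
    show "cmod (cinner (blinfun_apply A \<xi>) \<eta>) \<le> \<gamma> * (((s * norm \<xi>)\<^sup>2 + (norm \<eta> / s)\<^sup>2) / 2)"
      using bd unfolding e n .
  qed
  have cont: "continuous_on UNIV (\<lambda>x. cmod (cinner (y::'k) x))" for y
    by (intro continuous_intros linear_continuous_on bounded_linear_cinner_right)
  have half: "cmod (cinner (blinfun_apply A \<xi>) \<eta>) \<le> \<gamma> * (norm \<xi> * norm \<eta>)"
    if \<xi>: "\<xi> \<in> algebraic_tensors \<tau>" for \<xi> \<eta>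
  proof (induction \<eta> rule: algebraic_dense_induct[OF tau])
    case 1
    show ?case by (intro closed_Collect_le cont continuous_intros)
  qed (rule alg[OF \<xi>])
  have est: "norm (blinfun_apply A \<xi>) \<le> \<gamma> * norm \<xi>" for \<xi>
  proof (induction \<xi> rule: algebraic_dense_induct[OF tau])
    case 1
    show ?case by (intro closed_Collect_le continuous_intros)
  next
    case (2 \<xi>)
    show ?case
    proof (cases "blinfun_apply A \<xi> = 0")
      case False
      have "(norm (blinfun_apply A \<xi>))\<^sup>2 \<le> \<gamma> * (norm \<xi> * norm (blinfun_apply A \<xi>))"
        using half[OF 2, of "blinfun_apply A \<xi>"] by (simp add: cinner_self norm_power)
      then show ?thesis using False by (simp add: power2_eq_square mult_ac)
    qed (use \<gamma> in simp)
  qed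
  show ?thesis by (rule norm_blinfun_bound[OF \<gamma> est])
qed

section \<open>Series whose test functionals satisfy the bound\<close>

context
  fixes x :: "'d::finite list \<Rightarrow> 'u \<Rightarrow>\<^sub>L 'u" and \<gamma> :: real
  assumes x: "range x \<subseteq> clinear_ops" and \<gamma>: "0 \<le> \<gamma>"
    and bound: "\<And>(T :: 'd \<Rightarrow> 'h \<Rightarrow>\<^sub>L 'h) N \<xi> \<eta>. T \<in> polydisc \<Longrightarrow> \<xi> \<in> algebraic_tensors \<tau> \<Longrightarrow>
      \<eta> \<in> algebraic_tensors \<tau> \<Longrightarrow> vanishes_beyond \<tau> T N \<xi> \<Longrightarrow>
      cmod (test_functional \<tau> T N \<xi> \<eta> x) \<le> \<gamma> * (((norm \<xi>)\<^sup>2 + (norm \<eta>)\<^sup>2) / 2)"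
begin

text \<open>The hypothesis \<open>bound\<close> covers only tuples that vanish beyond some length on
  the vector. Passing to the shifted tuple reaches an arbitrary \<open>T\<close>, and unit weights
  \<open>a\<close>, \<open>b\<close> keep the norms from growing.\<close>

lemma shifted_bound:
  fixes T :: "'d \<Rightarrow> 'h \<Rightarrow>\<^sub>L 'h" and a b :: "nat \<Rightarrow> real"
  assumes T: "T \<in> polydisc" and \<xi>: "\<xi> \<in> algebraic_tensors \<tau>" and \<eta>: "\<eta> \<in> algebraic_tensors \<tau>"
    and a: "(\<Sum>m\<le>N. (a m)\<^sup>2) = 1" and b: "(\<Sum>m\<le>N. (b m)\<^sup>2) = 1"
  shows "cmod (\<Sum>j\<le>N. of_real (\<Sum>m=j..N. a m * b (m - j)) * cinner (blinfun_apply (homogeneous_part \<tau> x T j) \<xi>) \<eta>)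
    \<le> \<gamma> * (((norm \<xi>)\<^sup>2 + (norm \<eta>)\<^sup>2) / 2)"
proof -
  obtain S \<xi>' \<eta>' where S: "S \<in> polydisc" "\<xi>' \<in> algebraic_tensors \<tau>" "\<eta>' \<in> algebraic_tensors \<tau>"
    "vanishes_beyond \<tau> S N \<xi>'"
    and eq: "\<And>x. range x \<subseteq> clinear_ops \<Longrightarrow> test_functional \<tau> S N \<xi>' \<eta>' x =
      (\<Sum>j\<le>N. of_real (\<Sum>m=j..N. a m * b (m - j)) * cinner (blinfun_apply (homogeneous_part \<tau> x T j) \<xi>) \<eta>)"
    and norms: "(norm \<xi>')\<^sup>2 \<le> (\<Sum>m\<le>N. (a m)\<^sup>2) * (norm \<xi>)\<^sup>2" "(norm \<eta>')\<^sup>2 \<le> (\<Sum>m\<le>N. (b m)\<^sup>2) * (norm \<eta>)\<^sup>2"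
    using shift_functional[OF tau inf T \<xi> \<eta>, of N a b] by blast
  have "cmod (test_functional \<tau> S N \<xi>' \<eta>' x) \<le> \<gamma> * (((norm \<xi>')\<^sup>2 + (norm \<eta>')\<^sup>2) / 2)"
    by (rule bound[OF S])
  also have "\<dots> \<le> \<gamma> * (((norm \<xi>)\<^sup>2 + (norm \<eta>)\<^sup>2) / 2)"
    using norms unfolding a b mult_1_left
    by (intro mult_left_mono \<gamma> divide_right_mono add_mono) auto
  finally show ?thesis by (simp add: eq[OF x])
qed

lemma norm_homogeneous_part_le:
  fixes T :: "'d \<Rightarrow> 'h \<Rightarrow>\<^sub>L 'h"
  assumes T: "T \<in> polydisc"
  shows "norm (homogeneous_part \<tau> x T n) \<le> \<gamma>"
proof (rule norm_le_of_quadratic_bound[OF \<gamma>])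
  fix \<xi> \<eta> assume \<xi>: "\<xi> \<in> algebraic_tensors \<tau>" and \<eta>: "\<eta> \<in> algebraic_tensors \<tau>"
  \<comment> \<open>Starting in copy \<open>n\<close> and reading off in copy \<open>0\<close>
    selects the words of length exactly \<open>n\<close>.\<close>
  define a b :: "nat \<Rightarrow> real" where "a m = (if m = n then 1 else 0)" and "b m = (if m = 0 then 1 else 0)" for m
  have "(\<Sum>m=j..n. a m * b (m - j)) = (if j = n then 1 else 0)" if "j \<le> n" for j
  proof -
    have "(\<Sum>m=j..n. a m * b (m - j)) = (\<Sum>m=j..n. if m = n then b (n - j) else 0)"
      by (intro sum.cong) (auto simp: a_def)
    then show ?thesis using that by (simp add: b_def)
  qed
  then have "(\<Sum>j\<le>n. of_real (\<Sum>m=j..n. a m * b (m - j)) * cinner (blinfun_apply (homogeneous_part \<tau> x T j) \<xi>) \<eta>)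
      = (\<Sum>j\<le>n. if j = n then cinner (blinfun_apply (homogeneous_part \<tau> x T n) \<xi>) \<eta> else 0)"
    by (intro sum.cong) auto
  also have "\<dots> = cinner (blinfun_apply (homogeneous_part \<tau> x T n) \<xi>) \<eta>" by simp
  finally have eq: "(\<Sum>j\<le>n. of_real (\<Sum>m=j..n. a m * b (m - j)) * cinner (blinfun_apply (homogeneous_part \<tau> x T j) \<xi>) \<eta>)
      = cinner (blinfun_apply (homogeneous_part \<tau> x T n) \<xi>) \<eta>" .
  have "(\<Sum>m\<le>n. (a m)\<^sup>2) = 1" "(\<Sum>m\<le>n. (b m)\<^sup>2) = 1"
    by (simp_all add: a_def b_def if_distrib[of "\<lambda>t. t\<^sup>2"] cong: if_cong)
  from shifted_bound[OF T \<xi> \<eta> this]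
  show "cmod (cinner (blinfun_apply (homogeneous_part \<tau> x T n) \<xi>) \<eta>) \<le> \<gamma> * (((norm \<xi>)\<^sup>2 + (norm \<eta>)\<^sup>2) / 2)"
    unfolding eq .
qed

text \<open>The open polydisc leaves room to divide \<open>T\<close> by some \<open>r < 1\<close>;
  the part of degree \<open>j\<close> at \<open>T\<close> is \<open>r ^ j\<close> times the one at
  \<open>T / r\<close>, to which the uniform bound applies.\<close>

lemma homogeneous_part_geometric:
  fixes T :: "'d \<Rightarrow> 'h \<Rightarrow>\<^sub>L 'h"
  assumes T: "T \<in> polydisc"
  obtains r where "0 < r" "r < 1" "\<And>j. norm (homogeneous_part \<tau> x T j) \<le> \<gamma> * r ^ j"
proof -
  obtain r where r: "0 < r" "r < 1" "\<And>j. norm (T j) < r"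
    using polydisc_radius[OF T] by blast
  define T' where "T' j = inverse r *\<^sub>R T j" for j
  have T': "T' \<in> polydisc"
    using r polydisc_clinear[OF T]
    by (auto simp: polydisc_def T'_def clinear_scaleR field_simps)
  have word: "word_op T w = r ^ length w *\<^sub>R word_op T' w" for w
  proof (induction w)
    case (Cons j w)
    have "T j = r *\<^sub>R T' j" using r by (simp add: T'_def)
    then show ?case
      by (intro blinfun_eqI) (simp add: Cons blinfun.scaleR_left blinfun.scaleR_right)
  qed simp
  have "homogeneous_part \<tau> x T j = r ^ j *\<^sub>R homogeneous_part \<tau> x T' j" for j
  proof -
    have "x w \<in> clinear_ops" for w using x by auto
    then show ?thesis
      unfolding homogeneous_part_def scaleR_sum_right
      by (intro sum.cong refl)
        (simp only: word mem_Collect_eq tensor_op_scaleR_right[OF tau _ polydisc_word[OF T']])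
  qed
  then have "norm (homogeneous_part \<tau> x T j) \<le> \<gamma> * r ^ j" for j
    using norm_homogeneous_part_le[OF T', of j] r by (simp add: mult.commute mult_left_mono)
  with r show ?thesis using that by blast
qed

lemma series_converges_bounded:
  fixes T :: "'d \<Rightarrow> 'h \<Rightarrow>\<^sub>L 'h"
  assumes T: "T \<in> polydisc"
  shows "series_converges \<tau> x T"
proof -
  obtain r where r: "0 < r" "r < 1" "\<And>j. norm (homogeneous_part \<tau> x T j) \<le> \<gamma> * r ^ j"
    using homogeneous_part_geometric[OF T] by blast
  then have "summable (\<lambda>j. \<gamma> * r ^ j)"
    by (intro summable_mult summable_geometric) simp
  then show ?thesis
    unfolding series_converges_def by (rule summable_comparison_test') (rule r(3))
qed

text \<open>Fejer means, unlike longer partial sums, have the form covered by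
  \<open>shifted_bound\<close>; the geometric decay makes them converge to the series.\<close>

lemma norm_series_eval_le:
  fixes T :: "'d \<Rightarrow> 'h \<Rightarrow>\<^sub>L 'h"
  assumes T: "T \<in> polydisc"
  shows "norm (series_eval \<tau> x T) \<le> \<gamma>"
proof (rule norm_le_of_quadratic_bound[OF \<gamma>])
  fix \<xi> \<eta> assume \<xi>: "\<xi> \<in> algebraic_tensors \<tau>" and \<eta>: "\<eta> \<in> algebraic_tensors \<tau>"
  obtain r where r: "0 < r" "r < 1" "\<And>j. norm (homogeneous_part \<tau> x T j) \<le> \<gamma> * r ^ j"
    using homogeneous_part_geometric[OF T] by blast
  define c where "c j = cinner (blinfun_apply (homogeneous_part \<tau> x T j) \<xi>) \<eta>" for j
  have lin: "bounded_linear (\<lambda>A. cinner (blinfun_apply A \<xi>) \<eta>)"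
    by (rule bounded_linear_compose[OF bounded_linear_cinner_left blinfun.bounded_linear_left])
  have sum: "c sums cinner (blinfun_apply (series_eval \<tau> x T) \<xi>) \<eta>"
    unfolding c_def series_eval_def
    by (rule bounded_linear.sums[OF lin summable_sums])
      (use series_converges_bounded[OF T] in \<open>simp add: series_converges_def\<close>)
  have c_le: "norm (c j) \<le> \<gamma> * norm \<xi> * norm \<eta> * r ^ j" for j
  proof -
    have "norm (c j) \<le> norm (blinfun_apply (homogeneous_part \<tau> x T j) \<xi>) * norm \<eta>"
      unfolding c_def by (rule cmod_cinner_le)
    also have "\<dots> \<le> (\<gamma> * r ^ j * norm \<xi>) * norm \<eta>"
      by (intro mult_right_mono order_trans[OF norm_blinfun] r) auto
    finally show ?thesis by (simp add: mult_ac)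
  qed
  have "summable (\<lambda>j. of_nat j * c j)"
  proof (rule summable_comparison_test')
    have "summable (\<lambda>j. of_nat (Suc j) * r ^ j)"
      using r(1,2) by (intro sums_summable[OF geometric_deriv_sums]) simp
    then have "summable (\<lambda>j. real j * r ^ j)"
      by (rule summable_comparison_test'[of _ 0]) (use r(1) in simp)
    then show "summable (\<lambda>j. \<gamma> * norm \<xi> * norm \<eta> * (real j * r ^ j))" by (rule summable_mult)
    show "norm (of_nat j * c j) \<le> \<gamma> * norm \<xi> * norm \<eta> * (real j * r ^ j)" if "0 \<le> j" for j
      using mult_left_mono[OF c_le, of "real j" j] by (simp add: norm_mult mult_ac)
  qed
  then have lim: "(\<lambda>N. \<Sum>j\<le>N. of_real (real (Suc N - j) / real (Suc N)) * c j) \<longlonglongrightarrow> suminf c"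
    by (intro fejer_means_tendsto sums_summable[OF sum])
  have "cmod (\<Sum>j\<le>N. of_real (real (Suc N - j) / real (Suc N)) * c j) \<le> \<gamma> * (((norm \<xi>)\<^sup>2 + (norm \<eta>)\<^sup>2) / 2)" for N
  proof -
    \<comment> \<open>The unit vector with equal weights: \<open>N + 1 - j\<close> products, each
      \<open>1 / (N + 1)\<close>, add up to the Fejer weight.\<close>
    define a :: "nat \<Rightarrow> real" where "a m = 1 / sqrt (real (Suc N))" for m
    have aa: "a m * a k = 1 / real (Suc N)" "(a m)\<^sup>2 = 1 / real (Suc N)" for m k
      by (simp_all add: a_def power_divide)
    have "(\<Sum>m=j..N. a m * a (m - j)) = real (Suc N - j) / real (Suc N)" for j
      by (simp add: aa)
    moreover have "(\<Sum>m\<le>N. (a m)\<^sup>2) = 1"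
      by (simp add: aa)
    ultimately show ?thesis
      using shifted_bound[OF T \<xi> \<eta>, where N = N and a = a and b = a] by (simp add: c_def)
  qed
  then have "cmod (suminf c) \<le> \<gamma> * (((norm \<xi>)\<^sup>2 + (norm \<eta>)\<^sup>2) / 2)"
    by (intro LIMSEQ_le_const2[OF tendsto_norm[OF lim]]) auto
  then show "cmod (cinner (blinfun_apply (series_eval \<tau> x T) \<xi>) \<eta>) \<le> \<gamma> * (((norm \<xi>)\<^sup>2 + (norm \<eta>)\<^sup>2) / 2)"
    using sums_unique[OF sum] by simp
qed

end
end

theorem theorem6:
  fixes \<tau> :: "'u::complex_hilbert \<Rightarrow> 'h::complex_hilbert \<Rightarrow> 'k::complex_hilbert"
    and \<Lambda> :: "'d::finite list set"
    and p :: "'d list \<Rightarrow> 'u \<Rightarrow>\<^sub>L 'u"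
  assumes "separable_space (euclidean :: 'h topology)"
    and "infinite_dimensional TYPE('h)"
    and "separable_space (euclidean :: 'u topology)"
    and "hilbert_tensor \<tau>"
    and "initial_segment \<Lambda>" and "infinite \<Lambda>"
    and "\<And>w. w \<in> \<Lambda> \<Longrightarrow> p w \<in> clinear_ops"
    and "\<And>w. w \<notin> \<Lambda> \<Longrightarrow> p w = 0"
    and "\<And>X. X \<in> polydisc \<Longrightarrow> series_converges \<tau> p X"
    and "series_norm \<tau> p < \<infinity>"
  shows "\<exists>x :: 'd list \<Rightarrow> 'u \<Rightarrow>\<^sub>L 'u.
    (\<forall>w. x w \<in> clinear_ops) \<and>
    (\<forall>w\<in>\<Lambda>. x w = p w) \<and>
    (\<forall>T\<in>polydisc. series_converges \<tau> x T) \<and>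
    series_norm \<tau> x = (SUP T\<in>{T\<in>polydisc. nilpotent_tuple \<Lambda> T}. ennreal (norm (series_eval \<tau> p T)))"
proof -
  note inf = assms(2) and tau = assms(4)
  let ?N = "{T :: 'd \<Rightarrow> 'h \<Rightarrow>\<^sub>L 'h. T \<in> polydisc \<and> nilpotent_tuple \<Lambda> T}"
  define s where "s = (SUP T\<in>?N. ennreal (norm (series_eval \<tau> p T)))"
  define \<gamma> where "\<gamma> = enn2real s"
  \<comment> \<open>Finiteness of the supremum is what allows the real bound \<open>\<gamma>\<close>
    to be extracted from an extended real.\<close>
  have "s \<le> series_norm \<tau> p"
    unfolding s_def series_norm_def by (rule SUP_subset_mono) auto
  then have "s < top"
    using assms(10) by (simp add: order_le_less_trans)
  then have s: "s = ennreal \<gamma>" and \<gamma>: "0 \<le> \<gamma>"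
    by (simp_all add: \<gamma>_def)
  have bound: "norm (series_eval \<tau> p T) \<le> \<gamma>" if "T \<in> polydisc" "nilpotent_tuple \<Lambda> T" for T :: "'d \<Rightarrow> 'h \<Rightarrow>\<^sub>L 'h"
  proof -
    have "ennreal (norm (series_eval \<tau> p T)) \<le> s"
      unfolding s_def by (rule SUP_upper) (use that in simp)
    then show ?thesis using \<gamma> by (simp add: s)
  qed
  have p: "range p \<subseteq> clinear_ops"
    using assms(7,8) clinear_zero by fastforce
  obtain x where x: "range x \<subseteq> clinear_ops" "\<And>w. w \<in> \<Lambda> \<Longrightarrow> x w = p w"
    and test: "\<And>(T :: 'd \<Rightarrow> 'h \<Rightarrow>\<^sub>L 'h) N \<xi> \<eta>. T \<in> polydisc \<Longrightarrow> \<xi> \<in> algebraic_tensors \<tau> \<Longrightarrow>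
      \<eta> \<in> algebraic_tensors \<tau> \<Longrightarrow> vanishes_beyond \<tau> T N \<xi> \<Longrightarrow>
      cmod (test_functional \<tau> T N \<xi> \<eta> x) \<le> \<gamma> * (((norm \<xi>)\<^sup>2 + (norm \<eta>)\<^sup>2) / 2)"
    using nilpotent_extension[OF tau inf p assms(5) _ \<gamma> bound] assms(6) by auto
  have xw: "x w \<in> clinear_ops" for w using x(1) by auto
  have conv: "series_converges \<tau> x T" if "T \<in> polydisc" for T :: "'d \<Rightarrow> 'h \<Rightarrow>\<^sub>L 'h"
    by (rule series_converges_bounded[OF tau inf x(1) \<gamma> test that])
  have le: "norm (series_eval \<tau> x T) \<le> \<gamma>" if "T \<in> polydisc" for T :: "'d \<Rightarrow> 'h \<Rightarrow>\<^sub>L 'h"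
    by (rule norm_series_eval_le[OF tau inf x(1) \<gamma> test that])
  have "series_norm \<tau> x \<le> s"
    unfolding series_norm_def s using le by (intro SUP_least ennreal_leI)
  moreover have "s \<le> series_norm \<tau> x"
  proof -
    \<comment> \<open>A \<open>\<Lambda>\<close>-nilpotent tuple kills every word outside
      \<open>\<Lambda>\<close>, and over \<open>\<Lambda>\<close> the coefficients agree; so the
      supremum for \<open>p\<close> is part of the norm of \<open>x\<close>.\<close>
    have "series_eval \<tau> p T = series_eval \<tau> x T" if "nilpotent_tuple \<Lambda> T" for T :: "'d \<Rightarrow> 'h \<Rightarrow>\<^sub>L 'h"
    proof -
      have "tensor_op \<tau> (p w) (word_op T w) = tensor_op \<tau> (x w) (word_op T w)" for w
      proof (cases "w \<in> \<Lambda>")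
        case False
        then have "word_op T w = 0" using that by (simp add: nilpotent_tuple_def)
        moreover have "p w \<in> clinear_ops" using p by auto
        ultimately show ?thesis by (simp add: tensor_op_zero_right[OF tau] xw)
      qed (simp add: x(2))
      then have "homogeneous_part \<tau> p T = homogeneous_part \<tau> x T"
        by (simp add: homogeneous_part_def fun_eq_iff)
      then show ?thesis by (simp add: series_eval_def)
    qed
    then show ?thesis
      unfolding s_def series_norm_def by (intro SUP_mono) auto
  qed
  ultimately have "series_norm \<tau> x = s" by (rule antisym)
  then show ?thesis
    using xw x(2) conv unfolding s_def by blast
qed

end
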